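(* Let $M$ be an infinite-horizon discounted-reward MDP with MNL transitions and discount factor $\gamma\in[0,1)$, satisfying (A1)–(A3). Let $\delta\in(0,1)$, $\eta=\frac12\log\mathcal{U}+(L_\theta L_\varphi+1)$, $\lambda\ge84\sqrt2(L_\theta L_\varphi^3+dL_\varphi^2)\eta$, and $N\ge\log(\sqrt T/d)/(1-\gamma)$. Then the (non-stationary) policy $\pi$ of \texttt{UCMNLK} run with discount $\gamma$ guarantees, with probability at least $1-2\delta$, $\mathrm{Regret}(\pi,T)=\tilde{\mathcal O}\big(f(L_\theta,L_\varphi)(d(1-\gamma)^{-2}\sqrt T+\kappa^{-1}d^2(1-\gamma)^{-2})\big)$, where $f$ is a polynomial in $(L_\theta,L_\varphi)$ and $\tilde{\mathcal O}$ hides logarithmic factors of $T,\mathcal U,1/\delta$.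
   Context: MDP: finite $\mathcal{S},\mathcal{A}$, known reward $r:\mathcal{S}\times\mathcal{A}\to[0,1]$; known reachable sets $\mathcal{S}_{s,a}$ and features $\varphi(s,a,s')\in\mathbb{R}^d$; transitions $p(s'\mid s,a,\theta^* )$ with $p(s'\mid s,a,\theta)=\exp(\varphi(s,a,s')^\top\theta)/\sum_{s''\in\mathcal{S}_{s,a}}\exp(\varphi(s,a,s'')^\top\theta)$ on $\mathcal{S}_{s,a}$; $\mathcal U=\max|\mathcal{S}_{s,a}|$. For a history-dependent policy $\pi$, $V^\pi_t(s)=\mathbb{E}[\sum_{i\ge0}\gamma^ir(s_{t+i},a_{t+i})\mid s_t=s]$ (given the history); $V^*(s)=\max_\pi V^\pi_1(s)$; $\mathrm{Regret}(\pi,T)=\sum_{t=1}^TV^*(s_t)-\sum_{t=1}^TV^\pi_t(s_t)$. Assumptions: (A1) $\|\varphi\|_2\le L_\varphi$, $\|\theta^*\|_2\le L_\theta$, $\Theta=\{\|\theta\|_2\le L_\theta\}$; (A2) $\kappa\in(0,1)$ with $\inf_{\theta\in\Theta}p(s'\mid s_t,a_t,\theta)p(s''\mid s_t,a_t,\theta)\ge\kappa$ for all $t\in[T]$, $s',s''\in\mathcal{S}_{s_t,a_t}$; (A3) each $\mathcal{S}_{s,a}$ contains $s'$ with $\varphi(s,a,s')=0$. Estimator, confidence polytopes $\mathcal{P}_t$ (with radii $\beta_t=f_0(L_\theta,L_\varphi)\sqrt d(\log(\mathcal Ut/\delta))^2$, $f_0$ a fixed polynomial for which $\|\widehat\theta_t-\theta^*\|_{\Sigma_t}\le\beta_t$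 for all $t$ w.p. $\ge1-\delta$), \texttt{DEVI} and \texttt{UCMNLK}: exactly as follows. $\ell_t(\theta)=-\sum_{s'\in\mathcal{S}_{s_t,a_t}}\mathbf1\{s_{t+1}=s'\}\log p(s'\mid s_t,a_t,\theta)$; $\widehat\theta_1=0$, $\Sigma_1=\lambda I_d$, $\widehat\Sigma_t=\Sigma_t+\eta\nabla^2\ell_t(\widehat\theta_t)$, $\widehat\theta_{t+1}=\arg\min_{\theta\in\Theta}\{\nabla\ell_t(\widehat\theta_t)^\top(\theta-\widehat\theta_t)+\frac1{2\eta}\|\theta-\widehat\theta_t\|^2_{\widehat\Sigma_t}\}$, $\Sigma_{t+1}=\Sigma_t+\nabla^2\ell_t(\widehat\theta_{t+1})$. $\mathcal P_t$: all $p\in[0,1]^{\mathcal S\times\mathcal A\times\mathcal S}$ with $\sum_{s'\in\mathcal S_{s,a}}p_{s,a,s'}=1$ and $\sum_{s'\in\mathcal S_{s,a}}|p_{s,a,s'}-p(s'\mid s,a,\widehat\theta_t)|\le\beta_t\sum_{s'}p(s'\mid s,a,\widehat\theta_t)\|\varphi(s,a,s')-\sum_{s''}p(s''\mid s,a,\widehat\theta_t)\varphi(s,a,s'')\|_{\Sigma_t^{-1}}+3\beta_t^2\max_{s'}\|\varphi(s,a,s')\|^2_{\Sigma_t^{-1}}$ for all $(s,a)$. \texttt{DEVI}$(\gamma,\mathcal P,N)$: $Q^{(0)}\equiv1/(1-\gamma)$, $V^{(n-1)}(s)=\max_aQ^{(n-1)}(s,a)$, $Q^{(n)}(s,a)=r(s,a)+\gamma\max_{p\in\mathcal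 P}\sum_{s'\in\mathcal S_{s,a}}p_{s,a,s'}V^{(n-1)}(s')$ for $n=1..N$, return $Q^{(N)}$. \texttt{UCMNLK}: for episodes $k$: $t_k=t$, $Q_k=\texttt{DEVI}(\gamma,\mathcal P_{t_k},N)$, $\pi_k(s)\in\arg\max_aQ_k(s,a)$; while $\det\Sigma_t\le2\det\Sigma_{t_k}$, play $a_t=\pi_k(s_t)$, observe $s_{t+1}$, update, $t\leftarrow t+1$. *)

theory Defs
  imports "Jordan_Normal_Form.Gauss_Jordan_Elimination" "Jordan_Normal_Form.Determinant"
          "HOL-Probability.Probability_Mass_Function"
begin

definition poly2 :: "(real \<Rightarrow> real \<Rightarrow> real) \<Rightarrow> bool" where
  "poly2 f \<longleftrightarrow> (\<exists>n::nat. \<exists>c::nat \<Rightarrow> nat \<Rightarrow> real.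
      \<forall>x y. f x y = (\<Sum>i\<le>n. \<Sum>j\<le>n. c i j * x ^ i * y ^ j))"

definition vnorm :: "real Matrix.vec \<Rightarrow> real" where
  "vnorm x = sqrt (scalar_prod x x)"

definition wnorm :: "real mat \<Rightarrow> real Matrix.vec \<Rightarrow> real" where
  "wnorm M x = sqrt (scalar_prod x (M *\<^sub>v x))"

definition minv :: "real mat \<Rightarrow> real mat" where
  "minv M = the (mat_inverse M)"

definition pdiff :: "nat \<Rightarrow> (real Matrix.vec \<Rightarrow> real) \<Rightarrow> real Matrix.vec \<Rightarrow> nat \<Rightarrow> real" where
  "pdiff d f \<theta> i = deriv (\<lambda>x. f (Matrix.vec d (\<lambda>j. if j = i then x else vec_index \<theta> j))) (vec_index \<theta> i)"

definition grad :: "nat \<Rightarrow> (real Matrix.vec \<Rightarrow> real) \<Rightarrow> real Matrix.vec \<Rightarrow> real Matrix.vec" where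
  "grad d f \<theta> = Matrix.vec d (pdiff d f \<theta>)"

definition hess :: "nat \<Rightarrow> (real Matrix.vec \<Rightarrow> real) \<Rightarrow> real Matrix.vec \<Rightarrow> real mat" where
  "hess d f \<theta> = Matrix.mat d d (\<lambda>(i, j). pdiff d (\<lambda>\<theta>'. pdiff d f \<theta>' i) \<theta> j)"

definition Theta :: "nat \<Rightarrow> real \<Rightarrow> real Matrix.vec set" where
  "Theta d L\<theta> = {\<theta> \<in> carrier_vec d. vnorm \<theta> \<le> L\<theta>}"

text \<open>States and actions are natural numbers; Ssa s a is the reachable set,
  phi s a s' the feature vector.\<close>

definition mnl :: "(nat \<Rightarrow> nat \<Rightarrow> nat \<Rightarrow> real Matrix.vec) \<Rightarrow> (nat \<Rightarrow> nat \<Rightarrow> nat set)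
    \<Rightarrow> real Matrix.vec \<Rightarrow> nat \<Rightarrow> nat \<Rightarrow> nat \<Rightarrow> real" where
  "mnl \<phi> Ssa \<theta> s a s' =
     (if s' \<in> Ssa s a then exp (scalar_prod (\<phi> s a s') \<theta>) /
        (\<Sum>s''\<in>Ssa s a. exp (scalar_prod (\<phi> s a s'') \<theta>)) else 0)"

definition trans_pmf :: "(nat \<Rightarrow> nat \<Rightarrow> nat \<Rightarrow> real Matrix.vec) \<Rightarrow> (nat \<Rightarrow> nat \<Rightarrow> nat set)
    \<Rightarrow> real Matrix.vec \<Rightarrow> nat \<Rightarrow> nat \<Rightarrow> nat pmf" where
  "trans_pmf \<phi> Ssa \<theta> s a = embed_pmf (mnl \<phi> Ssa \<theta> s a)"

text \<open>A history at time t is ([(s_1,a_1),...,(s_{t-1},a_{t-1})], s_t).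
  A (possibly randomized) history-dependent policy maps histories to action distributions.\<close>

type_synonym hist = "(nat \<times> nat) list \<times> nat"

definition step_pmf :: "(nat \<Rightarrow> nat \<Rightarrow> nat pmf) \<Rightarrow> (hist \<Rightarrow> nat pmf) \<Rightarrow> hist \<Rightarrow> hist pmf" where
  "step_pmf P \<pi> h = bind_pmf (\<pi> h) (\<lambda>a. map_pmf (\<lambda>s'. (fst h @ [(snd h, a)], s')) (P (snd h) a))"

fun run_pmf :: "(nat \<Rightarrow> nat \<Rightarrow> nat pmf) \<Rightarrow> (hist \<Rightarrow> nat pmf) \<Rightarrow> hist \<Rightarrow> nat \<Rightarrow> hist pmf" where
  "run_pmf P \<pi> h 0 = return_pmf h"
| "run_pmf P \<pi> h (Suc n) = bind_pmf (run_pmf P \<pi> h n) (step_pmf P \<pi>)"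

definition Vpi :: "real \<Rightarrow> (nat \<Rightarrow> nat \<Rightarrow> real) \<Rightarrow> (nat \<Rightarrow> nat \<Rightarrow> nat pmf)
    \<Rightarrow> (hist \<Rightarrow> nat pmf) \<Rightarrow> hist \<Rightarrow> real" where
  "Vpi \<gamma> r P \<pi> h = (\<Sum>i. \<gamma> ^ i * measure_pmf.expectation (run_pmf P \<pi> h i)
       (\<lambda>h'. measure_pmf.expectation (\<pi> h') (\<lambda>a. r (snd h') a)))"

definition policies :: "nat set \<Rightarrow> (hist \<Rightarrow> nat pmf) set" where
  "policies A = {\<pi>. \<forall>h. set_pmf (\<pi> h) \<subseteq> A}"

definition Vstar :: "real \<Rightarrow> (nat \<Rightarrow> nat \<Rightarrow> real) \<Rightarrow> (nat \<Rightarrow> nat \<Rightarrow> nat pmf) \<Rightarrow> nat set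
    \<Rightarrow> nat \<Rightarrow> real" where
  "Vstar \<gamma> r P A s = (SUP \<pi> \<in> policies A. Vpi \<gamma> r P \<pi> ([], s))"

text \<open>Prefix of a history: the history at time i+1 (i = 0,1,...).\<close>
definition hprefix :: "hist \<Rightarrow> nat \<Rightarrow> hist" where
  "hprefix h i = (take i (fst h), if i < length (fst h) then fst (fst h ! i) else snd h)"

text \<open>Regret(pi,T) = sum_{t=1}^T V*(s_t) - V^pi_t(s_t), as a function of the history at time T.\<close>
definition regret :: "real \<Rightarrow> (nat \<Rightarrow> nat \<Rightarrow> real) \<Rightarrow> (nat \<Rightarrow> nat \<Rightarrow> nat pmf) \<Rightarrow> nat set
    \<Rightarrow> (hist \<Rightarrow> nat pmf) \<Rightarrow> nat \<Rightarrow> hist \<Rightarrow> real" where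
  "regret \<gamma> r P A \<pi> T h = (\<Sum>i<T. Vstar \<gamma> r P A (snd (hprefix h i)))
                         - (\<Sum>i<T. Vpi \<gamma> r P \<pi> (hprefix h i))"

definition transitions :: "hist \<Rightarrow> (nat \<times> nat \<times> nat) list" where
  "transitions h = map (\<lambda>i. (fst (fst h ! i), snd (fst h ! i),
        if Suc i < length (fst h) then fst (fst h ! Suc i) else snd h)) [0..<length (fst h)]"

record ucparams =
  pS :: "nat set"
  pA :: "nat set"
  rew :: "nat \<Rightarrow> nat \<Rightarrow> real"
  pSsa :: "nat \<Rightarrow> nat \<Rightarrow> nat set"
  phi :: "nat \<Rightarrow> nat \<Rightarrow> nat \<Rightarrow> real Matrix.vec"
  dim :: nat
  Lth :: real
  disc :: real
  eta :: real
  lam :: real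
  del :: real
  NN :: nat
  beta :: "nat \<Rightarrow> real"

definition UU :: "nat set \<Rightarrow> nat set \<Rightarrow> (nat \<Rightarrow> nat \<Rightarrow> nat set) \<Rightarrow> nat" where
  "UU S A Ssa = Max {card (Ssa s a) | s a. s \<in> S \<and> a \<in> A}"

definition beta0 :: "(real \<Rightarrow> real \<Rightarrow> real) \<Rightarrow> real \<Rightarrow> real \<Rightarrow> nat \<Rightarrow> nat \<Rightarrow> real \<Rightarrow> nat \<Rightarrow> real" where
  "beta0 f0 L\<theta> L\<phi> d U \<delta> t = f0 L\<theta> L\<phi> * sqrt (real d) * (ln (real U * real t / \<delta>)) ^ 2"

definition mean_feat :: "ucparams \<Rightarrow> real Matrix.vec \<Rightarrow> nat \<Rightarrow> nat \<Rightarrow> real Matrix.vec" where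
  "mean_feat M \<theta> s a = Matrix.vec (dim M) (\<lambda>j. \<Sum>s''\<in>pSsa M s a. mnl (phi M) (pSsa M) \<theta> s a s'' * vec_index (phi M s a s'') j)"

definition conf_set :: "ucparams \<Rightarrow> real Matrix.vec \<Rightarrow> real mat \<Rightarrow> real \<Rightarrow> (nat \<Rightarrow> nat \<Rightarrow> nat \<Rightarrow> real) set" where
  "conf_set M \<theta> \<Sigma> b = {p. \<forall>s\<in>pS M. \<forall>a\<in>pA M.
      (\<forall>s'\<in>pS M. 0 \<le> p s a s' \<and> p s a s' \<le> 1) \<and>
      (\<Sum>s'\<in>pSsa M s a. p s a s') = 1 \<and>
      (\<Sum>s'\<in>pSsa M s a. \<bar>p s a s' - mnl (phi M) (pSsa M) \<theta> s a s'\<bar>)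
        \<le> b * (\<Sum>s'\<in>pSsa M s a. mnl (phi M) (pSsa M) \<theta> s a s' *
                  wnorm (minv \<Sigma>) (phi M s a s' - mean_feat M \<theta> s a))
          + 3 * b ^ 2 * Max ((\<lambda>s'. (wnorm (minv \<Sigma>) (phi M s a s')) ^ 2) ` pSsa M s a)}"

fun devi :: "ucparams \<Rightarrow> (nat \<Rightarrow> nat \<Rightarrow> nat \<Rightarrow> real) set \<Rightarrow> nat \<Rightarrow> nat \<Rightarrow> nat \<Rightarrow> real" where
  "devi M P 0 s a = 1 / (1 - disc M)"
| "devi M P (Suc n) s a = rew M s a + disc M *
      (SUP p\<in>P. \<Sum>s'\<in>pSsa M s a. p s a s' * Max ((\<lambda>a'. devi M P n s' a') ` pA M))"

definition Pset :: "ucparams \<Rightarrow> nat \<Rightarrow> real Matrix.vec \<Rightarrow> real mat \<Rightarrow> (nat \<Rightarrow> nat \<Rightarrow> nat \<Rightarrow> real) set" where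
  "Pset M t \<theta> \<Sigma> = conf_set M \<theta> \<Sigma> (beta M t)"

definition loss :: "ucparams \<Rightarrow> nat \<Rightarrow> nat \<Rightarrow> nat \<Rightarrow> real Matrix.vec \<Rightarrow> real" where
  "loss M s a s2 \<theta> = - (\<Sum>s'\<in>pSsa M s a. (if s2 = s' then 1 else 0) * ln (mnl (phi M) (pSsa M) \<theta> s a s'))"

text \<open>Algorithm state before acting at time t: (theta_hat_t, Sigma_t, Sigma_{t_k}, Q_k).\<close>
type_synonym astate = "real Matrix.vec \<times> real mat \<times> real mat \<times> (nat \<Rightarrow> nat \<Rightarrow> real)"

definition alg_init :: "ucparams \<Rightarrow> astate" where
  "alg_init M = (let \<theta> = 0\<^sub>v (dim M); \<Sigma> = lam M \<cdot>\<^sub>m 1\<^sub>m (dim M)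
     in (\<theta>, \<Sigma>, \<Sigma>, devi M (Pset M 1 \<theta> \<Sigma>) (NN M)))"

text \<open>Process the transition (s_t,a_t,s_{t+1}) at time t, then (at time t+1) start a new
  episode if det Sigma_{t+1} > 2 det Sigma_{t_k}.\<close>
definition alg_next :: "ucparams \<Rightarrow> nat \<Rightarrow> nat \<times> nat \<times> nat \<Rightarrow> astate \<Rightarrow> astate" where
  "alg_next M t tr st = (case tr of (s, a, s2) \<Rightarrow> case st of (\<theta>, \<Sigma>, \<Sigma>k, Q) \<Rightarrow>
     let lt = loss M s a s2;
         d = dim M;
         \<Sigma>h = \<Sigma> + eta M \<cdot>\<^sub>m hess d lt \<theta>;
         obj = (\<lambda>x. scalar_prod (grad d lt \<theta>) (x - \<theta>)
                    + 1 / (2 * eta M) * (wnorm \<Sigma>h (x - \<theta>)) ^ 2);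
         \<theta>' = (SOME \<theta>'. \<theta>' \<in> Theta d (Lth M) \<and> (\<forall>x\<in>Theta d (Lth M). obj \<theta>' \<le> obj x));
         \<Sigma>' = \<Sigma> + hess d lt \<theta>'
     in if Determinant.det \<Sigma>' \<le> 2 * Determinant.det \<Sigma>k then (\<theta>', \<Sigma>', \<Sigma>k, Q)
        else (\<theta>', \<Sigma>', \<Sigma>', devi M (Pset M (Suc t) \<theta>' \<Sigma>') (NN M)))"

fun alg_run_from :: "ucparams \<Rightarrow> nat \<Rightarrow> (nat \<times> nat \<times> nat) list \<Rightarrow> astate \<Rightarrow> astate" where
  "alg_run_from M t [] st = st"
| "alg_run_from M t (tr # trs) st = alg_run_from M (Suc t) trs (alg_next M t tr st)"

text \<open>Algorithm state at time length(xs)+1 after processing transitions xs (from time 1).\<close>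
definition alg_state :: "ucparams \<Rightarrow> (nat \<times> nat \<times> nat) list \<Rightarrow> astate" where
  "alg_state M xs = alg_run_from M 1 xs (alg_init M)"

text \<open>The UCMNL-K policy; sel is the (arbitrary) argmax tie-breaking rule.\<close>
definition ucmnlk :: "ucparams \<Rightarrow> ((nat \<Rightarrow> nat \<Rightarrow> real) \<Rightarrow> nat \<Rightarrow> nat) \<Rightarrow> hist \<Rightarrow> nat" where
  "ucmnlk M sel h = (case alg_state M (transitions h) of (\<theta>, \<Sigma>, \<Sigma>k, Q) \<Rightarrow> sel Q (snd h))"

definition ucmnlk_pol :: "ucparams \<Rightarrow> ((nat \<Rightarrow> nat \<Rightarrow> real) \<Rightarrow> nat \<Rightarrow> nat) \<Rightarrow> hist \<Rightarrow> nat pmf" where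
  "ucmnlk_pol M sel h = return_pmf (ucmnlk M sel h)"

end

theory Submission
  imports Defs "HOL-Probability.Hoeffding"
begin

text \<open>
  On the event that the estimates stay in their confidence ellipsoids, a second-order expansion of
  the softmax shows that the true kernel lies in every confidence polytope, so \<open>DEVI\<close> is optimistic:
  its value dominates that of every policy. Unrolling the Bellman equations along the trajectory
  then bounds \<open>1 - \<gamma>\<close> times the regret by the \<open>L1\<close> diameters of the polytopes at the visited pairs, a
  bounded martingale (Azuma), one term \<open>1 / (1 - \<gamma>)\<close> per new episode, and the truncation error
  \<open>T \<gamma>^N\<close>.

  All matrices \<open>\<Sigma>\<^sub>t\<close> arise from \<open>\<lambda> I\<close> by rank-one updates, since the Hessian of the loss is the
  covariance of the features. The matrix determinant lemma and the Sherman-Morrison formula therefore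
  yield the elliptical potential bound, the comparison of \<open>\<Sigma>\<^sub>t\<close> with the \<open>\<Sigma>\<close> at the start of the
  episode, and the bound on the number of episodes, without any spectral theory. The feature variance
  \<open>x\<^sub>t\<close> controls both terms of the polytope radius: its square root bounds the first-order width, and
  \<open>x\<^sub>t / \<kappa>\<close> bounds \<open>max \<parallel>\<phi>\<parallel>\<^sup>2\<close> because one feature vector is zero. When \<open>d > \<surd>T\<close> the bound is trivial;
  otherwise the Leibniz formula is enough to estimate \<open>ln det \<Sigma>\<^sub>T\<close>.
\<close>

unbundle no vec_syntax and no inner_syntax
hide_const (open) Determinants.det Finite_Cartesian_Product.mat Finite_Cartesian_Product.vec
  Finite_Cartesian_Product.row
hide_type (open) Finite_Cartesian_Product.vec

section \<open>Polynomials in two variables\<close>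

lemma poly_eq_sum_atMost:
  fixes q :: "'a :: comm_semiring_1 poly"
  assumes "degree q \<le> n"
  shows "poly q z = (\<Sum>i\<le>n. coeff q i * z ^ i)"
  by (subst poly_as_sum_of_monoms'[OF assms, symmetric]) (simp add: poly_sum poly_monom)

lemma poly2_iff_poly_poly:
  "poly2 f \<longleftrightarrow> (\<exists>p :: real poly poly. \<forall>x y. f x y = poly (poly p [:x:]) y)"
proof
  assume "poly2 f"
  then obtain n c where f: "\<And>x y. f x y = (\<Sum>i\<le>n. \<Sum>j\<le>n. c i j * x ^ i * y ^ j)"
    unfolding poly2_def by blast
  have "f x y = poly (poly (\<Sum>i\<le>n. monom (\<Sum>j\<le>n. monom (c i j) j) i) [:x:]) y" for x y
    by (simp add: f poly_sum poly_monom sum_distrib_right sum_distrib_left mult_ac poly_power)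
  then show "\<exists>p :: real poly poly. \<forall>x y. f x y = poly (poly p [:x:]) y" by blast
next
  assume "\<exists>p :: real poly poly. \<forall>x y. f x y = poly (poly p [:x:]) y"
  then obtain p :: "real poly poly" where f: "\<And>x y. f x y = poly (poly p [:x:]) y" by blast
  define n where "n = Max (insert (degree p) ((\<lambda>i. degree (coeff p i)) ` {..degree p}))"
  have degree_p: "degree p \<le> n" by (simp add: n_def)
  have degree_coeff: "degree (coeff p i) \<le> n" for i
  proof (cases "i \<le> degree p")
    case True then show ?thesis unfolding n_def by (intro Max_ge) auto
  qed (simp add: coeff_eq_0)
  have "f x y = (\<Sum>i\<le>n. \<Sum>j\<le>n. coeff (coeff p i) j * x ^ i * y ^ j)" for x y
  proof -
    have "f x y = (\<Sum>i\<le>n. poly (coeff p i) y * x ^ i)"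
      unfolding f poly_eq_sum_atMost[OF degree_p] by (simp add: poly_sum poly_power)
    then show ?thesis
      unfolding poly_eq_sum_atMost[OF degree_coeff]
      by (simp add: sum_distrib_right sum_distrib_left mult_ac)
  qed
  then show "poly2 f" unfolding poly2_def
    by (intro exI[of _ n] exI[of _ "\<lambda>i j. coeff (coeff p i) j"]) blast
qed

lemma poly2_const: "poly2 (\<lambda>x y. a)"
  unfolding poly2_iff_poly_poly by (intro exI[of _ "[:[:a:]:]"]) simp

lemma poly2_add:
  assumes "poly2 f" "poly2 g"
  shows "poly2 (\<lambda>x y. f x y + g x y)"
  using assms unfolding poly2_iff_poly_poly by (metis poly_add)

lemma poly2_mult:
  assumes "poly2 f" "poly2 g"
  shows "poly2 (\<lambda>x y. f x y * g x y)"
  using assms unfolding poly2_iff_poly_poly by (metis poly_mult)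

section \<open>Finite probability weights\<close>

definition weighted_mean :: "'a set \<Rightarrow> ('a \<Rightarrow> real) \<Rightarrow> ('a \<Rightarrow> real) \<Rightarrow> real" where
  "weighted_mean I p f = (\<Sum>i\<in>I. p i * f i)"

definition weighted_cov :: "'a set \<Rightarrow> ('a \<Rightarrow> real) \<Rightarrow> ('a \<Rightarrow> real) \<Rightarrow> ('a \<Rightarrow> real) \<Rightarrow> real" where
  "weighted_cov I p f g = (\<Sum>i\<in>I. p i * (f i - weighted_mean I p f) * (g i - weighted_mean I p g))"

abbreviation weighted_var :: "'a set \<Rightarrow> ('a \<Rightarrow> real) \<Rightarrow> ('a \<Rightarrow> real) \<Rightarrow> real" where
  "weighted_var I p f \<equiv> weighted_cov I p f f"

abbreviation l1_dist :: "'a set \<Rightarrow> ('a \<Rightarrow> real) \<Rightarrow> ('a \<Rightarrow> real) \<Rightarrow> real" where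
  "l1_dist I p q \<equiv> (\<Sum>i\<in>I. \<bar>p i - q i\<bar>)"

lemma weighted_mean_cong:
  assumes "\<And>i. i \<in> I \<Longrightarrow> p i = q i" "\<And>i. i \<in> I \<Longrightarrow> f i = g i"
  shows "weighted_mean I p f = weighted_mean I q g"
  using assms by (simp add: weighted_mean_def)

lemma weighted_mean_cmult: "weighted_mean I p (\<lambda>i. c * f i) = c * weighted_mean I p f"
  by (simp add: weighted_mean_def sum_distrib_left mult_ac)

lemma weighted_mean_add:
  "weighted_mean I p (\<lambda>i. f i + g i) = weighted_mean I p f + weighted_mean I p g"
  by (simp add: weighted_mean_def distrib_left sum.distrib)

locale prob_weights =
  fixes I :: "'a set" and p :: "'a \<Rightarrow> real"
  assumes finite_index: "finite I"
    and weight_nonneg: "i \<in> I \<Longrightarrow> 0 \<le> p i"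
    and sum_weights: "(\<Sum>i\<in>I. p i) = 1"
begin

lemma weighted_mean_const: "weighted_mean I p (\<lambda>_. c) = c"
  by (simp add: weighted_mean_def sum_weights flip: sum_distrib_right)

lemma weighted_mean_mono:
  assumes "\<And>i. i \<in> I \<Longrightarrow> f i \<le> g i"
  shows "weighted_mean I p f \<le> weighted_mean I p g"
  unfolding weighted_mean_def by (intro sum_mono mult_left_mono assms weight_nonneg)

lemma weighted_mean_le:
  assumes "\<And>i. i \<in> I \<Longrightarrow> f i \<le> u"
  shows "weighted_mean I p f \<le> u"
  using weighted_mean_mono[of f "\<lambda>_. u"] assms by (simp add: weighted_mean_const)

lemma weighted_mean_nonneg:
  assumes "\<And>i. i \<in> I \<Longrightarrow> 0 \<le> f i"
  shows "0 \<le> weighted_mean I p f"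
  using weighted_mean_mono[of "\<lambda>_. 0" f] assms by (simp add: weighted_mean_const)

lemma abs_weighted_mean_le:
  assumes "\<And>i. i \<in> I \<Longrightarrow> \<bar>f i\<bar> \<le> m"
  shows "\<bar>weighted_mean I p f\<bar> \<le> m"
proof -
  have "weighted_mean I p f \<le> m" using assms by (intro weighted_mean_le) (simp add: abs_le_iff)
  moreover have "weighted_mean I p (\<lambda>i. - 1 * f i) \<le> m"
    using assms by (intro weighted_mean_le) (simp add: abs_le_iff)
  ultimately show ?thesis unfolding weighted_mean_cmult by (simp add: abs_le_iff)
qed

lemma weight_le_1:
  assumes "i \<in> I"
  shows "p i \<le> 1"
  using member_le_sum[OF assms, of p] weight_nonneg finite_index by (simp add: sum_weights)

lemma weighted_mean_deviation: "weighted_mean I p (\<lambda>i. f i - weighted_mean I p f) = 0"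
  by (simp add: weighted_mean_def right_diff_distrib sum_subtractf sum_weights flip: sum_distrib_right)

lemma weighted_cov_eq_deviation:
  "weighted_cov I p f g = (\<Sum>i\<in>I. p i * (f i - weighted_mean I p f) * g i)"
proof -
  have "weighted_cov I p f g = (\<Sum>i\<in>I. p i * (f i - weighted_mean I p f) * g i)
      - weighted_mean I p g * weighted_mean I p (\<lambda>i. f i - weighted_mean I p f)"
    unfolding weighted_cov_def weighted_mean_def[of I p "\<lambda>i. f i - weighted_mean I p f"] sum_distrib_left
    by (simp add: right_diff_distrib sum_subtractf mult_ac)
  then show ?thesis by (simp add: weighted_mean_deviation)
qed

lemma weighted_cov_eq:
  "weighted_cov I p f g = weighted_mean I p (\<lambda>i. f i * g i) - weighted_mean I p f * weighted_mean I p g"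
  unfolding weighted_cov_eq_deviation
  by (simp add: weighted_mean_def left_diff_distrib right_diff_distrib sum_subtractf sum_distrib_left
      sum_distrib_right mult_ac)

lemma weighted_var_nonneg: "0 \<le> weighted_var I p f"
  unfolding weighted_cov_def by (intro sum_nonneg) (simp add: mult.assoc weight_nonneg)

lemma weighted_mean_square_le: "(weighted_mean I p f)\<^sup>2 \<le> weighted_mean I p (\<lambda>i. (f i)\<^sup>2)"
  using weighted_var_nonneg[of f] unfolding weighted_cov_eq by (simp add: power2_eq_square)

lemma weighted_var_le:
  assumes "\<And>i. i \<in> I \<Longrightarrow> \<bar>f i\<bar> \<le> m"
  shows "weighted_var I p f \<le> m\<^sup>2"
proof -
  have "f i * f i \<le> m\<^sup>2" if "i \<in> I" for i
    using power_mono[OF assms[OF that] abs_ge_zero, of 2] by (simp add: power2_eq_square)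
  then have "weighted_mean I p (\<lambda>i. f i * f i) \<le> m\<^sup>2" by (rule weighted_mean_le)
  then show ?thesis unfolding weighted_cov_eq using zero_le_square[of "weighted_mean I p f"] by linarith
qed

lemma abs_weighted_cov_le:
  assumes f: "\<And>i. i \<in> I \<Longrightarrow> \<bar>f i\<bar> \<le> m" and g: "\<And>i. i \<in> I \<Longrightarrow> \<bar>g i\<bar> \<le> n"
  shows "\<bar>weighted_cov I p f g\<bar> \<le> (2 * m) * (2 * n)"
proof -
  have "weighted_cov I p f g
    = weighted_mean I p (\<lambda>i. (f i - weighted_mean I p f) * (g i - weighted_mean I p g))"
    by (simp add: weighted_cov_def weighted_mean_def mult.assoc)
  also have "\<bar>\<dots>\<bar> \<le> (2 * m) * (2 * n)"
  proof (rule abs_weighted_mean_le)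
    fix i assume i: "i \<in> I"
    have "\<bar>f i - weighted_mean I p f\<bar> \<le> 2 * m" "\<bar>g i - weighted_mean I p g\<bar> \<le> 2 * n"
      using f[OF i] g[OF i] abs_weighted_mean_le[of f, OF f] abs_weighted_mean_le[of g, OF g] by linarith+
    then show "\<bar>(f i - weighted_mean I p f) * (g i - weighted_mean I p g)\<bar> \<le> (2 * m) * (2 * n)"
      unfolding abs_mult by (intro mult_mono) auto
  qed
  finally show ?thesis .
qed

lemma weight_mult_square_add_le:
  assumes "i \<in> I" "j \<in> I" "i \<noteq> j"
  shows "p i * p j * (f i + f j)\<^sup>2 \<le> weighted_mean I p (\<lambda>k. (f k)\<^sup>2)"
proof -
  have weights: "0 \<le> p i" "0 \<le> p j" "0 \<le> 1 - (p i + p j)"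
    using sum_mono2[OF finite_index, of "{i, j}" p] assms weight_nonneg by (auto simp: sum_weights)
  then have "0 \<le> (p i * f i - p j * f j)\<^sup>2 + (1 - (p i + p j)) * (p i * (f i)\<^sup>2 + p j * (f j)\<^sup>2)"
    by simp
  also have "\<dots> = (p i * (f i)\<^sup>2 + p j * (f j)\<^sup>2) - p i * p j * (f i + f j)\<^sup>2"
    by (simp add: power2_eq_square algebra_simps)
  finally have "p i * p j * (f i + f j)\<^sup>2 \<le> (\<Sum>k\<in>{i, j}. p k * (f k)\<^sup>2)"
    using assms by simp
  also have "\<dots> \<le> weighted_mean I p (\<lambda>k. (f k)\<^sup>2)"
    unfolding weighted_mean_def using assms by (intro sum_mono2 finite_index) (auto simp: weight_nonneg)
  finally show ?thesis .
qed

end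

section \<open>Variation of the softmax\<close>

lemma sum_mult_sgn_le:
  fixes y z :: "'a \<Rightarrow> real"
  shows "(\<Sum>i\<in>I. sgn (z i) * y i) \<le> (\<Sum>i\<in>I. \<bar>y i\<bar>)"
  by (intro sum_mono) (simp add: sgn_if abs_ge_self abs_ge_minus_self)

lemma sum_abs_diff_le_deriv:
  fixes f f' :: "real \<Rightarrow> 'a \<Rightarrow> real"
  assumes f: "\<And>i u. i \<in> I \<Longrightarrow> ((\<lambda>u. f u i) has_real_derivative f' u i) (at u)"
    and bound: "\<And>u. (\<Sum>i\<in>I. \<bar>f' u i\<bar>) \<le> b"
  shows "l1_dist I (f 1) (f 0) \<le> b"
proof -
  define \<sigma> where "\<sigma> i = sgn (f 1 i - f 0 i)" for i
  define g where "g u = (\<Sum>i\<in>I. \<sigma> i * f u i)" for u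
  define g' where "g' u = (\<Sum>i\<in>I. \<sigma> i * f' u i)" for u
  have "(g has_real_derivative g' u) (at u)" for u
    unfolding g_def g'_def by (intro DERIV_sum DERIV_cmult f)
  then obtain u where "g 1 - g 0 = g' u" using MVT2[of 0 1 g g'] by auto
  moreover have "g 1 - g 0 = l1_dist I (f 1) (f 0)"
    by (simp add: g_def \<sigma>_def abs_sgn left_diff_distrib mult.commute flip: sum_subtractf)
  moreover have "g' u \<le> b"
    unfolding g'_def \<sigma>_def by (rule order.trans[OF sum_mult_sgn_le bound])
  ultimately show ?thesis by simp
qed

lemma sum_abs_diff_le_deriv2:
  fixes f f' f'' :: "real \<Rightarrow> 'a \<Rightarrow> real"
  assumes f: "\<And>i u. i \<in> I \<Longrightarrow> ((\<lambda>u. f u i) has_real_derivative f' u i) (at u)"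
    and f': "\<And>i u. i \<in> I \<Longrightarrow> ((\<lambda>u. f' u i) has_real_derivative f'' u i) (at u)"
    and bound: "\<And>u. (\<Sum>i\<in>I. \<bar>f'' u i\<bar>) \<le> b"
  shows "l1_dist I (f 1) (f 0) \<le> (\<Sum>i\<in>I. \<bar>f' 0 i\<bar>) + b / 2"
proof -
  define \<sigma> where "\<sigma> i = sgn (f 1 i - f 0 i)" for i
  define g where "g k u = (\<Sum>i\<in>I. \<sigma> i * (if k = 0 then f else if k = 1 then f' else f'') u i)"
    for k :: nat and u
  have "\<exists>u>0. u < 1 \<and> g 0 1 = (\<Sum>k<2. g k 0 / fact k * 1 ^ k) + g 2 u / fact 2 * 1 ^ 2"
  proof (rule Maclaurin)
    show "\<forall>k u. k < 2 \<and> 0 \<le> u \<and> u \<le> 1 \<longrightarrow> (g k has_real_derivative g (Suc k) u) (at u)"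
      unfolding g_def by (auto simp: less_2_cases_iff intro!: DERIV_sum DERIV_cmult f f')
  qed auto
  then obtain u where "g 0 1 - g 0 0 = g 1 0 + g 2 u / 2" by (auto simp: numeral_2_eq_2)
  moreover have "g 0 1 - g 0 0 = l1_dist I (f 1) (f 0)"
    by (simp add: g_def \<sigma>_def abs_sgn left_diff_distrib mult.commute flip: sum_subtractf)
  moreover have "g 1 0 \<le> (\<Sum>i\<in>I. \<bar>f' 0 i\<bar>)"
    unfolding g_def \<sigma>_def by (rule order.trans[OF sum_mult_sgn_le]) simp
  moreover have "g 2 u \<le> b"
    unfolding g_def \<sigma>_def by (rule order.trans[OF sum_mult_sgn_le]) (simp add: bound)
  ultimately show ?thesis by simp
qed

definition softmax :: "'a set \<Rightarrow> ('a \<Rightarrow> real) \<Rightarrow> 'a \<Rightarrow> real" where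
  "softmax I z i = exp (z i) / (\<Sum>j\<in>I. exp (z j))"

lemma softmax_cong:
  assumes "\<And>i. i \<in> I \<Longrightarrow> z i = w i" "i \<in> I"
  shows "softmax I z i = softmax I w i"
  using assms by (simp add: softmax_def cong: sum.cong)

locale finite_softmax =
  fixes I :: "'a set"
  assumes finite: "finite I" and nonempty: "I \<noteq> {}"
begin

lemma sum_exp_pos: "0 < (\<Sum>j\<in>I. exp (z j :: real))"
  using finite nonempty by (intro sum_pos) auto

lemma softmax_pos: "0 < softmax I z i"
  unfolding softmax_def using sum_exp_pos by simp

sublocale prob_weights I "softmax I z" for z
proof
  show "(\<Sum>i\<in>I. softmax I z i) = 1"
    using sum_exp_pos[of z] by (simp add: softmax_def flip: sum_divide_distrib)
qed (use finite softmax_pos in \<open>auto intro: less_imp_le\<close>)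

lemma has_real_derivative_softmax:
  fixes c x :: "'a \<Rightarrow> real"
  defines "p \<equiv> \<lambda>u. softmax I (\<lambda>j. c j + u * x j)"
  shows "((\<lambda>u. p u i) has_real_derivative p u i * (x i - weighted_mean I (p u) x)) (at u)"
proof -
  define Z where "Z u = (\<Sum>j\<in>I. exp (c j + u * x j))" for u
  have Z_pos: "0 < Z u" for u unfolding Z_def by (rule sum_exp_pos)
  have p_eq: "p u j = exp (c j + u * x j) / Z u" for u j by (simp add: p_def softmax_def Z_def)
  have "(\<Sum>j\<in>I. exp (c j + u * x j) * x j) = Z u * weighted_mean I (p u) x"
    using Z_pos[of u] by (simp add: weighted_mean_def p_eq sum_distrib_left)
  moreover have "(Z has_real_derivative (\<Sum>j\<in>I. exp (c j + u * x j) * x j)) (at u)"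
    unfolding Z_def by (auto intro!: derivative_eq_intros sum.cong)
  ultimately show ?thesis
    unfolding p_eq using Z_pos[of u]
    by (auto intro!: derivative_eq_intros simp: field_simps power2_eq_square)
qed

lemma has_real_derivative_weighted_mean_softmax:
  fixes c x f :: "'a \<Rightarrow> real"
  defines "p \<equiv> \<lambda>u. softmax I (\<lambda>j. c j + u * x j)"
  shows "((\<lambda>u. weighted_mean I (p u) f) has_real_derivative weighted_cov I (p u) x f) (at u)"
  unfolding weighted_mean_def[of I _ f] p_def weighted_cov_eq_deviation
  by (auto intro!: derivative_eq_intros has_real_derivative_softmax)

lemma softmax_l1_lipschitz:
  assumes m: "\<And>i. i \<in> I \<Longrightarrow> \<bar>w i - z i\<bar> \<le> m"
  shows "l1_dist I (softmax I w) (softmax I z) \<le> 2 * m"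
proof -
  define x where "x i = w i - z i" for i
  define p where "p u = softmax I (\<lambda>i. z i + u * x i)" for u
  define avg where "avg u = weighted_mean I (p u) x" for u
  have p': "((\<lambda>u. p u i) has_real_derivative p u i * (x i - avg u)) (at u)" for u i
    unfolding p_def avg_def by (rule has_real_derivative_softmax)
  have avg: "\<bar>avg u\<bar> \<le> m" for u
    unfolding avg_def p_def using m by (intro abs_weighted_mean_le) (simp add: x_def)
  have "(\<Sum>i\<in>I. \<bar>p u i * (x i - avg u)\<bar>) = weighted_mean I (p u) (\<lambda>i. \<bar>x i - avg u\<bar>)" for u
    by (simp add: weighted_mean_def p_def abs_mult abs_of_pos[OF softmax_pos])
  also have "weighted_mean I (p u) (\<lambda>i. \<bar>x i - avg u\<bar>) \<le> 2 * m" for u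
    unfolding p_def
  proof (rule weighted_mean_le)
    show "\<bar>x i - avg u\<bar> \<le> 2 * m" if "i \<in> I" for i using m[OF that] avg[of u] by (simp add: x_def)
  qed
  finally have "l1_dist I (p 1) (p 0) \<le> 2 * m"
    by (rule sum_abs_diff_le_deriv[OF p'])
  then show ?thesis by (simp add: p_def x_def)
qed

lemma softmax_l1_second_order:
  fixes z w :: "'a \<Rightarrow> real"
  defines "x \<equiv> \<lambda>i. w i - z i"
  assumes m: "\<And>i. i \<in> I \<Longrightarrow> \<bar>x i\<bar> \<le> m"
  shows "l1_dist I (softmax I w) (softmax I z)
    \<le> weighted_mean I (softmax I z) (\<lambda>i. \<bar>x i - weighted_mean I (softmax I z) x\<bar>) + m\<^sup>2"
proof -
  define p where "p u = softmax I (\<lambda>i. z i + u * x i)" for u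
  define avg where "avg u = weighted_mean I (p u) x" for u
  define var where "var u = weighted_var I (p u) x" for u
  define p'' where "p'' u i = p u i * ((x i - avg u)\<^sup>2 - var u)" for u i
  have p_pos: "0 < p u i" for u i by (simp add: p_def softmax_pos)
  have p': "((\<lambda>u. p u i) has_real_derivative p u i * (x i - avg u)) (at u)" for u i
    unfolding p_def avg_def by (rule has_real_derivative_softmax)
  have avg': "(avg has_real_derivative var u) (at u)" for u
    unfolding p_def avg_def var_def by (rule has_real_derivative_weighted_mean_softmax)
  have p'': "((\<lambda>u. p u i * (x i - avg u)) has_real_derivative p'' u i) (at u)" for u i
    unfolding p''_def by (auto intro!: derivative_eq_intros p' avg' simp: power2_eq_square algebra_simps)
  have "(\<Sum>i\<in>I. \<bar>p'' u i\<bar>) \<le> 2 * m\<^sup>2" for u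
  proof -
    have var_nonneg: "0 \<le> var u" unfolding var_def p_def by (rule weighted_var_nonneg)
    have "(\<Sum>i\<in>I. \<bar>p'' u i\<bar>) = weighted_mean I (p u) (\<lambda>i. \<bar>(x i - avg u)\<^sup>2 - var u\<bar>)"
      by (simp add: weighted_mean_def p''_def abs_mult abs_of_pos[OF p_pos])
    also have "\<dots> \<le> weighted_mean I (p u) (\<lambda>i. (x i - avg u)\<^sup>2 + var u)"
      unfolding p_def using var_nonneg by (intro weighted_mean_mono) (simp add: abs_le_iff)
    also have "\<dots> = weighted_mean I (p u) (\<lambda>i. (x i - avg u)\<^sup>2) + var u"
      unfolding weighted_mean_add p_def weighted_mean_const ..
    also have "weighted_mean I (p u) (\<lambda>i. (x i - avg u)\<^sup>2) = var u"
      by (simp add: var_def avg_def weighted_cov_def weighted_mean_def power2_eq_square mult.assoc)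
    also have "var u \<le> m\<^sup>2" unfolding var_def p_def by (rule weighted_var_le[OF m])
    finally show ?thesis by simp
  qed
  from sum_abs_diff_le_deriv2[OF p' p'' this]
  have "l1_dist I (p 1) (p 0) \<le> (\<Sum>i\<in>I. \<bar>p 0 i * (x i - avg 0)\<bar>) + m\<^sup>2" by simp
  then show ?thesis
    by (simp add: p_def x_def avg_def weighted_mean_def abs_mult abs_of_pos[OF softmax_pos])
qed

end

section \<open>Rank-one updates of positive definite matrices\<close>

definition psd :: "nat \<Rightarrow> real mat \<Rightarrow> bool" where
  "psd d A \<longleftrightarrow> A \<in> carrier_mat d d \<and>
     (\<forall>x\<in>carrier_vec d. \<forall>y\<in>carrier_vec d. x \<bullet> (A *\<^sub>v y) = y \<bullet> (A *\<^sub>v x)) \<and>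
     (\<forall>x\<in>carrier_vec d. 0 \<le> x \<bullet> (A *\<^sub>v x))"

text \<open>For a positive semidefinite matrix, a positive determinant amounts to definiteness; it is also
  the quantity that rank-one updates act on explicitly.\<close>

definition pd :: "nat \<Rightarrow> real mat \<Rightarrow> bool" where
  "pd d A \<longleftrightarrow> psd d A \<and> 0 < det A"

lemma psd_carrier: "psd d A \<Longrightarrow> A \<in> carrier_mat d d"
  and psd_sym: "psd d A \<Longrightarrow> x \<in> carrier_vec d \<Longrightarrow> y \<in> carrier_vec d \<Longrightarrow> x \<bullet> (A *\<^sub>v y) = y \<bullet> (A *\<^sub>v x)"
  and psd_nonneg: "psd d A \<Longrightarrow> x \<in> carrier_vec d \<Longrightarrow> 0 \<le> x \<bullet> (A *\<^sub>v x)"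
  unfolding psd_def by blast+

lemma pd_psd: "pd d A \<Longrightarrow> psd d A"
  and pd_carrier: "pd d A \<Longrightarrow> A \<in> carrier_mat d d"
  and pd_det_pos: "pd d A \<Longrightarrow> 0 < det A"
  by (simp_all add: pd_def psd_def)

subsection \<open>The seminorm of a positive semidefinite matrix\<close>

lemma square_le_if_quadratic_nonneg:
  fixes a b c :: real
  assumes quadratic: "\<And>t. 0 \<le> a + 2 * t * b + t\<^sup>2 * c" and c: "c \<ge> 0"
  shows "b\<^sup>2 \<le> a * c"
proof (cases "c = 0")
  case True
  have "b = 0"
  proof (rule ccontr)
    assume "b \<noteq> 0"
    with quadratic[of "- (a + 1) / (2 * b)"] True show False by (simp add: field_simps)
  qed
  with True show ?thesis by simp
next
  case False
  with c have "c > 0" by simp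
  with quadratic[of "- b / c"] show ?thesis by (simp add: field_simps power2_eq_square)
qed

lemma psd_quadratic_add:
  assumes A: "psd d A" and x: "x \<in> carrier_vec d" and y: "y \<in> carrier_vec d"
  shows "(x + t \<cdot>\<^sub>v y) \<bullet> (A *\<^sub>v (x + t \<cdot>\<^sub>v y)) =
    x \<bullet> (A *\<^sub>v x) + 2 * t * (x \<bullet> (A *\<^sub>v y)) + t\<^sup>2 * (y \<bullet> (A *\<^sub>v y))"
proof -
  note carrier = psd_carrier[OF A]
  have "A *\<^sub>v x \<in> carrier_vec d" "A *\<^sub>v y \<in> carrier_vec d" using carrier x y by auto
  moreover have "A *\<^sub>v (x + t \<cdot>\<^sub>v y) = A *\<^sub>v x + t \<cdot>\<^sub>v (A *\<^sub>v y)"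
    using x y by (simp add: mult_add_distrib_mat_vec[OF carrier] mult_mat_vec[OF carrier])
  ultimately show ?thesis
    using x y psd_sym[OF A y x]
    by (simp add: scalar_prod_add_distrib[of _ d] add_scalar_prod_distrib[of _ d]
        power2_eq_square algebra_simps)
qed

lemma psd_cauchy_schwarz:
  assumes A: "psd d A" and x: "x \<in> carrier_vec d" and y: "y \<in> carrier_vec d"
  shows "(x \<bullet> (A *\<^sub>v y))\<^sup>2 \<le> (x \<bullet> (A *\<^sub>v x)) * (y \<bullet> (A *\<^sub>v y))"
proof (rule square_le_if_quadratic_nonneg)
  show "0 \<le> x \<bullet> (A *\<^sub>v x) + 2 * t * (x \<bullet> (A *\<^sub>v y)) + t\<^sup>2 * (y \<bullet> (A *\<^sub>v y))" for t
    unfolding psd_quadratic_add[OF assms, symmetric] using psd_nonneg[OF A] x y by simp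
qed (rule psd_nonneg[OF A y])

lemma wnorm_nonneg: "psd d A \<Longrightarrow> x \<in> carrier_vec d \<Longrightarrow> 0 \<le> wnorm A x"
  using psd_nonneg by (simp add: wnorm_def)

lemma wnorm_square: "psd d A \<Longrightarrow> x \<in> carrier_vec d \<Longrightarrow> (wnorm A x)\<^sup>2 = x \<bullet> (A *\<^sub>v x)"
  using psd_nonneg by (simp add: wnorm_def)

lemma wnorm_cauchy_schwarz:
  assumes "psd d A" "x \<in> carrier_vec d" "y \<in> carrier_vec d"
  shows "\<bar>x \<bullet> (A *\<^sub>v y)\<bar> \<le> wnorm A x * wnorm A y"
  using real_sqrt_le_mono[OF psd_cauchy_schwarz[OF assms]]
  by (simp add: wnorm_def real_sqrt_mult)

lemma wnorm_zero: "wnorm A (0\<^sub>v d) = 0"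
  by (simp add: wnorm_def scalar_prod_def)

lemma wnorm_smult:
  assumes A: "psd d A" and x: "x \<in> carrier_vec d"
  shows "wnorm A (k \<cdot>\<^sub>v x) = \<bar>k\<bar> * wnorm A x"
proof -
  have "A *\<^sub>v x \<in> carrier_vec d" using psd_carrier[OF A] x by simp
  then have "(k \<cdot>\<^sub>v x) \<bullet> (A *\<^sub>v (k \<cdot>\<^sub>v x)) = k\<^sup>2 * (x \<bullet> (A *\<^sub>v x))"
    using x by (simp add: mult_mat_vec[OF psd_carrier[OF A] x] power2_eq_square)
  then show ?thesis by (simp add: wnorm_def real_sqrt_mult)
qed

lemma wnorm_add_le:
  assumes A: "psd d A" and x: "x \<in> carrier_vec d" and y: "y \<in> carrier_vec d"
  shows "wnorm A (x + y) \<le> wnorm A x + wnorm A y"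
proof (rule power2_le_imp_le)
  have "(wnorm A (x + y))\<^sup>2 = (wnorm A x)\<^sup>2 + 2 * (x \<bullet> (A *\<^sub>v y)) + (wnorm A y)\<^sup>2"
    using psd_quadratic_add[OF assms, of 1] x y by (simp add: wnorm_square[OF A])
  also have "\<dots> \<le> (wnorm A x + wnorm A y)\<^sup>2"
    using wnorm_cauchy_schwarz[OF assms] by (simp add: power2_sum)
  finally show "(wnorm A (x + y))\<^sup>2 \<le> (wnorm A x + wnorm A y)\<^sup>2" .
qed (use assms in \<open>simp add: wnorm_nonneg\<close>)

lemma wnorm_minus_commute:
  assumes A: "psd d A" and x: "x \<in> carrier_vec d" and y: "y \<in> carrier_vec d"
  shows "wnorm A (x - y) = wnorm A (y - x)"
proof -
  have "x - y = (-1) \<cdot>\<^sub>v (y - x)" using x y by (intro eq_vecI) auto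
  then show ?thesis using wnorm_smult[OF A, of "y - x" "-1"] x y by simp
qed

lemma wnorm_diff_triangle_le:
  assumes A: "psd d A" and x: "x \<in> carrier_vec d" and y: "y \<in> carrier_vec d" and z: "z \<in> carrier_vec d"
  shows "wnorm A (x - z) \<le> wnorm A (x - y) + wnorm A (y - z)"
proof -
  have "x - z = (x - y) + (y - z)" using x y z by (intro eq_vecI) auto
  then show ?thesis using wnorm_add_le[OF A, of "x - y" "y - z"] x y z by simp
qed

lemma wnorm_sum_le:
  assumes A: "psd d A" and "finite I" and "\<And>i. i \<in> I \<Longrightarrow> v i \<in> carrier_vec d"
  shows "wnorm A (vec d (\<lambda>j. \<Sum>i\<in>I. c i * v i $ j)) \<le> (\<Sum>i\<in>I. \<bar>c i\<bar> * wnorm A (v i))"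
  using assms(2,3)
proof (induction I rule: finite_induct)
  case empty
  have "vec d (\<lambda>j. 0 :: real) = 0\<^sub>v d" by auto
  then show ?case by (simp add: wnorm_zero)
next
  case (insert i I)
  let ?w = "vec d (\<lambda>j. \<Sum>i\<in>I. c i * v i $ j)"
  have "vec d (\<lambda>j. \<Sum>i\<in>insert i I. c i * v i $ j) = c i \<cdot>\<^sub>v v i + ?w"
    using insert.hyps insert.prems[of i] by (intro eq_vecI) auto
  then show ?case
    using wnorm_add_le[OF A, of "c i \<cdot>\<^sub>v v i" ?w] insert wnorm_smult[OF A, of "v i" "c i"] by auto
qed

subsection \<open>Inverse and dual norm\<close>

lemma pd_minv:
  assumes "pd d A"
  shows "minv A \<in> carrier_mat d d" "A * minv A = 1\<^sub>m d" "minv A * A = 1\<^sub>m d"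
proof -
  have A: "A \<in> carrier_mat d d" and "det A \<noteq> 0"
    using pd_carrier[OF assms] pd_det_pos[OF assms] by auto
  then have "A \<in> Units (ring_mat TYPE(real) d ())" by (rule det_non_zero_imp_unit)
  then have "mat_inverse A \<noteq> None" using mat_inverse(1)[OF A, of "()"] by fast
  then obtain B where "mat_inverse A = Some B" by fast
  with mat_inverse(2)[OF A this]
  show "minv A \<in> carrier_mat d d" "A * minv A = 1\<^sub>m d" "minv A * A = 1\<^sub>m d"
    by (auto simp: minv_def)
qed

lemma minv_mult_vec:
  assumes A: "pd d A" and x: "x \<in> carrier_vec d"
  shows minv_mult_vec_carrier: "minv A *\<^sub>v x \<in> carrier_vec d"
    and mult_minv_mult_vec: "A *\<^sub>v (minv A *\<^sub>v x) = x"
    and minv_mult_mult_vec: "minv A *\<^sub>v (A *\<^sub>v x) = x"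
proof -
  note carrier = pd_carrier[OF A] and inverse = pd_minv[OF A]
  show "minv A *\<^sub>v x \<in> carrier_vec d" using inverse(1) x by simp
  show "A *\<^sub>v (minv A *\<^sub>v x) = x"
    unfolding assoc_mult_mat_vec[OF carrier inverse(1) x, symmetric] inverse(2) using x by simp
  show "minv A *\<^sub>v (A *\<^sub>v x) = x"
    unfolding assoc_mult_mat_vec[OF inverse(1) carrier x, symmetric] inverse(3) using x by simp
qed

lemma psd_minv:
  assumes A: "pd d A"
  shows "psd d (minv A)"
  unfolding psd_def
proof (intro conjI ballI)
  show "minv A \<in> carrier_mat d d" by (rule pd_minv[OF A])
  fix x :: "real vec" assume x: "x \<in> carrier_vec d"
  let ?u = "minv A *\<^sub>v x"
  note u = minv_mult_vec[OF A x]
  have "0 \<le> ?u \<bullet> (A *\<^sub>v ?u)" using psd_nonneg[OF pd_psd[OF A] u(1)] .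
  then show "0 \<le> x \<bullet> ?u" using u x comm_scalar_prod[OF u(1) x] by simp
  fix y :: "real vec" assume y: "y \<in> carrier_vec d"
  note v = minv_mult_vec[OF A y]
  have "?u \<bullet> (A *\<^sub>v (minv A *\<^sub>v y)) = (minv A *\<^sub>v y) \<bullet> (A *\<^sub>v ?u)"
    by (rule psd_sym[OF pd_psd[OF A] u(1) v(1)])
  then show "x \<bullet> (minv A *\<^sub>v y) = y \<bullet> ?u"
    using u v comm_scalar_prod[OF u(1) y] comm_scalar_prod[OF v(1) x] by simp
qed

lemma wnorm_minv_dual:
  assumes A: "pd d A" and x: "x \<in> carrier_vec d" and y: "y \<in> carrier_vec d"
  shows "\<bar>x \<bullet> y\<bar> \<le> wnorm (minv A) x * wnorm A y"
proof -
  have Ay: "A *\<^sub>v y \<in> carrier_vec d" using pd_carrier[OF A] y by simp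
  have "wnorm (minv A) (A *\<^sub>v y) = wnorm A y"
    using minv_mult_vec[OF A y] comm_scalar_prod[OF y Ay] by (simp add: wnorm_def)
  then show ?thesis
    using wnorm_cauchy_schwarz[OF psd_minv[OF A] x Ay] minv_mult_mult_vec[OF A y] by simp
qed

lemma smult_one_mult_vec: "x \<in> carrier_vec d \<Longrightarrow> (a \<cdot>\<^sub>m 1\<^sub>m d) *\<^sub>v x = a \<cdot>\<^sub>v (x :: real vec)"
  by (intro eq_vecI) auto

lemma psd_smult_one:
  assumes "0 \<le> a"
  shows "psd d (a \<cdot>\<^sub>m 1\<^sub>m d)"
  unfolding psd_def using assms
  by (auto simp: smult_one_mult_vec scalar_prod_def mult_ac intro!: sum_nonneg)

lemma pd_smult_one:
  assumes "0 < a"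
  shows "pd d (a \<cdot>\<^sub>m 1\<^sub>m d)"
  using assms psd_smult_one[of a d] by (simp add: pd_def)

lemma wnorm_minv_smult_one:
  assumes a: "0 < a" and x: "x \<in> carrier_vec d"
  shows "wnorm (minv (a \<cdot>\<^sub>m 1\<^sub>m d)) x = vnorm x / sqrt a"
proof -
  have "(a \<cdot>\<^sub>m 1\<^sub>m d) *\<^sub>v ((1 / a) \<cdot>\<^sub>v x) = x" using a x by (simp add: smult_one_mult_vec smult_smult_assoc)
  then have "minv (a \<cdot>\<^sub>m 1\<^sub>m d) *\<^sub>v x = (1 / a) \<cdot>\<^sub>v x"
    using minv_mult_mult_vec[OF pd_smult_one[OF a], of "(1 / a) \<cdot>\<^sub>v x" d] x by simp
  then show ?thesis using x by (simp add: wnorm_def vnorm_def real_sqrt_divide)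
qed

subsection \<open>Rank-one updates\<close>

lemma det_add_mult:
  fixes A B C R :: "'a :: idom mat"
  assumes A: "A \<in> carrier_mat n n" and B: "B \<in> carrier_mat n n" and AB: "A * B = 1\<^sub>m n"
    and C: "C \<in> carrier_mat n m" and R: "R \<in> carrier_mat m n"
  shows "det (A + C * R) = det A * det (R * (B * C) + 1\<^sub>m m)"
proof -
  define M where "M = four_block_mat A C (- R) (1\<^sub>m m)"
  define E1 where "E1 = four_block_mat (1\<^sub>m n) (0\<^sub>m n m) R (1\<^sub>m m)"
  define E2 where "E2 = four_block_mat (1\<^sub>m n) (- (B * C)) (0\<^sub>m m n) (1\<^sub>m m)"
  have BC: "B * C \<in> carrier_mat n m" using B C by simp
  have carrier: "M \<in> carrier_mat (n + m) (n + m)" "E1 \<in> carrier_mat (n + m) (n + m)"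
    "E2 \<in> carrier_mat (n + m) (n + m)"
    unfolding M_def E1_def E2_def using A R C BC by (auto intro!: four_block_carrier_mat)
  have "det E1 = 1" unfolding E1_def
    using R by (subst det_four_block_mat_upper_right_zero[of _ n _ m]) auto
  moreover have "M * E1 = four_block_mat (A + C * R) C (0\<^sub>m m n) (1\<^sub>m m)"
    unfolding M_def E1_def
    using A R C by (subst mult_four_block_mat[of _ n n _ m _ m _ _ n _ m]) simp_all
  ultimately have det_schur: "det M = det (A + C * R)"
    using det_mult[OF carrier(1,2)] A R C
    by (simp add: det_four_block_mat_lower_left_zero[of _ n _ m])
  have "det E2 = 1" unfolding E2_def
    using BC by (subst det_four_block_mat_lower_left_zero[of _ n _ m]) auto
  moreover have "A * (B * C) = C" using assoc_mult_mat[OF A B C] AB C by simp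
  then have "M * E2 = four_block_mat A (0\<^sub>m n m) (- R) (R * (B * C) + 1\<^sub>m m)"
    unfolding M_def E2_def
    using A B R C BC by (subst mult_four_block_mat[of _ n n _ m _ m _ _ n _ m]) simp_all
  ultimately have "det M = det A * det (R * (B * C) + 1\<^sub>m m)"
    using det_mult[OF carrier(1,3)] A R BC
    by (simp add: det_four_block_mat_upper_right_zero[of _ n _ m])
  with det_schur show ?thesis by simp
qed

definition outer :: "real vec \<Rightarrow> real mat" where
  "outer y = mat (dim_vec y) (dim_vec y) (\<lambda>(i, j). y $ i * y $ j)"

lemma outer_carrier [simp]: "y \<in> carrier_vec d \<Longrightarrow> outer y \<in> carrier_mat d d"
  by (auto simp: outer_def)

lemma outer_mult_vec:
  assumes "y \<in> carrier_vec d" "x \<in> carrier_vec d"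
  shows "outer y *\<^sub>v x = (y \<bullet> x) \<cdot>\<^sub>v y"
  using assms
  by (intro eq_vecI) (auto simp: outer_def scalar_prod_def sum_distrib_left sum_distrib_right mult_ac)

lemma det_add_outer:
  assumes A: "pd d A" and y: "y \<in> carrier_vec d"
  shows "det (A + outer y) = det A * (1 + (wnorm (minv A) y)\<^sup>2)"
proof -
  let ?C = "mat d 1 (\<lambda>(i, _). y $ i)" and ?R = "mat 1 d (\<lambda>(_, j). y $ j)"
  note inverse = pd_minv[OF A]
  have "?C * ?R = outer y" using y by (intro eq_matI) (auto simp: outer_def scalar_prod_def)
  then have "det (A + outer y) = det A * det (?R * (minv A * ?C) + 1\<^sub>m 1)"
    using det_add_mult[OF pd_carrier[OF A] inverse(1,2), of ?C 1 ?R] by simp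
  also have "det (?R * (minv A * ?C) + 1\<^sub>m 1) = 1 + y \<bullet> (minv A *\<^sub>v y)"
  proof -
    have "Matrix.row ?R 0 = y" "col ?C 0 = y" using y by auto
    moreover from this have "col (minv A * ?C) 0 = minv A *\<^sub>v y"
      using inverse by (auto simp: mult_mat_vec_def)
    ultimately show ?thesis using inverse by (subst det_single) auto
  qed
  finally show ?thesis using wnorm_square[OF psd_minv[OF A] y] by simp
qed

lemma add_outer_mult_vec:
  assumes A: "A \<in> carrier_mat d d" and y: "y \<in> carrier_vec d" and x: "x \<in> carrier_vec d"
  shows "(A + outer y) *\<^sub>v x = A *\<^sub>v x + (y \<bullet> x) \<cdot>\<^sub>v y"
  using add_mult_distrib_mat_vec[OF A outer_carrier[OF y] x] outer_mult_vec[OF y x] by simp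

lemma scalar_prod_add_outer:
  assumes A: "A \<in> carrier_mat d d" and y: "y \<in> carrier_vec d"
    and x: "x \<in> carrier_vec d" and z: "z \<in> carrier_vec d"
  shows "z \<bullet> ((A + outer y) *\<^sub>v x) = z \<bullet> (A *\<^sub>v x) + (y \<bullet> z) * (y \<bullet> x)"
  unfolding add_outer_mult_vec[OF A y x]
  using A x y z comm_scalar_prod[OF z y] by (simp add: scalar_prod_add_distrib[of _ d])

lemma pd_add_outer:
  assumes A: "pd d A" and y: "y \<in> carrier_vec d"
  shows "pd d (A + outer y)"
proof -
  have "psd d (A + outer y)"
    unfolding psd_def using psd_carrier psd_sym psd_nonneg pd_psd[OF A] y
    by (auto simp: scalar_prod_add_outer[OF pd_carrier[OF A] y] mult.commute)
  moreover have "0 < det A * (1 + (wnorm (minv A) y)\<^sup>2)"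
    using pd_det_pos[OF A] by (intro mult_pos_pos add_pos_nonneg) auto
  ultimately show ?thesis by (simp add: pd_def det_add_outer[OF A y])
qed

lemma wnorm_add_outer:
  assumes A: "pd d A" and y: "y \<in> carrier_vec d" and x: "x \<in> carrier_vec d"
  shows "(wnorm (A + outer y) x)\<^sup>2 = (wnorm A x)\<^sup>2 + (y \<bullet> x)\<^sup>2"
  unfolding wnorm_square[OF pd_psd[OF A] x] wnorm_square[OF pd_psd[OF pd_add_outer[OF A y]] x]
  by (simp add: scalar_prod_add_outer[OF pd_carrier[OF A] y x x] power2_eq_square)

theorem sherman_morrison:
  assumes A: "pd d A" and y: "y \<in> carrier_vec d" and x: "x \<in> carrier_vec d"
  defines "q \<equiv> (y \<bullet> (minv A *\<^sub>v x)) / (1 + (wnorm (minv A) y)\<^sup>2)"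
  shows "minv (A + outer y) *\<^sub>v x = minv A *\<^sub>v x + (- q) \<cdot>\<^sub>v (minv A *\<^sub>v y)"
proof -
  let ?a = "minv A *\<^sub>v x" and ?w = "minv A *\<^sub>v y" and ?B = "A + outer y"
  let ?z = "?a + (- q) \<cdot>\<^sub>v ?w"
  note carrier = pd_carrier[OF A]
  note a = minv_mult_vec[OF A x] and w = minv_mult_vec[OF A y]
  have z: "?z \<in> carrier_vec d" using a w by simp
  have "y \<bullet> ?z = y \<bullet> ?a - q * (y \<bullet> ?w)"
    using a w y by (simp add: scalar_prod_add_distrib[of _ d])
  also have "\<dots> = q"
    using wnorm_square[OF psd_minv[OF A] y] psd_nonneg[OF psd_minv[OF A] y]
    by (simp add: q_def field_simps)
  finally have yz: "y \<bullet> ?z = q" .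
  have "?B *\<^sub>v ?z = A *\<^sub>v ?z + (y \<bullet> ?z) \<cdot>\<^sub>v y" by (rule add_outer_mult_vec[OF carrier y z])
  also have "A *\<^sub>v ?z = x + (- q) \<cdot>\<^sub>v y"
    using a w by (simp add: mult_add_distrib_mat_vec[OF carrier] mult_mat_vec[OF carrier])
  also have "x + (- q) \<cdot>\<^sub>v y + (y \<bullet> ?z) \<cdot>\<^sub>v y = x"
    unfolding yz using x y by (intro eq_vecI) auto
  finally have "?B *\<^sub>v ?z = x" .
  then show ?thesis using minv_mult_mult_vec[OF pd_add_outer[OF A y] z] by simp
qed

lemma wnorm_minv_add_outer:
  assumes A: "pd d A" and y: "y \<in> carrier_vec d" and x: "x \<in> carrier_vec d"
  shows "(wnorm (minv (A + outer y)) x)\<^sup>2 =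
    (wnorm (minv A) x)\<^sup>2 - (y \<bullet> (minv A *\<^sub>v x))\<^sup>2 / (1 + (wnorm (minv A) y)\<^sup>2)"
proof -
  note carriers = minv_mult_vec_carrier[OF A x] minv_mult_vec_carrier[OF A y]
  have "x \<bullet> (minv A *\<^sub>v y) = y \<bullet> (minv A *\<^sub>v x)" by (rule psd_sym[OF psd_minv[OF A] x y])
  then have "x \<bullet> (minv (A + outer y) *\<^sub>v x) =
    x \<bullet> (minv A *\<^sub>v x) - (y \<bullet> (minv A *\<^sub>v x))\<^sup>2 / (1 + (wnorm (minv A) y)\<^sup>2)"
    unfolding sherman_morrison[OF assms]
    using x carriers by (simp add: scalar_prod_add_distrib[of _ d] power2_eq_square)
  then show ?thesis
    using wnorm_square[OF psd_minv[OF A] x] wnorm_square[OF psd_minv[OF pd_add_outer[OF A y]] x] by simp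
qed

definition rank_one_update :: "nat \<Rightarrow> real mat \<Rightarrow> real mat \<Rightarrow> bool" where
  "rank_one_update d A B \<longleftrightarrow> (\<exists>y\<in>carrier_vec d. B = A + outer y)"

lemma pd_rank_one_updates:
  assumes "(rank_one_update d)\<^sup>*\<^sup>* A B" "pd d A"
  shows "pd d B"
  using assms
proof (induction rule: rtranclp_induct)
  case (step B C)
  then obtain y where "y \<in> carrier_vec d" "C = B + outer y" unfolding rank_one_update_def by blast
  with step show ?case by (simp add: pd_add_outer)
qed

lemma rank_one_updates_mono:
  fixes f :: "real mat \<Rightarrow> 'a :: preorder"
  assumes "(rank_one_update d)\<^sup>*\<^sup>* A B" and A: "pd d A"
    and update: "\<And>A y. pd d A \<Longrightarrow> y \<in> carrier_vec d \<Longrightarrow> f A \<le> f (A + outer y)"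
  shows "f A \<le> f B"
  using assms(1)
proof (induction rule: rtranclp_induct)
  case (step B C)
  then obtain y where y: "y \<in> carrier_vec d" "C = B + outer y" unfolding rank_one_update_def by blast
  have "f B \<le> f C" unfolding y(2) by (rule update[OF pd_rank_one_updates[OF step.hyps(1) A] y(1)])
  with step.IH show ?case by (rule order.trans)
qed simp

lemma det_rank_one_updates_mono:
  assumes "(rank_one_update d)\<^sup>*\<^sup>* A B" "pd d A"
  shows "det A \<le> det B"
  using assms
proof (rule rank_one_updates_mono[where f = det])
  show "det A \<le> det (A + outer y)" if "pd d A" "y \<in> carrier_vec d" for A y
    using pd_det_pos[OF that(1)] by (simp add: det_add_outer[OF that] mult_le_cancel_left1)
qed

lemma wnorm_rank_one_updates_mono:
  assumes "(rank_one_update d)\<^sup>*\<^sup>* A B" "pd d A" and x: "x \<in> carrier_vec d"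
  shows "wnorm A x \<le> wnorm B x"
  using assms(1,2)
proof (rule rank_one_updates_mono[where f = "\<lambda>A. wnorm A x"])
  show "wnorm A x \<le> wnorm (A + outer y) x" if "pd d A" "y \<in> carrier_vec d" for A y
  proof (rule power2_le_imp_le)
    show "(wnorm A x)\<^sup>2 \<le> (wnorm (A + outer y) x)\<^sup>2" by (simp add: wnorm_add_outer[OF that x])
  qed (rule wnorm_nonneg[OF pd_psd[OF pd_add_outer[OF that]] x])
qed

lemma wnorm_minv_rank_one_updates_antimono:
  assumes "(rank_one_update d)\<^sup>*\<^sup>* A B" "pd d A" and x: "x \<in> carrier_vec d"
  shows "wnorm (minv B) x \<le> wnorm (minv A) x"
proof -
  have "- wnorm (minv A) x \<le> - wnorm (minv B) x"
    using assms(1,2)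
  proof (rule rank_one_updates_mono[where f = "\<lambda>A. - wnorm (minv A) x"])
    show "- wnorm (minv A) x \<le> - wnorm (minv (A + outer y)) x"
      if A: "pd d A" and y: "y \<in> carrier_vec d" for A y
    proof -
      have "0 \<le> (y \<bullet> (minv A *\<^sub>v x))\<^sup>2 / (1 + (wnorm (minv A) y)\<^sup>2)"
        by (intro divide_nonneg_nonneg) simp_all
      then have "(wnorm (minv (A + outer y)) x)\<^sup>2 \<le> (wnorm (minv A) x)\<^sup>2"
        unfolding wnorm_minv_add_outer[OF A y x] by linarith
      from power2_le_imp_le[OF this wnorm_nonneg[OF psd_minv[OF A] x]] show ?thesis by simp
    qed
  qed
  then show ?thesis by simp
qed

lemma det_wnorm_minv_rank_one_updates_mono:
  assumes "(rank_one_update d)\<^sup>*\<^sup>* A B" "pd d A" and x: "x \<in> carrier_vec d"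
  shows "det A * (wnorm (minv A) x)\<^sup>2 \<le> det B * (wnorm (minv B) x)\<^sup>2"
  using assms(1,2)
proof (rule rank_one_updates_mono[where f = "\<lambda>A. det A * (wnorm (minv A) x)\<^sup>2"])
  show "det A * (wnorm (minv A) x)\<^sup>2 \<le> det (A + outer y) * (wnorm (minv (A + outer y)) x)\<^sup>2"
    if A: "pd d A" and y: "y \<in> carrier_vec d" for A y
  proof -
    let ?a = "(wnorm (minv A) x)\<^sup>2" and ?b = "y \<bullet> (minv A *\<^sub>v x)" and ?c = "(wnorm (minv A) y)\<^sup>2"
    have "?b\<^sup>2 \<le> ?c * ?a"
      using psd_cauchy_schwarz[OF psd_minv[OF A] y x] by (simp add: wnorm_square[OF psd_minv[OF A]] x y)
    moreover have "(1 + ?c) * (?a - ?b\<^sup>2 / (1 + ?c)) = (1 + ?c) * ?a - ?b\<^sup>2"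
      using add_pos_nonneg[of 1 ?c] by (simp add: right_diff_distrib)
    ultimately have "?a \<le> (1 + ?c) * (?a - ?b\<^sup>2 / (1 + ?c))" by (simp only: distrib_right)
    then show ?thesis
      using pd_det_pos[OF A] by (simp add: det_add_outer[OF A y] wnorm_minv_add_outer[OF A y x] mult.assoc)
  qed
qed

subsection \<open>Gram matrices\<close>

definition gram :: "nat \<Rightarrow> 'i set \<Rightarrow> ('i \<Rightarrow> real vec) \<Rightarrow> real mat" where
  "gram d I y = mat d d (\<lambda>(i, j). \<Sum>k\<in>I. y k $ i * y k $ j)"

lemma gram_carrier [simp]: "gram d I y \<in> carrier_mat d d"
  and dim_gram [simp]: "dim_row (gram d I y) = d" "dim_col (gram d I y) = d"
  by (simp_all add: gram_def)

lemma add_gram_empty: "A \<in> carrier_mat d d \<Longrightarrow> A + gram d {} y = A"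
  by (intro eq_matI) (simp_all add: gram_def)

lemma add_gram_insert:
  assumes "A \<in> carrier_mat d d" "finite I" "k \<notin> I" "y k \<in> carrier_vec d"
  shows "A + gram d (insert k I) y = (A + gram d I y) + outer (y k)"
  using assms(1-3) carrier_matD[OF outer_carrier[OF assms(4)]] carrier_vecD[OF assms(4)]
  by (intro eq_matI) (simp_all add: gram_def outer_def)

lemma rank_one_updates_gram:
  assumes A: "A \<in> carrier_mat d d" and "finite I" "\<And>k. k \<in> I \<Longrightarrow> y k \<in> carrier_vec d"
  shows "(rank_one_update d)\<^sup>*\<^sup>* A (A + gram d I y)"
  using assms(2,3)
proof (induction I rule: finite_induct)
  case empty
  then show ?case by (simp add: add_gram_empty[OF A])
next
  case (insert k I)
  then have "rank_one_update d (A + gram d I y) (A + gram d (insert k I) y)"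
    unfolding rank_one_update_def using A by (auto simp: add_gram_insert)
  with insert show ?case by (auto intro: rtranclp.rtrancl_into_rtrancl)
qed

lemma det_add_gram_ge:
  assumes A: "pd d A" and "finite I" "\<And>k. k \<in> I \<Longrightarrow> y k \<in> carrier_vec d"
  shows "det A * (1 + (\<Sum>k\<in>I. (wnorm (minv A) (y k))\<^sup>2)) \<le> det (A + gram d I y)"
  using assms(2,3)
proof (induction I rule: finite_induct)
  case empty
  then show ?case by (simp add: add_gram_empty[OF pd_carrier[OF A]])
next
  case (insert k I)
  let ?B = "A + gram d I y"
  have yk: "y k \<in> carrier_vec d" using insert.prems by simp
  have updates: "(rank_one_update d)\<^sup>*\<^sup>* A ?B"
    using insert by (intro rank_one_updates_gram pd_carrier[OF A]) auto
  note B = pd_rank_one_updates[OF updates A]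
  have "det A * (1 + (\<Sum>k\<in>insert k I. (wnorm (minv A) (y k))\<^sup>2))
    = det A * (1 + (\<Sum>k\<in>I. (wnorm (minv A) (y k))\<^sup>2)) + det A * (wnorm (minv A) (y k))\<^sup>2"
    using insert.hyps by (simp add: algebra_simps)
  also have "\<dots> \<le> det ?B + det ?B * (wnorm (minv ?B) (y k))\<^sup>2"
    using insert by (intro add_mono det_wnorm_minv_rank_one_updates_mono[OF updates A]) auto
  also have "\<dots> = det (A + gram d (insert k I) y)"
    unfolding add_gram_insert[where y = y, OF pd_carrier[OF A] insert.hyps yk] det_add_outer[OF B yk]
    by (simp add: distrib_left)
  finally show ?case .
qed

subsection \<open>Coordinates\<close>

lemma abs_vec_index_le_vnorm:
  assumes "v \<in> carrier_vec d" "j < d"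
  shows "\<bar>v $ j\<bar> \<le> vnorm v"
proof -
  have "vnorm v = L2_set (\<lambda>i. \<bar>v $ i\<bar>) {0..<d}"
    using assms by (simp add: vnorm_def scalar_prod_def L2_set_def power2_eq_square)
  then show ?thesis using member_le_L2_set[of "{0..<d}" j "\<lambda>i. \<bar>v $ i\<bar>"] assms by simp
qed

lemma vnorm_nonneg: "0 \<le> vnorm v"
  by (simp add: vnorm_def scalar_prod_def sum_nonneg)

lemma abs_det_le:
  fixes A :: "real mat"
  assumes A: "A \<in> carrier_mat d d" and b: "\<And>i j. i < d \<Longrightarrow> j < d \<Longrightarrow> \<bar>A $$ (i, j)\<bar> \<le> b"
  shows "\<bar>det A\<bar> \<le> (real d * b) ^ d"
proof -
  let ?P = "{p. p permutes {0..<d}}"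
  have "\<bar>det A\<bar> \<le> (\<Sum>p\<in>?P. \<bar>signof p * (\<Prod>i = 0..<d. A $$ (i, p i))\<bar>)"
    unfolding det_def'[OF A] by (rule sum_abs)
  also have "\<dots> \<le> (\<Sum>p\<in>?P. b ^ d)"
  proof (rule sum_mono)
    fix p assume "p \<in> ?P"
    then have p: "p permutes {0..<d}" by simp
    have "\<bar>signof p * (\<Prod>i = 0..<d. A $$ (i, p i))\<bar> = (\<Prod>i = 0..<d. \<bar>A $$ (i, p i)\<bar>)"
      by (simp add: abs_mult abs_prod sign_def)
    also have "\<dots> \<le> (\<Prod>i = 0..<d. b)"
      by (rule prod_mono) (use permutes_in_image[OF p] b in auto)
    finally show "\<bar>signof p * (\<Prod>i = 0..<d. A $$ (i, p i))\<bar> \<le> b ^ d" by simp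
  qed
  also have "\<dots> = fact d * b ^ d" by (simp add: card_permutations[of _ d])
  also have "\<dots> \<le> real d ^ d * b ^ d"
  proof (cases "d = 0")
    case False
    then have "b \<ge> 0" using b[of 0 0] by simp
    then show ?thesis using fact_le_power[of d, where 'a = real] by (intro mult_right_mono) simp_all
  qed simp
  finally show ?thesis by (simp add: power_mult_distrib)
qed

section \<open>The multinomial logit model\<close>

definition coord_line :: "nat \<Rightarrow> real vec \<Rightarrow> nat \<Rightarrow> real \<Rightarrow> real vec" where
  "coord_line d \<theta> i u = vec d (\<lambda>j. if j = i then u else \<theta> $ j)"

lemma coord_line_carrier [simp]: "coord_line d \<theta> i u \<in> carrier_vec d"
  by (simp add: coord_line_def)

lemma coord_line_self: "\<theta> \<in> carrier_vec d \<Longrightarrow> coord_line d \<theta> i (\<theta> $ i) = \<theta>"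
  by (intro eq_vecI) (auto simp: coord_line_def)

lemma scalar_prod_coord_line:
  assumes "v \<in> carrier_vec d" "\<theta> \<in> carrier_vec d" "i < d"
  shows "v \<bullet> coord_line d \<theta> i u = (v \<bullet> \<theta> - \<theta> $ i * v $ i) + u * v $ i"
  using assms by (simp add: scalar_prod_def coord_line_def sum.remove[of "{0..<d}" i] mult.commute)

lemma pdiff_eqI:
  assumes "((\<lambda>u. f (coord_line d \<theta> i u)) has_real_derivative D) (at (\<theta> $ i))"
  shows "pdiff d f \<theta> i = D"
  using DERIV_imp_deriv[OF assms] by (simp add: pdiff_def coord_line_def)

abbreviation mnl_kernel :: "ucparams \<Rightarrow> real vec \<Rightarrow> nat \<Rightarrow> nat \<Rightarrow> nat \<Rightarrow> real" where
  "mnl_kernel M \<equiv> mnl (phi M) (pSsa M)"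

definition hess_factor :: "ucparams \<Rightarrow> nat \<Rightarrow> nat \<Rightarrow> real vec \<Rightarrow> nat \<Rightarrow> real vec" where
  "hess_factor M s a \<theta> k = sqrt (mnl_kernel M \<theta> s a k) \<cdot>\<^sub>v (phi M s a k - mean_feat M \<theta> s a)"

definition centered_width :: "ucparams \<Rightarrow> nat \<Rightarrow> nat \<Rightarrow> real vec \<Rightarrow> real mat \<Rightarrow> real" where
  "centered_width M s a \<theta> A = weighted_mean (pSsa M s a) (mnl_kernel M \<theta> s a)
     (\<lambda>k. wnorm (minv A) (phi M s a k - mean_feat M \<theta> s a))"

definition feature_variance :: "ucparams \<Rightarrow> nat \<Rightarrow> nat \<Rightarrow> real vec \<Rightarrow> real mat \<Rightarrow> real" where
  "feature_variance M s a \<theta> A = weighted_mean (pSsa M s a) (mnl_kernel M \<theta> s a)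
     (\<lambda>k. (wnorm (minv A) (phi M s a k - mean_feat M \<theta> s a))\<^sup>2)"

definition max_feature_square :: "ucparams \<Rightarrow> nat \<Rightarrow> nat \<Rightarrow> real mat \<Rightarrow> real" where
  "max_feature_square M s a A = Max ((\<lambda>k. (wnorm (minv A) (phi M s a k))\<^sup>2) ` pSsa M s a)"

definition conf_radius :: "ucparams \<Rightarrow> nat \<Rightarrow> nat \<Rightarrow> real vec \<Rightarrow> real mat \<Rightarrow> real \<Rightarrow> real" where
  "conf_radius M s a \<theta> A b = b * centered_width M s a \<theta> A + 3 * b\<^sup>2 * max_feature_square M s a A"

lemma mem_conf_set_iff:
  "q \<in> conf_set M \<theta> \<Sigma> b \<longleftrightarrow> (\<forall>s\<in>pS M. \<forall>a\<in>pA M.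
     (\<forall>k\<in>pS M. 0 \<le> q s a k \<and> q s a k \<le> 1) \<and> (\<Sum>k\<in>pSsa M s a. q s a k) = 1 \<and>
     l1_dist (pSsa M s a) (q s a) (mnl_kernel M \<theta> s a) \<le> conf_radius M s a \<theta> \<Sigma> b)"
  by (simp add: conf_set_def conf_radius_def centered_width_def max_feature_square_def weighted_mean_def)

locale mnl_model =
  fixes M :: ucparams and s a :: nat
  assumes finite_reachable: "finite (pSsa M s a)" and reachable_nonempty: "pSsa M s a \<noteq> {}"
    and phi_carrier: "\<And>k. k \<in> pSsa M s a \<Longrightarrow> phi M s a k \<in> carrier_vec (dim M)"
begin

abbreviation "I \<equiv> pSsa M s a"
abbreviation "\<phi> \<equiv> phi M s a"
abbreviation "d \<equiv> dim M"
abbreviation "p \<theta> \<equiv> mnl_kernel M \<theta> s a"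
abbreviation "mean \<theta> \<equiv> mean_feat M \<theta> s a"

sublocale softmax: finite_softmax I
  using finite_reachable reachable_nonempty by unfold_locales

lemma mnl_eq_softmax: "k \<in> I \<Longrightarrow> p \<theta> k = softmax I (\<lambda>k. \<phi> k \<bullet> \<theta>) k"
  by (simp add: mnl_def softmax_def)

lemma mnl_outside: "k \<notin> I \<Longrightarrow> p \<theta> k = 0"
  by (simp add: mnl_def)

lemma mnl_pos: "k \<in> I \<Longrightarrow> 0 < p \<theta> k"
  by (simp add: mnl_eq_softmax softmax.softmax_pos)

lemma mnl_nonneg: "0 \<le> p \<theta> k"
  using mnl_pos[of k \<theta>] mnl_outside[of k \<theta>] by (cases "k \<in> I") auto

sublocale prob_weights I "p \<theta>" for \<theta>
proof
  show "(\<Sum>k\<in>I. p \<theta> k) = 1" using softmax.sum_weights by (simp add: mnl_eq_softmax)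
qed (rule finite_reachable mnl_nonneg)+

lemma mnl_le_1: "p \<theta> k \<le> 1"
  using weight_le_1[of k \<theta>] mnl_outside[of k \<theta>] by (cases "k \<in> I") auto

lemma mean_carrier [simp]: "mean \<theta> \<in> carrier_vec d" by (simp add: mean_feat_def)

lemma dim_mean [simp]: "dim_vec (mean \<theta>) = d" by (simp add: mean_feat_def)

lemma centered_carrier: "k \<in> I \<Longrightarrow> \<phi> k - mean \<theta> \<in> carrier_vec d"
  using phi_carrier by simp

lemma mean_index: "i < d \<Longrightarrow> mean \<theta> $ i = weighted_mean I (p \<theta>) (\<lambda>k. \<phi> k $ i)"
  by (simp add: mean_feat_def weighted_mean_def)

lemma scalar_prod_mean:
  assumes v: "v \<in> carrier_vec d"
  shows "mean \<theta> \<bullet> v = weighted_mean I (p \<theta>) (\<lambda>k. \<phi> k \<bullet> v)"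
proof -
  have "mean \<theta> \<bullet> v = (\<Sum>i<d. \<Sum>k\<in>I. p \<theta> k * (\<phi> k $ i * v $ i))"
    using v by (simp add: scalar_prod_def mean_feat_def atLeast0LessThan sum_distrib_right mult.assoc)
  also have "\<dots> = (\<Sum>k\<in>I. p \<theta> k * (\<Sum>i<d. \<phi> k $ i * v $ i))"
    unfolding sum_distrib_left by (rule sum.swap)
  finally show ?thesis using v by (simp add: weighted_mean_def scalar_prod_def atLeast0LessThan)
qed

subsection \<open>Derivatives of the loss\<close>

context
  fixes \<theta> :: "real vec" and i :: nat
  assumes \<theta>: "\<theta> \<in> carrier_vec d" and i: "i < d"
begin

lemma mnl_coord_line:
  assumes "k \<in> I"
  shows "p (coord_line d \<theta> i u) k = softmax I (\<lambda>k. (\<phi> k \<bullet> \<theta> - \<theta> $ i * \<phi> k $ i) + u * \<phi> k $ i) k"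
  unfolding mnl_eq_softmax[OF assms]
  by (intro softmax_cong assms scalar_prod_coord_line phi_carrier \<theta> i)

lemma has_real_derivative_mnl:
  assumes k: "k \<in> I"
  shows "((\<lambda>u. p (coord_line d \<theta> i u) k) has_real_derivative p \<theta> k * (\<phi> k $ i - mean \<theta> $ i)) (at (\<theta> $ i))"
  using softmax.has_real_derivative_softmax[of "\<lambda>k. \<phi> k \<bullet> \<theta> - \<theta> $ i * \<phi> k $ i" "\<lambda>k. \<phi> k $ i" k "\<theta> $ i"]
  by (simp add: mnl_coord_line[OF k] mean_index[OF i] k mnl_eq_softmax[symmetric]
      cong: weighted_mean_cong)

lemma has_real_derivative_mean:
  assumes j: "j < d"
  shows "((\<lambda>u. mean (coord_line d \<theta> i u) $ j) has_real_derivative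
    weighted_cov I (p \<theta>) (\<lambda>k. \<phi> k $ i) (\<lambda>k. \<phi> k $ j)) (at (\<theta> $ i))"
  using softmax.has_real_derivative_weighted_mean_softmax
    [of "\<lambda>k. \<phi> k \<bullet> \<theta> - \<theta> $ i * \<phi> k $ i" "\<lambda>k. \<phi> k $ i" "\<lambda>k. \<phi> k $ j" "\<theta> $ i"]
  by (simp add: mnl_coord_line mean_index[OF j] weighted_cov_def mnl_eq_softmax[symmetric]
      cong: weighted_mean_cong)

end

lemma loss_eq: "s2 \<in> I \<Longrightarrow> loss M s a s2 \<theta> = - ln (p \<theta> s2)"
  using finite_reachable by (simp add: loss_def if_distrib[of "\<lambda>t. t * _"] cong: if_cong)

lemma pdiff_loss:
  assumes s2: "s2 \<in> I" and \<theta>: "\<theta> \<in> carrier_vec d" and i: "i < d"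
  shows "pdiff d (loss M s a s2) \<theta> i = mean \<theta> $ i - \<phi> s2 $ i"
proof (rule pdiff_eqI)
  show "((\<lambda>u. loss M s a s2 (coord_line d \<theta> i u)) has_real_derivative mean \<theta> $ i - \<phi> s2 $ i) (at (\<theta> $ i))"
    unfolding loss_eq[OF s2] using mnl_pos[OF s2, of \<theta>]
    by (auto intro!: derivative_eq_intros has_real_derivative_mnl \<theta> i s2 simp: coord_line_self[OF \<theta>])
qed

lemma pdiff_pdiff_loss:
  assumes s2: "s2 \<in> I" and \<theta>: "\<theta> \<in> carrier_vec d" and i: "i < d" and j: "j < d"
  shows "pdiff d (\<lambda>\<theta>. pdiff d (loss M s a s2) \<theta> j) \<theta> i =
    weighted_cov I (p \<theta>) (\<lambda>k. \<phi> k $ i) (\<lambda>k. \<phi> k $ j)"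
proof (rule pdiff_eqI)
  show "((\<lambda>u. pdiff d (loss M s a s2) (coord_line d \<theta> i u) j) has_real_derivative
      weighted_cov I (p \<theta>) (\<lambda>k. \<phi> k $ i) (\<lambda>k. \<phi> k $ j)) (at (\<theta> $ i))"
    unfolding pdiff_loss[OF s2 coord_line_carrier j]
    by (auto intro!: derivative_eq_intros has_real_derivative_mean \<theta> i j)
qed

lemma gram_hess_factor_index:
  assumes i: "i < d" and j: "j < d"
  shows "gram d I (hess_factor M s a \<theta>) $$ (i, j) = weighted_cov I (p \<theta>) (\<lambda>k. \<phi> k $ i) (\<lambda>k. \<phi> k $ j)"
proof -
  have index: "hess_factor M s a \<theta> k $ l = sqrt (p \<theta> k) * (\<phi> k $ l - mean \<theta> $ l)" if "l < d" for k l
    using that by (simp add: hess_factor_def)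
  have "hess_factor M s a \<theta> k $ i * hess_factor M s a \<theta> k $ j
    = p \<theta> k * (\<phi> k $ i - mean \<theta> $ i) * (\<phi> k $ j - mean \<theta> $ j)" for k
  proof -
    have "hess_factor M s a \<theta> k $ i * hess_factor M s a \<theta> k $ j
      = (sqrt (p \<theta> k) * sqrt (p \<theta> k)) * (\<phi> k $ i - mean \<theta> $ i) * (\<phi> k $ j - mean \<theta> $ j)"
      unfolding index[OF i] index[OF j] by (simp only: mult_ac)
    also have "sqrt (p \<theta> k) * sqrt (p \<theta> k) = p \<theta> k" by (simp add: mnl_nonneg)
    finally show ?thesis .
  qed
  then show ?thesis using i j by (simp add: gram_def weighted_cov_def mean_index)
qed

lemma hess_loss:
  assumes s2: "s2 \<in> I" and \<theta>: "\<theta> \<in> carrier_vec d"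
  shows "hess d (loss M s a s2) \<theta> = gram d I (hess_factor M s a \<theta>)"
proof (rule eq_matI)
  fix i j
  assume "i < dim_row (gram d I (hess_factor M s a \<theta>))" "j < dim_col (gram d I (hess_factor M s a \<theta>))"
  then have "i < d" "j < d" by simp_all
  then show "hess d (loss M s a s2) \<theta> $$ (i, j) = gram d I (hess_factor M s a \<theta>) $$ (i, j)"
    by (simp add: hess_def pdiff_pdiff_loss[OF s2 \<theta>] gram_hess_factor_index weighted_cov_def mult_ac)
qed (simp_all add: hess_def gram_def)

lemma hess_factor_carrier: "k \<in> I \<Longrightarrow> hess_factor M s a \<theta> k \<in> carrier_vec d"
  by (simp add: hess_factor_def centered_carrier)

lemma abs_gram_hess_factor_le:
  assumes "\<And>k. k \<in> I \<Longrightarrow> vnorm (\<phi> k) \<le> L" "i < d" "j < d"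
  shows "\<bar>gram d I (hess_factor M s a \<theta>) $$ (i, j)\<bar> \<le> 4 * L\<^sup>2"
proof -
  have "\<bar>\<phi> k $ l\<bar> \<le> L" if "k \<in> I" "l < d" for k l
    using abs_vec_index_le_vnorm[OF phi_carrier that(2)] assms(1)[OF that(1)] that(1) order.trans by blast
  then have "\<bar>weighted_cov I (p \<theta>) (\<lambda>k. \<phi> k $ i) (\<lambda>k. \<phi> k $ j)\<bar> \<le> (2 * L) * (2 * L)"
    using assms(2,3) by (intro abs_weighted_cov_le) auto
  then show ?thesis by (simp add: gram_hess_factor_index assms(2,3) power2_eq_square)
qed

subsection \<open>Sensitivity in the dual norm\<close>

lemma wnorm_feature_square_le: "k \<in> I \<Longrightarrow> (wnorm (minv A) (\<phi> k))\<^sup>2 \<le> max_feature_square M s a A"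
  unfolding max_feature_square_def using finite_reachable by (intro Max_ge) auto

lemma wnorm_feature_le: "k \<in> I \<Longrightarrow> wnorm (minv A) (\<phi> k) \<le> sqrt (max_feature_square M s a A)"
  by (rule real_le_rsqrt[OF wnorm_feature_square_le])

lemma max_feature_square_nonneg: "0 \<le> max_feature_square M s a A"
proof -
  obtain k where "k \<in> I" using reachable_nonempty by blast
  from order.trans[OF zero_le_power2 wnorm_feature_square_le[OF this]] show ?thesis .
qed

lemma max_feature_square_le:
  assumes "\<And>k. k \<in> I \<Longrightarrow> (wnorm (minv A) (\<phi> k))\<^sup>2 \<le> u"
  shows "max_feature_square M s a A \<le> u"
  unfolding max_feature_square_def using assms finite_reachable reachable_nonempty
  by (subst Max_le_iff) auto

lemma feature_variance_nonneg: "0 \<le> feature_variance M s a \<theta> A"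
  unfolding feature_variance_def by (intro weighted_mean_nonneg) simp

lemma centered_width_square_le: "(centered_width M s a \<theta> A)\<^sup>2 \<le> feature_variance M s a \<theta> A"
  unfolding centered_width_def feature_variance_def by (rule weighted_mean_square_le)

context
  fixes A :: "real mat"
  assumes A: "pd d A"
begin

lemma centered_width_nonneg: "0 \<le> centered_width M s a \<theta> A"
  unfolding centered_width_def
  by (intro weighted_mean_nonneg wnorm_nonneg[OF psd_minv[OF A]] centered_carrier)

lemma sum_wnorm_hess_factor:
  "(\<Sum>k\<in>I. (wnorm (minv A) (hess_factor M s a \<theta> k))\<^sup>2) = feature_variance M s a \<theta> A"
  unfolding feature_variance_def weighted_mean_def hess_factor_def
  by (intro sum.cong refl)
     (simp add: wnorm_smult[OF psd_minv[OF A] centered_carrier] power_mult_distrib mnl_nonneg)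

lemma abs_feature_scalar_prod_le:
  assumes "k \<in> I" and v: "v \<in> carrier_vec d"
  shows "\<bar>\<phi> k \<bullet> v\<bar> \<le> sqrt (max_feature_square M s a A) * wnorm A v"
  by (rule order.trans[OF wnorm_minv_dual[OF A phi_carrier[OF assms(1)] v]])
     (intro mult_right_mono wnorm_feature_le wnorm_nonneg[OF pd_psd[OF A] v] assms(1))

lemma wnorm_mean_le: "wnorm (minv A) (mean \<theta>) \<le> sqrt (max_feature_square M s a A)"
proof -
  have "wnorm (minv A) (mean \<theta>) \<le> (\<Sum>k\<in>I. \<bar>p \<theta> k\<bar> * wnorm (minv A) (\<phi> k))"
    using wnorm_sum_le[where v = \<phi> and c = "p \<theta>", OF psd_minv[OF A] finite_reachable phi_carrier]
    by (simp add: mean_feat_def)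
  also have "\<dots> = weighted_mean I (p \<theta>) (\<lambda>k. wnorm (minv A) (\<phi> k))"
    by (simp add: weighted_mean_def mnl_nonneg)
  also have "\<dots> \<le> sqrt (max_feature_square M s a A)"
    by (rule weighted_mean_le[OF wnorm_feature_le])
  finally show ?thesis .
qed

lemma wnorm_centered_le:
  assumes k: "k \<in> I"
  shows "wnorm (minv A) (\<phi> k - mean \<theta>) \<le> 2 * sqrt (max_feature_square M s a A)"
proof -
  have "wnorm (minv A) (\<phi> k - mean \<theta>)
    \<le> wnorm (minv A) (\<phi> k - 0\<^sub>v d) + wnorm (minv A) (0\<^sub>v d - mean \<theta>)"
    by (rule wnorm_diff_triangle_le[OF psd_minv[OF A] phi_carrier[OF k] zero_carrier_vec mean_carrier])
  also have "wnorm (minv A) (0\<^sub>v d - mean \<theta>) = wnorm (minv A) (mean \<theta>)"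
    using wnorm_minus_commute[OF psd_minv[OF A] zero_carrier_vec mean_carrier] by simp
  finally show ?thesis
    using phi_carrier[OF k] wnorm_feature_le[OF k, of A] wnorm_mean_le[of \<theta>] by simp
qed

lemma feature_variance_le: "feature_variance M s a \<theta> A \<le> 4 * max_feature_square M s a A"
  unfolding feature_variance_def
proof (rule weighted_mean_le)
  fix k assume k: "k \<in> I"
  have "(wnorm (minv A) (\<phi> k - mean \<theta>))\<^sup>2 \<le> (2 * sqrt (max_feature_square M s a A))\<^sup>2"
    by (intro power_mono wnorm_centered_le wnorm_nonneg[OF psd_minv[OF A]] centered_carrier k)
  then show "(wnorm (minv A) (\<phi> k - mean \<theta>))\<^sup>2 \<le> 4 * max_feature_square M s a A"
    by (simp add: power_mult_distrib max_feature_square_nonneg)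
qed

lemma abs_centered_scalar_prod_le:
  assumes k: "k \<in> I" and v: "v \<in> carrier_vec d"
  shows "\<bar>\<phi> k \<bullet> v - mean \<theta> \<bullet> v\<bar> \<le> wnorm A v * wnorm (minv A) (\<phi> k - mean \<theta>)"
  using wnorm_minv_dual[OF A centered_carrier[OF k] v]
  by (simp add: minus_scalar_prod_distrib[OF phi_carrier[OF k] mean_carrier v] mult.commute)

lemma wnorm_mean_diff_le:
  "wnorm (minv A) (mean \<theta>\<^sub>1 - mean \<theta>\<^sub>0) \<le> l1_dist I (p \<theta>\<^sub>1) (p \<theta>\<^sub>0) * sqrt (max_feature_square M s a A)"
proof -
  have "mean \<theta>\<^sub>1 - mean \<theta>\<^sub>0 = vec d (\<lambda>j. \<Sum>k\<in>I. (p \<theta>\<^sub>1 k - p \<theta>\<^sub>0 k) * \<phi> k $ j)"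
    by (intro eq_vecI) (auto simp: mean_feat_def left_diff_distrib sum_subtractf)
  then have "wnorm (minv A) (mean \<theta>\<^sub>1 - mean \<theta>\<^sub>0) \<le> (\<Sum>k\<in>I. \<bar>p \<theta>\<^sub>1 k - p \<theta>\<^sub>0 k\<bar> * wnorm (minv A) (\<phi> k))"
    using wnorm_sum_le
      [where v = \<phi> and c = "\<lambda>k. p \<theta>\<^sub>1 k - p \<theta>\<^sub>0 k", OF psd_minv[OF A] finite_reachable phi_carrier]
    by simp
  also have "\<dots> \<le> (\<Sum>k\<in>I. \<bar>p \<theta>\<^sub>1 k - p \<theta>\<^sub>0 k\<bar> * sqrt (max_feature_square M s a A))"
    by (intro sum_mono mult_left_mono wnorm_feature_le) auto
  finally show ?thesis by (simp add: sum_distrib_right)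
qed

context
  fixes \<theta>\<^sub>0 \<theta>\<^sub>1 :: "real vec"
  assumes \<theta>\<^sub>0: "\<theta>\<^sub>0 \<in> carrier_vec d" and \<theta>\<^sub>1: "\<theta>\<^sub>1 \<in> carrier_vec d"
begin

lemma logit_diff: "k \<in> I \<Longrightarrow> \<phi> k \<bullet> \<theta>\<^sub>1 - \<phi> k \<bullet> \<theta>\<^sub>0 = \<phi> k \<bullet> (\<theta>\<^sub>1 - \<theta>\<^sub>0)"
  using scalar_prod_minus_distrib[OF phi_carrier \<theta>\<^sub>1 \<theta>\<^sub>0] by simp

lemma abs_logit_diff_le:
  "k \<in> I \<Longrightarrow> \<bar>\<phi> k \<bullet> \<theta>\<^sub>1 - \<phi> k \<bullet> \<theta>\<^sub>0\<bar> \<le> sqrt (max_feature_square M s a A) * wnorm A (\<theta>\<^sub>1 - \<theta>\<^sub>0)"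
  using abs_feature_scalar_prod_le[of k "\<theta>\<^sub>1 - \<theta>\<^sub>0"] \<theta>\<^sub>0 \<theta>\<^sub>1 by (simp add: logit_diff)

lemma mnl_l1_lipschitz:
  "l1_dist I (p \<theta>\<^sub>1) (p \<theta>\<^sub>0) \<le> 2 * (sqrt (max_feature_square M s a A) * wnorm A (\<theta>\<^sub>1 - \<theta>\<^sub>0))"
  using softmax.softmax_l1_lipschitz[OF abs_logit_diff_le] by (simp add: mnl_eq_softmax)

lemma mnl_l1_second_order:
  "l1_dist I (p \<theta>\<^sub>1) (p \<theta>\<^sub>0) \<le> wnorm A (\<theta>\<^sub>1 - \<theta>\<^sub>0) * centered_width M s a \<theta>\<^sub>0 A
     + (wnorm A (\<theta>\<^sub>1 - \<theta>\<^sub>0))\<^sup>2 * max_feature_square M s a A"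
proof -
  define v where "v = \<theta>\<^sub>1 - \<theta>\<^sub>0"
  have v: "v \<in> carrier_vec d" using \<theta>\<^sub>0 \<theta>\<^sub>1 by (simp add: v_def)
  define x where "x k = \<phi> k \<bullet> \<theta>\<^sub>1 - \<phi> k \<bullet> \<theta>\<^sub>0" for k
  have "weighted_mean I (p \<theta>\<^sub>0) x = mean \<theta>\<^sub>0 \<bullet> v"
    unfolding scalar_prod_mean[OF v] by (rule weighted_mean_cong) (simp_all add: x_def v_def logit_diff)
  then have "weighted_mean I (p \<theta>\<^sub>0) (\<lambda>k. \<bar>x k - weighted_mean I (p \<theta>\<^sub>0) x\<bar>)
    \<le> weighted_mean I (p \<theta>\<^sub>0) (\<lambda>k. wnorm A v * wnorm (minv A) (\<phi> k - mean \<theta>\<^sub>0))"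
    using abs_centered_scalar_prod_le[OF _ v, of _ \<theta>\<^sub>0]
    by (intro weighted_mean_mono) (simp add: x_def v_def logit_diff)
  also have "\<dots> = wnorm A v * centered_width M s a \<theta>\<^sub>0 A"
    by (simp add: weighted_mean_cmult centered_width_def)
  finally have "l1_dist I (p \<theta>\<^sub>1) (p \<theta>\<^sub>0)
    \<le> wnorm A v * centered_width M s a \<theta>\<^sub>0 A + (sqrt (max_feature_square M s a A) * wnorm A v)\<^sup>2"
    using softmax.softmax_l1_second_order
      [where z = "\<lambda>k. \<phi> k \<bullet> \<theta>\<^sub>0" and w = "\<lambda>k. \<phi> k \<bullet> \<theta>\<^sub>1", OF abs_logit_diff_le]
    by (simp add: mnl_eq_softmax x_def v_def cong: weighted_mean_cong)
  then show ?thesis by (simp add: v_def power_mult_distrib max_feature_square_nonneg mult.commute)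
qed

lemma mnl_l1_le_conf_radius:
  assumes b: "wnorm A (\<theta>\<^sub>1 - \<theta>\<^sub>0) \<le> b"
  shows "l1_dist I (p \<theta>\<^sub>1) (p \<theta>\<^sub>0) \<le> conf_radius M s a \<theta>\<^sub>0 A b"
proof -
  have w: "0 \<le> wnorm A (\<theta>\<^sub>1 - \<theta>\<^sub>0)" using \<theta>\<^sub>0 \<theta>\<^sub>1 by (intro wnorm_nonneg[OF pd_psd[OF A]]) simp
  then have "(wnorm A (\<theta>\<^sub>1 - \<theta>\<^sub>0))\<^sup>2 \<le> 3 * b\<^sup>2"
    using power_mono[OF b w, of 2] zero_le_power2[of b] by linarith
  then show ?thesis
    unfolding conf_radius_def using b
    by (intro order.trans[OF mnl_l1_second_order] add_mono mult_right_mono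
        centered_width_nonneg max_feature_square_nonneg)
qed

lemma centered_width_lipschitz:
  "centered_width M s a \<theta>\<^sub>1 A
    \<le> centered_width M s a \<theta>\<^sub>0 A + 6 * max_feature_square M s a A * wnorm A (\<theta>\<^sub>1 - \<theta>\<^sub>0)"
proof -
  define l1 where "l1 = l1_dist I (p \<theta>\<^sub>1) (p \<theta>\<^sub>0)"
  define m where "m = sqrt (max_feature_square M s a A)"
  define w where "w \<theta> k = wnorm (minv A) (\<phi> k - mean \<theta>)" for \<theta> k
  have m: "0 \<le> m" "m * m = max_feature_square M s a A" by (simp_all add: m_def max_feature_square_nonneg)
  have change_of_mean: "w \<theta>\<^sub>1 k \<le> w \<theta>\<^sub>0 k + l1 * m" if k: "k \<in> I" for k
  proof -
    have "w \<theta>\<^sub>1 k \<le> w \<theta>\<^sub>0 k + wnorm (minv A) (mean \<theta>\<^sub>0 - mean \<theta>\<^sub>1)"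
      unfolding w_def
      by (rule wnorm_diff_triangle_le[OF psd_minv[OF A] phi_carrier[OF k] mean_carrier mean_carrier])
    also have "wnorm (minv A) (mean \<theta>\<^sub>0 - mean \<theta>\<^sub>1) \<le> l1 * m"
      unfolding l1_def m_def wnorm_minus_commute[OF psd_minv[OF A] mean_carrier mean_carrier, of \<theta>\<^sub>0]
      by (rule wnorm_mean_diff_le)
    finally show ?thesis by simp
  qed
  have "weighted_mean I (p \<theta>\<^sub>1) (w \<theta>\<^sub>1) - weighted_mean I (p \<theta>\<^sub>0) (w \<theta>\<^sub>1)
    = (\<Sum>k\<in>I. (p \<theta>\<^sub>1 k - p \<theta>\<^sub>0 k) * w \<theta>\<^sub>1 k)"
    by (simp add: weighted_mean_def left_diff_distrib sum_subtractf)
  also have "\<dots> \<le> (\<Sum>k\<in>I. \<bar>p \<theta>\<^sub>1 k - p \<theta>\<^sub>0 k\<bar> * (2 * m))"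
    unfolding w_def m_def
    by (intro sum_mono mult_mono wnorm_centered_le wnorm_nonneg[OF psd_minv[OF A]] centered_carrier) auto
  also have "\<dots> = 2 * m * l1" by (simp add: l1_def sum_distrib_left mult.commute)
  finally have "weighted_mean I (p \<theta>\<^sub>1) (w \<theta>\<^sub>1) \<le> weighted_mean I (p \<theta>\<^sub>0) (w \<theta>\<^sub>1) + 2 * m * l1"
    by simp
  also have "weighted_mean I (p \<theta>\<^sub>0) (w \<theta>\<^sub>1) \<le> weighted_mean I (p \<theta>\<^sub>0) (\<lambda>k. w \<theta>\<^sub>0 k + l1 * m)"
    by (intro weighted_mean_mono change_of_mean)
  also have "\<dots> = weighted_mean I (p \<theta>\<^sub>0) (w \<theta>\<^sub>0) + l1 * m"
    by (simp add: weighted_mean_add weighted_mean_const)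
  finally have "weighted_mean I (p \<theta>\<^sub>1) (w \<theta>\<^sub>1) \<le> weighted_mean I (p \<theta>\<^sub>0) (w \<theta>\<^sub>0) + 3 * m * l1"
    by (simp add: mult_ac)
  also have "3 * m * l1 \<le> 3 * m * (2 * (m * wnorm A (\<theta>\<^sub>1 - \<theta>\<^sub>0)))"
    unfolding l1_def m_def by (intro mult_left_mono mnl_l1_lipschitz) (simp add: max_feature_square_nonneg)
  also have "\<dots> = 6 * max_feature_square M s a A * wnorm A (\<theta>\<^sub>1 - \<theta>\<^sub>0)" by (simp flip: m(2))
  finally show ?thesis by (simp add: centered_width_def w_def[abs_def])
qed

end

text \<open>As \<open>\<phi> z = 0\<close>, the centred features at \<open>k\<close> and \<open>z\<close> differ by exactly \<open>\<phi> k\<close>.\<close>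

lemma kappa_max_feature_square_le:
  assumes \<kappa>: "0 \<le> \<kappa>" "\<And>k l. k \<in> I \<Longrightarrow> l \<in> I \<Longrightarrow> \<kappa> \<le> p \<theta> k * p \<theta> l"
    and z: "z \<in> I" "\<phi> z = 0\<^sub>v d"
  shows "\<kappa> * max_feature_square M s a A \<le> feature_variance M s a \<theta> A"
proof -
  have "max_feature_square M s a A \<in> (\<lambda>k. (wnorm (minv A) (\<phi> k))\<^sup>2) ` I"
    unfolding max_feature_square_def using finite_reachable reachable_nonempty by (intro Max_in) auto
  then obtain k where k: "k \<in> I" "max_feature_square M s a A = (wnorm (minv A) (\<phi> k))\<^sup>2"
    by blast
  show ?thesis
  proof (cases "k = z")
    case True
    then show ?thesis using z feature_variance_nonneg by (simp add: k wnorm_zero)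
  next
    case False
    let ?w = "\<lambda>k. wnorm (minv A) (\<phi> k - mean \<theta>)"
    have "wnorm (minv A) (\<phi> k - \<phi> z) \<le> ?w k + wnorm (minv A) (mean \<theta> - \<phi> z)"
      by (rule wnorm_diff_triangle_le
          [OF psd_minv[OF A] phi_carrier[OF k(1)] mean_carrier phi_carrier[OF z(1)]])
    then have "wnorm (minv A) (\<phi> k) \<le> ?w k + ?w z"
      using z phi_carrier[OF k(1)] wnorm_minus_commute[OF psd_minv[OF A] mean_carrier phi_carrier[OF z(1)]]
      by simp
    then have "max_feature_square M s a A \<le> (?w k + ?w z)\<^sup>2"
      unfolding k(2) by (intro power_mono wnorm_nonneg[OF psd_minv[OF A]] phi_carrier k(1))
    then have "\<kappa> * max_feature_square M s a A \<le> p \<theta> k * p \<theta> z * (?w k + ?w z)\<^sup>2"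
      using \<kappa>(2)[OF k(1) z(1)] \<kappa>(1) max_feature_square_nonneg
      by (intro mult_mono) (auto simp: mnl_nonneg)
    also have "\<dots> \<le> feature_variance M s a \<theta> A"
      unfolding feature_variance_def by (rule weight_mult_square_add_le[OF k(1) z(1) False])
    finally show ?thesis .
  qed
qed

end
end

section \<open>Values of finite Markov decision processes\<close>

lemma expectation_pmf_ge:
  fixes f :: "'a \<Rightarrow> real"
  assumes "finite (set_pmf p)" "\<And>x. x \<in> set_pmf p \<Longrightarrow> l \<le> f x"
  shows "l \<le> measure_pmf.expectation p f"
  using assms
  by (auto intro!: measure_pmf.integral_ge_const integrable_measure_pmf_finite simp: AE_measure_pmf_iff)

lemma expectation_pmf_le:
  fixes f :: "'a \<Rightarrow> real"
  assumes "finite (set_pmf p)" "\<And>x. x \<in> set_pmf p \<Longrightarrow> f x \<le> u"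
  shows "measure_pmf.expectation p f \<le> u"
  using assms
  by (auto intro!: measure_pmf.integral_le_const integrable_measure_pmf_finite simp: AE_measure_pmf_iff)

lemma run_pmf_Suc_left:
  "run_pmf P \<pi> h (Suc n) = bind_pmf (step_pmf P \<pi> h) (\<lambda>h'. run_pmf P \<pi> h' n)"
proof (induction n)
  case 0
  show ?case by (simp add: bind_return_pmf bind_return_pmf')
next
  case (Suc n)
  have "run_pmf P \<pi> h (Suc (Suc n)) = bind_pmf (run_pmf P \<pi> h (Suc n)) (step_pmf P \<pi>)" by simp
  also have "\<dots> = bind_pmf (step_pmf P \<pi> h) (\<lambda>h'. run_pmf P \<pi> h' (Suc n))"
    unfolding Suc.IH by (simp add: bind_assoc_pmf)
  finally show ?case .
qed

locale finite_mdp =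
  fixes M :: ucparams
  assumes finite_states: "finite (pS M)"
    and finite_actions: "finite (pA M)" and actions_nonempty: "pA M \<noteq> {}"
    and rew_nonneg: "\<And>s a. s \<in> pS M \<Longrightarrow> a \<in> pA M \<Longrightarrow> 0 \<le> rew M s a"
    and rew_le_1: "\<And>s a. s \<in> pS M \<Longrightarrow> a \<in> pA M \<Longrightarrow> rew M s a \<le> 1"
    and reachable_subset: "\<And>s a. s \<in> pS M \<Longrightarrow> a \<in> pA M \<Longrightarrow> pSsa M s a \<subseteq> pS M"
    and disc_nonneg: "0 \<le> disc M" and disc_less_1: "disc M < 1"
begin

abbreviation "\<gamma> \<equiv> disc M"

definition horizon :: real where "horizon = 1 / (1 - \<gamma>)"

lemma horizon_ge_1: "1 \<le> horizon"
  using disc_nonneg disc_less_1 by (simp add: horizon_def field_simps)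

lemma horizon_pos: "0 < horizon"
  using horizon_ge_1 by linarith

lemma horizon_eq: "1 + \<gamma> * horizon = horizon"
  using disc_less_1 by (simp add: horizon_def field_simps)

lemma disc_mult_le: "0 \<le> x \<Longrightarrow> \<gamma> * x \<le> x"
  using disc_nonneg disc_less_1 by (intro mult_left_le_one_le) auto

lemma finite_reachable: "s \<in> pS M \<Longrightarrow> a \<in> pA M \<Longrightarrow> finite (pSsa M s a)"
  using reachable_subset finite_states finite_subset by blast

end

subsection \<open>Optimistic value iteration\<close>

definition devi_value :: "ucparams \<Rightarrow> (nat \<Rightarrow> nat \<Rightarrow> nat \<Rightarrow> real) set \<Rightarrow> nat \<Rightarrow> nat \<Rightarrow> real" where
  "devi_value M Q n s = Max ((\<lambda>a. devi M Q n s a) ` pA M)"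

definition optimistic_mean ::
  "ucparams \<Rightarrow> (nat \<Rightarrow> nat \<Rightarrow> nat \<Rightarrow> real) set \<Rightarrow> nat \<Rightarrow> nat \<Rightarrow> (nat \<Rightarrow> real) \<Rightarrow> real" where
  "optimistic_mean M Q s a V = (SUP q\<in>Q. weighted_mean (pSsa M s a) (q s a) V)"

lemma devi_Suc: "devi M Q (Suc n) s a = rew M s a + disc M * optimistic_mean M Q s a (devi_value M Q n)"
  by (simp add: devi_value_def optimistic_mean_def weighted_mean_def)

definition kernel_set :: "ucparams \<Rightarrow> (nat \<Rightarrow> nat \<Rightarrow> nat \<Rightarrow> real) set \<Rightarrow> bool" where
  "kernel_set M Q \<longleftrightarrow> Q \<noteq> {} \<and> (\<forall>q\<in>Q. \<forall>s\<in>pS M. \<forall>a\<in>pA M. prob_weights (pSsa M s a) (q s a))"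

context finite_mdp
begin

lemma devi_le_value: "a \<in> pA M \<Longrightarrow> devi M Q n s a \<le> devi_value M Q n s"
  unfolding devi_value_def using finite_actions by (intro Max_ge) auto

lemma devi_value_le: "(\<And>a. a \<in> pA M \<Longrightarrow> devi M Q n s a \<le> u) \<Longrightarrow> devi_value M Q n s \<le> u"
  unfolding devi_value_def using finite_actions actions_nonempty by (subst Max_le_iff) auto

lemma devi_value_eq:
  assumes "a \<in> pA M" "\<And>b. b \<in> pA M \<Longrightarrow> devi M Q n s b \<le> devi M Q n s a"
  shows "devi_value M Q n s = devi M Q n s a"
  by (intro antisym devi_value_le devi_le_value assms)

lemma devi_value_0: "devi_value M Q 0 s = horizon"
  using actions_nonempty by (simp add: devi_value_def horizon_def image_constant_conv)

context
  fixes Q :: "(nat \<Rightarrow> nat \<Rightarrow> nat \<Rightarrow> real) set"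
  assumes Q: "kernel_set M Q"
begin

lemma Q_nonempty: "Q \<noteq> {}" using Q by (simp add: kernel_set_def)

lemma prob_weights_Q: "q \<in> Q \<Longrightarrow> s \<in> pS M \<Longrightarrow> a \<in> pA M \<Longrightarrow> prob_weights (pSsa M s a) (q s a)"
  using Q by (simp add: kernel_set_def)

lemma optimistic_mean_least:
  "(\<And>q. q \<in> Q \<Longrightarrow> weighted_mean (pSsa M s a) (q s a) V \<le> u) \<Longrightarrow> optimistic_mean M Q s a V \<le> u"
  unfolding optimistic_mean_def by (rule cSUP_least[OF Q_nonempty])

lemma optimistic_mean_le:
  assumes sa: "s \<in> pS M" "a \<in> pA M" and V: "\<And>k. k \<in> pS M \<Longrightarrow> V k \<le> u"
  shows "optimistic_mean M Q s a V \<le> u"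
proof (rule optimistic_mean_least)
  fix q assume "q \<in> Q"
  then interpret prob_weights "pSsa M s a" "q s a" using prob_weights_Q sa by blast
  show "weighted_mean (pSsa M s a) (q s a) V \<le> u"
    using reachable_subset[OF sa] by (intro weighted_mean_le V) blast
qed

lemma weighted_mean_le_optimistic:
  assumes sa: "s \<in> pS M" "a \<in> pA M" and V: "\<And>k. k \<in> pS M \<Longrightarrow> V k \<le> u" and q: "q \<in> Q"
  shows "weighted_mean (pSsa M s a) (q s a) V \<le> optimistic_mean M Q s a V"
  unfolding optimistic_mean_def
proof (rule cSUP_upper[OF q], rule bdd_aboveI2)
  fix q' assume "q' \<in> Q"
  then interpret prob_weights "pSsa M s a" "q' s a" using prob_weights_Q sa by blast
  show "weighted_mean (pSsa M s a) (q' s a) V \<le> u"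
    using reachable_subset[OF sa] by (intro weighted_mean_le V) blast
qed

lemma devi_value_le_horizon: "s \<in> pS M \<Longrightarrow> devi_value M Q n s \<le> horizon"
proof (induction n arbitrary: s)
  case 0
  then show ?case by (simp add: devi_value_0)
next
  case (Suc n)
  show ?case
  proof (rule devi_value_le)
    fix a assume a: "a \<in> pA M"
    have "optimistic_mean M Q s a (devi_value M Q n) \<le> horizon"
      by (rule optimistic_mean_le[OF Suc.prems a Suc.IH])
    from mult_left_mono[OF this disc_nonneg] show "devi M Q (Suc n) s a \<le> horizon"
      unfolding devi_Suc using rew_le_1[OF Suc.prems a] horizon_eq by linarith
  qed
qed

lemma weighted_mean_devi_le_optimistic:
  assumes "s \<in> pS M" "a \<in> pA M" "q \<in> Q"
  shows "weighted_mean (pSsa M s a) (q s a) (devi_value M Q n)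
    \<le> optimistic_mean M Q s a (devi_value M Q n)"
  by (rule weighted_mean_le_optimistic[OF assms(1,2) devi_value_le_horizon assms(3)])

lemma devi_value_nonneg: "s \<in> pS M \<Longrightarrow> 0 \<le> devi_value M Q n s"
proof (induction n arbitrary: s)
  case 0
  then show ?case using horizon_pos by (simp add: devi_value_0)
next
  case (Suc n)
  obtain a where a: "a \<in> pA M" using actions_nonempty by blast
  obtain q where q: "q \<in> Q" using Q_nonempty by blast
  interpret prob_weights "pSsa M s a" "q s a" by (rule prob_weights_Q[OF q Suc.prems a])
  have "0 \<le> weighted_mean (pSsa M s a) (q s a) (devi_value M Q n)"
    using reachable_subset[OF Suc.prems a] Suc.IH by (intro weighted_mean_nonneg) blast
  also have "\<dots> \<le> optimistic_mean M Q s a (devi_value M Q n)"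
    by (rule weighted_mean_devi_le_optimistic[OF Suc.prems a q])
  finally have "0 \<le> devi M Q (Suc n) s a"
    unfolding devi_Suc using rew_nonneg[OF Suc.prems a] disc_nonneg
    by (intro add_nonneg_nonneg mult_nonneg_nonneg)
  then show ?case using devi_le_value[OF a, of Q "Suc n" s] by linarith
qed

lemma devi_le_devi_Suc:
  assumes "s \<in> pS M" "a \<in> pA M"
  shows "devi M Q n s a \<le> devi M Q (Suc n) s a + \<gamma> ^ n"
  using assms
proof (induction n arbitrary: s a)
  case 0
  obtain q where q: "q \<in> Q" using Q_nonempty by blast
  interpret prob_weights "pSsa M s a" "q s a" by (rule prob_weights_Q[OF q 0])
  have "horizon \<le> optimistic_mean M Q s a (devi_value M Q 0)"
    using weighted_mean_devi_le_optimistic[OF 0 q, of 0]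
    by (simp add: devi_value_0[abs_def] weighted_mean_const)
  from mult_left_mono[OF this disc_nonneg] show ?case
    unfolding devi_Suc using rew_nonneg[OF 0] horizon_eq by (simp add: horizon_def)
next
  case (Suc n)
  have value_step: "devi_value M Q n k \<le> devi_value M Q (Suc n) k + \<gamma> ^ n" if "k \<in> pS M" for k
  proof (rule devi_value_le)
    fix b assume b: "b \<in> pA M"
    show "devi M Q n k b \<le> devi_value M Q (Suc n) k + \<gamma> ^ n"
      using Suc.IH[OF that b] devi_le_value[OF b, of Q "Suc n" k] by linarith
  qed
  have "optimistic_mean M Q s a (devi_value M Q n)
    \<le> optimistic_mean M Q s a (devi_value M Q (Suc n)) + \<gamma> ^ n"
  proof (rule optimistic_mean_least)
    fix q assume q: "q \<in> Q"
    interpret prob_weights "pSsa M s a" "q s a" by (rule prob_weights_Q[OF q Suc.prems])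
    have "weighted_mean (pSsa M s a) (q s a) (devi_value M Q n)
      \<le> weighted_mean (pSsa M s a) (q s a) (\<lambda>k. devi_value M Q (Suc n) k + \<gamma> ^ n)"
      using reachable_subset[OF Suc.prems] by (intro weighted_mean_mono value_step) blast
    also have "\<dots> = weighted_mean (pSsa M s a) (q s a) (devi_value M Q (Suc n)) + \<gamma> ^ n"
      by (simp add: weighted_mean_add weighted_mean_const)
    finally show "weighted_mean (pSsa M s a) (q s a) (devi_value M Q n)
      \<le> optimistic_mean M Q s a (devi_value M Q (Suc n)) + \<gamma> ^ n"
      using weighted_mean_devi_le_optimistic[OF Suc.prems q, of "Suc n"] by linarith
  qed
  from mult_left_mono[OF this disc_nonneg] show ?case
    unfolding devi_Suc[of M Q n] devi_Suc[of M Q "Suc n"] by (simp add: distrib_left)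
qed

lemma weighted_mean_diff_le:
  assumes sa: "s \<in> pS M" "a \<in> pA M"
  shows "weighted_mean (pSsa M s a) q (devi_value M Q n) - weighted_mean (pSsa M s a) p (devi_value M Q n)
    \<le> horizon * l1_dist (pSsa M s a) q p"
proof -
  have "weighted_mean (pSsa M s a) q (devi_value M Q n) - weighted_mean (pSsa M s a) p (devi_value M Q n)
    = (\<Sum>k\<in>pSsa M s a. (q k - p k) * devi_value M Q n k)"
    by (simp add: weighted_mean_def left_diff_distrib sum_subtractf)
  also have "\<dots> \<le> (\<Sum>k\<in>pSsa M s a. \<bar>q k - p k\<bar> * horizon)"
    using reachable_subset[OF sa]
    by (intro sum_mono mult_mono devi_value_le_horizon devi_value_nonneg) auto
  finally show ?thesis by (simp add: sum_distrib_left mult.commute)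
qed

lemma devi_le_one_step:
  assumes sa: "s \<in> pS M" "a \<in> pA M"
    and \<rho>: "\<And>q. q \<in> Q \<Longrightarrow> l1_dist (pSsa M s a) (q s a) p \<le> \<rho>"
  shows "devi M Q n s a
    \<le> rew M s a + \<gamma> * (weighted_mean (pSsa M s a) p (devi_value M Q n) + horizon * \<rho>) + \<gamma> ^ n"
proof -
  have "optimistic_mean M Q s a (devi_value M Q n)
    \<le> weighted_mean (pSsa M s a) p (devi_value M Q n) + horizon * \<rho>"
  proof (rule optimistic_mean_least)
    fix q assume "q \<in> Q"
    then show "weighted_mean (pSsa M s a) (q s a) (devi_value M Q n)
      \<le> weighted_mean (pSsa M s a) p (devi_value M Q n) + horizon * \<rho>"
      using weighted_mean_diff_le[OF sa, of "q s a" n p] mult_left_mono[OF \<rho>, of q horizon] horizon_pos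
      by linarith
  qed
  from mult_left_mono[OF this disc_nonneg] show ?thesis
    using devi_le_devi_Suc[OF sa, of n] unfolding devi_Suc by linarith
qed

end
end

subsection \<open>Bellman equation and optimism\<close>

locale mdp_kernel = finite_mdp +
  fixes P :: "nat \<Rightarrow> nat \<Rightarrow> nat pmf"
  assumes set_kernel: "\<And>s a. s \<in> pS M \<Longrightarrow> a \<in> pA M \<Longrightarrow> set_pmf (P s a) \<subseteq> pSsa M s a"
begin

abbreviation "V \<equiv> Vpi \<gamma> (rew M) P"

definition mean_reward :: "(hist \<Rightarrow> nat pmf) \<Rightarrow> hist \<Rightarrow> real" where
  "mean_reward \<pi> h = measure_pmf.expectation (\<pi> h) (\<lambda>a. rew M (snd h) a)"

definition reward_at :: "(hist \<Rightarrow> nat pmf) \<Rightarrow> hist \<Rightarrow> nat \<Rightarrow> real" where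
  "reward_at \<pi> h i = measure_pmf.expectation (run_pmf P \<pi> h i) (mean_reward \<pi>)"

lemma Vpi_eq_suminf: "V \<pi> h = (\<Sum>i. \<gamma> ^ i * reward_at \<pi> h i)"
  unfolding Vpi_def reward_at_def mean_reward_def ..

lemma prob_weights_kernel:
  assumes sa: "s \<in> pS M" "a \<in> pA M"
  shows "prob_weights (pSsa M s a) (pmf (P s a))"
  by unfold_locales (simp_all add: finite_reachable[OF sa] sum_pmf_eq_1 set_kernel[OF sa])

lemma expectation_kernel:
  assumes sa: "s \<in> pS M" "a \<in> pA M"
  shows "measure_pmf.expectation (P s a) f = weighted_mean (pSsa M s a) (pmf (P s a)) f"
  unfolding weighted_mean_def using finite_reachable[OF sa] set_kernel[OF sa]
  by (subst integral_measure_pmf_real[of "pSsa M s a"]) (auto simp: mult.commute)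

context
  fixes \<pi> :: "hist \<Rightarrow> nat pmf"
  assumes \<pi>: "\<pi> \<in> policies (pA M)"
begin

lemma set_policy: "set_pmf (\<pi> h) \<subseteq> pA M"
  using \<pi> unfolding policies_def by blast

lemma finite_policy: "finite (set_pmf (\<pi> h))"
  using set_policy finite_actions finite_subset by blast

lemma step_pmf_cases:
  assumes h: "snd h \<in> pS M" and "h' \<in> set_pmf (step_pmf P \<pi> h)"
  obtains a k where "a \<in> pA M" "k \<in> pSsa M (snd h) a" "h' = (fst h @ [(snd h, a)], k)"
  using assms set_policy[of h] set_kernel[OF h] by (fastforce simp: step_pmf_def)

lemma step_state_in: "snd h \<in> pS M \<Longrightarrow> h' \<in> set_pmf (step_pmf P \<pi> h) \<Longrightarrow> snd h' \<in> pS M"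
  using reachable_subset by (fastforce elim: step_pmf_cases)

lemma finite_step:
  assumes "snd h \<in> pS M"
  shows "finite (set_pmf (step_pmf P \<pi> h))"
proof (rule finite_subset)
  show "set_pmf (step_pmf P \<pi> h) \<subseteq> (\<lambda>(a, k). (fst h @ [(snd h, a)], k)) ` (pA M \<times> pS M)"
    using reachable_subset[OF assms] by (fastforce elim: step_pmf_cases[OF assms])
qed (simp add: finite_actions finite_states)

lemma run_finite_and_state_in:
  assumes "snd h \<in> pS M"
  shows "finite (set_pmf (run_pmf P \<pi> h n)) \<and> (\<forall>h'\<in>set_pmf (run_pmf P \<pi> h n). snd h' \<in> pS M)"
proof (induction n)
  case (Suc n)
  then show ?case using finite_step step_state_in by auto
qed (use assms in simp)

lemma expectation_step:
  assumes h: "snd h \<in> pS M"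
  shows "measure_pmf.expectation (step_pmf P \<pi> h) (f :: hist \<Rightarrow> real) =
    weighted_mean (pA M) (pmf (\<pi> h)) (\<lambda>a. weighted_mean (pSsa M (snd h) a) (pmf (P (snd h) a))
      (\<lambda>k. f (fst h @ [(snd h, a)], k)))"
  unfolding step_pmf_def weighted_mean_def[of "pA M"]
  using set_policy finite_actions finite_subset[OF set_kernel[OF h] finite_reachable[OF h]]
  by (subst pmf_expectation_bind[OF finite_actions]) (auto simp: expectation_kernel[OF h] intro!: sum.cong)

lemma mean_reward_eq: "mean_reward \<pi> h = weighted_mean (pA M) (pmf (\<pi> h)) (rew M (snd h))"
  unfolding mean_reward_def weighted_mean_def using set_policy[of h] finite_actions
  by (subst integral_measure_pmf_real[of "pA M"]) (auto simp: mult.commute)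

lemma mean_reward_bounds: "snd h \<in> pS M \<Longrightarrow> 0 \<le> mean_reward \<pi> h \<and> mean_reward \<pi> h \<le> 1"
  unfolding mean_reward_def using set_policy rew_nonneg rew_le_1
  by (intro conjI expectation_pmf_ge expectation_pmf_le finite_policy) blast+

lemma reward_at_bounds: "snd h \<in> pS M \<Longrightarrow> 0 \<le> reward_at \<pi> h i \<and> reward_at \<pi> h i \<le> 1"
  unfolding reward_at_def using run_finite_and_state_in mean_reward_bounds
  by (intro conjI expectation_pmf_ge expectation_pmf_le) blast+

lemma summable_reward_at:
  assumes "snd h \<in> pS M"
  shows "summable (\<lambda>i. \<gamma> ^ i * reward_at \<pi> h i)"
proof (rule summable_comparison_test)
  show "\<exists>N. \<forall>i\<ge>N. norm (\<gamma> ^ i * reward_at \<pi> h i) \<le> \<gamma> ^ i"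
    using reward_at_bounds[OF assms] disc_nonneg
    by (intro exI[of _ 0]) (auto intro!: mult_left_le simp: abs_mult)
  show "summable ((^) \<gamma>)" using disc_nonneg disc_less_1 by (intro summable_geometric) simp
qed

lemma Vpi_nonneg:
  assumes h: "snd h \<in> pS M"
  shows "0 \<le> V \<pi> h"
  unfolding Vpi_eq_suminf using reward_at_bounds[OF h] disc_nonneg
  by (intro suminf_nonneg summable_reward_at[OF h]) simp

lemma Vpi_le_horizon:
  assumes h: "snd h \<in> pS M"
  shows "V \<pi> h \<le> horizon"
proof -
  have "V \<pi> h \<le> (\<Sum>i. \<gamma> ^ i)"
    unfolding Vpi_eq_suminf using reward_at_bounds[OF h] disc_nonneg disc_less_1
    by (intro suminf_le summable_reward_at[OF h] summable_geometric) (auto intro!: mult_left_le)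
  then show ?thesis using disc_nonneg disc_less_1 by (simp add: suminf_geometric horizon_def)
qed

lemma expectation_step_eq_sum:
  assumes h: "snd h \<in> pS M"
  shows "measure_pmf.expectation (step_pmf P \<pi> h) f =
    (\<Sum>h'\<in>set_pmf (step_pmf P \<pi> h). pmf (step_pmf P \<pi> h) h' * (f h' :: real))"
  using finite_step[OF h]
  by (subst integral_measure_pmf_real[of "set_pmf (step_pmf P \<pi> h)"]) (auto simp: mult.commute)

lemma reward_at_Suc:
  assumes h: "snd h \<in> pS M"
  shows "reward_at \<pi> h (Suc i) = measure_pmf.expectation (step_pmf P \<pi> h) (\<lambda>h'. reward_at \<pi> h' i)"
  unfolding reward_at_def run_pmf_Suc_left expectation_step_eq_sum[OF h]
  using run_finite_and_state_in step_state_in[OF h]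
  by (subst pmf_expectation_bind[OF finite_step[OF h]]) auto

theorem Vpi_bellman:
  assumes h: "snd h \<in> pS M"
  shows "V \<pi> h = mean_reward \<pi> h + \<gamma> * measure_pmf.expectation (step_pmf P \<pi> h) (V \<pi>)"
proof -
  let ?S = "set_pmf (step_pmf P \<pi> h)" and ?q = "pmf (step_pmf P \<pi> h)"
  have summable: "summable (\<lambda>i. \<gamma> ^ i * reward_at \<pi> h' i)" if "h' \<in> ?S" for h'
    using summable_reward_at step_state_in[OF h that] by blast
  have "V \<pi> h = reward_at \<pi> h 0 + (\<Sum>i. \<gamma> ^ Suc i * reward_at \<pi> h (Suc i))"
    unfolding Vpi_eq_suminf using suminf_split_head[OF summable_reward_at[OF h]] by simp
  also have "reward_at \<pi> h 0 = mean_reward \<pi> h" by (simp add: reward_at_def)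
  also have "(\<lambda>i. \<gamma> ^ Suc i * reward_at \<pi> h (Suc i)) = (\<lambda>i. \<Sum>h'\<in>?S. \<gamma> * ?q h' * (\<gamma> ^ i * reward_at \<pi> h' i))"
    unfolding reward_at_Suc[OF h] expectation_step_eq_sum[OF h] by (simp add: sum_distrib_left mult_ac)
  also have "(\<Sum>i. \<Sum>h'\<in>?S. \<gamma> * ?q h' * (\<gamma> ^ i * reward_at \<pi> h' i)) =
      (\<Sum>h'\<in>?S. \<Sum>i. \<gamma> * ?q h' * (\<gamma> ^ i * reward_at \<pi> h' i))"
    by (rule suminf_sum) (intro summable_mult summable)
  also have "\<dots> = (\<Sum>h'\<in>?S. \<gamma> * ?q h' * V \<pi> h')"
    unfolding Vpi_eq_suminf by (intro sum.cong refl suminf_mult summable)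
  finally show ?thesis by (simp add: expectation_step_eq_sum[OF h] sum_distrib_left mult_ac)
qed

end

lemma constant_policy: "a \<in> pA M \<Longrightarrow> (\<lambda>_. return_pmf a) \<in> policies (pA M)"
  by (simp add: policies_def)

lemma Vstar_least:
  assumes "\<And>\<pi>. \<pi> \<in> policies (pA M) \<Longrightarrow> V \<pi> ([], s) \<le> u"
  shows "Vstar \<gamma> (rew M) P (pA M) s \<le> u"
  unfolding Vstar_def using constant_policy actions_nonempty by (intro cSUP_least assms) auto

definition plausible :: "(nat \<Rightarrow> nat \<Rightarrow> nat \<Rightarrow> real) set \<Rightarrow> bool" where
  "plausible Q \<longleftrightarrow> kernel_set M Q \<and>
     (\<exists>q\<in>Q. \<forall>s\<in>pS M. \<forall>a\<in>pA M. \<forall>k\<in>pSsa M s a. q s a k = pmf (P s a) k)"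

lemma plausible_kernel_set: "plausible Q \<Longrightarrow> kernel_set M Q"
  by (simp add: plausible_def)

context
  fixes Q :: "(nat \<Rightarrow> nat \<Rightarrow> nat \<Rightarrow> real) set"
  assumes Q: "plausible Q"
begin

lemma weighted_mean_kernel_le_optimistic:
  assumes "s \<in> pS M" "a \<in> pA M"
  shows "weighted_mean (pSsa M s a) (pmf (P s a)) (devi_value M Q n)
    \<le> optimistic_mean M Q s a (devi_value M Q n)"
proof -
  obtain q where "q \<in> Q" and q: "\<And>k. k \<in> pSsa M s a \<Longrightarrow> q s a k = pmf (P s a) k"
    using Q assms unfolding plausible_def by blast
  then show ?thesis
    using weighted_mean_devi_le_optimistic[OF plausible_kernel_set[OF Q] assms, of q n]
    by (simp add: q cong: weighted_mean_cong)
qed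

theorem devi_optimistic:
  assumes \<pi>: "\<pi> \<in> policies (pA M)"
  shows "snd h \<in> pS M \<Longrightarrow> V \<pi> h \<le> devi_value M Q n (snd h)"
proof (induction n arbitrary: h)
  case 0
  then show ?case using Vpi_le_horizon[OF \<pi>] by (simp add: devi_value_0)
next
  case (Suc n)
  let ?s = "snd h" and ?next = "\<lambda>a k. V \<pi> (fst h @ [(snd h, a)], k)"
  interpret policy: prob_weights "pA M" "pmf (\<pi> h)"
    using finite_actions sum_pmf_eq_1[OF finite_actions set_policy[OF \<pi>]] by unfold_locales simp_all
  have "V \<pi> h = weighted_mean (pA M) (pmf (\<pi> h)) (\<lambda>a. rew M ?s a + \<gamma> *
      weighted_mean (pSsa M ?s a) (pmf (P ?s a)) (?next a))"
    unfolding Vpi_bellman[OF \<pi> Suc.prems] mean_reward_eq[OF \<pi>] expectation_step[OF \<pi> Suc.prems]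
    by (simp add: weighted_mean_add weighted_mean_cmult)
  also have "\<dots> \<le> devi_value M Q (Suc n) ?s"
  proof (rule policy.weighted_mean_le)
    fix a assume a: "a \<in> pA M"
    interpret kernel: prob_weights "pSsa M ?s a" "pmf (P ?s a)"
      by (rule prob_weights_kernel[OF Suc.prems a])
    have "weighted_mean (pSsa M ?s a) (pmf (P ?s a)) (?next a)
      \<le> weighted_mean (pSsa M ?s a) (pmf (P ?s a)) (devi_value M Q n)"
      using Suc.IH[of "(fst h @ [(?s, a)], k)" for k] reachable_subset[OF Suc.prems a]
      by (intro kernel.weighted_mean_mono) auto
    also note weighted_mean_kernel_le_optimistic[OF Suc.prems a]
    finally have "rew M ?s a + \<gamma> *
        weighted_mean (pSsa M ?s a) (pmf (P ?s a)) (?next a) \<le> devi M Q (Suc n) ?s a"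
      unfolding devi_Suc using disc_nonneg by (intro add_left_mono mult_left_mono)
    also have "\<dots> \<le> devi_value M Q (Suc n) ?s" by (rule devi_le_value[OF a])
    finally show "rew M ?s a + \<gamma> *
        weighted_mean (pSsa M ?s a) (pmf (P ?s a)) (?next a) \<le> devi_value M Q (Suc n) ?s" .
  qed
  finally show ?case .
qed

lemma Vstar_le_devi_value: "s \<in> pS M \<Longrightarrow> Vstar \<gamma> (rew M) P (pA M) s \<le> devi_value M Q n s"
  using devi_optimistic[where h = "([], s)" and n = n] by (intro Vstar_least) simp

end
end

section \<open>Concentration along trajectories\<close>

lemma run_pmf_length:
  assumes "h \<in> set_pmf (run_pmf P \<pi> ([], s1) n)"
  shows "length (fst h) = n"
  using assms by (induction n arbitrary: h) (auto simp: step_pmf_def)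

lemma hprefix_self: "length (fst h) = n \<Longrightarrow> hprefix h n = h"
  by (simp add: hprefix_def)

lemma hprefix_step:
  assumes "h' \<in> set_pmf (step_pmf P \<pi> h)" "i \<le> length (fst h)"
  shows "hprefix h' i = hprefix h i"
  using assms by (auto simp: step_pmf_def hprefix_def nth_append)

lemma run_pmf_prefix:
  assumes "h \<in> set_pmf (run_pmf P \<pi> ([], s1) n)" "i < n"
  shows "hprefix h i \<in> set_pmf (run_pmf P \<pi> ([], s1) i) \<and>
    hprefix h (Suc i) \<in> set_pmf (step_pmf P \<pi> (hprefix h i))"
  using assms
proof (induction n arbitrary: h)
  case (Suc n)
  then obtain g where g: "g \<in> set_pmf (run_pmf P \<pi> ([], s1) n)" "h \<in> set_pmf (step_pmf P \<pi> g)" by auto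
  have length_g: "length (fst g) = n" and length_h: "length (fst h) = Suc n"
    using run_pmf_length[OF g(1)] run_pmf_length[OF Suc.prems(1)] by auto
  show ?case
  proof (cases "i = n")
    case True
    then show ?thesis using g hprefix_step[OF g(2), of n] length_g length_h by (simp add: hprefix_self)
  next
    case False
    then have "i < n" using Suc.prems by simp
    then show ?thesis
      using Suc.IH[OF g(1)] hprefix_step[OF g(2), of i] hprefix_step[OF g(2), of "Suc i"] length_g by simp
  qed
qed simp

lemma run_pmf_hprefix:
  assumes "h \<in> set_pmf (run_pmf P \<pi> ([], s1) n)" "i \<le> n"
  shows "hprefix h i \<in> set_pmf (run_pmf P \<pi> ([], s1) i)"
  using assms run_pmf_prefix[of h P \<pi> s1 n i] hprefix_self[OF run_pmf_length[OF assms(1)]]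
  by (cases "i = n") auto

definition path_sum :: "(hist \<Rightarrow> hist \<Rightarrow> real) \<Rightarrow> nat \<Rightarrow> hist \<Rightarrow> real" where
  "path_sum D n h = (\<Sum>i<n. D (hprefix h i) (hprefix h (Suc i)))"

locale bounded_martingale_differences =
  fixes P :: "nat \<Rightarrow> nat \<Rightarrow> nat pmf" and \<pi> :: "hist \<Rightarrow> nat pmf" and s1 :: nat
    and D :: "hist \<Rightarrow> hist \<Rightarrow> real" and b :: real
  assumes b_pos: "0 < b"
    and mean_zero: "\<And>n h. h \<in> set_pmf (run_pmf P \<pi> ([], s1) n) \<Longrightarrow>
      measure_pmf.expectation (step_pmf P \<pi> h) (D h) = 0"
    and bounded: "\<And>n h h'. h \<in> set_pmf (run_pmf P \<pi> ([], s1) n) \<Longrightarrow>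
      h' \<in> set_pmf (step_pmf P \<pi> h) \<Longrightarrow> \<bar>D h h'\<bar> \<le> b"
begin

abbreviation "run n \<equiv> run_pmf P \<pi> ([], s1) n"

lemma path_sum_step:
  assumes "h \<in> set_pmf (run n)" "h' \<in> set_pmf (step_pmf P \<pi> h)"
  shows "path_sum D (Suc n) h' = path_sum D n h + D h h'"
proof -
  have length_h: "length (fst h) = n" by (rule run_pmf_length[OF assms(1)])
  have "length (fst h') = Suc n" using assms(2) length_h by (auto simp: step_pmf_def)
  then show ?thesis
    using hprefix_step[OF assms(2)] length_h by (simp add: path_sum_def hprefix_self)
qed

lemma exp_moment_step:
  assumes l: "0 < l" and h: "h \<in> set_pmf (run n)"
  shows "(\<integral>\<^sup>+ h'. ennreal (exp (l * path_sum D (Suc n) h')) \<partial>measure_pmf (step_pmf P \<pi> h))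
    \<le> ennreal (exp (l * path_sum D n h)) * ennreal (exp (l\<^sup>2 * b\<^sup>2 / 2))"
proof -
  interpret interval_bounded_random_variable "measure_pmf (step_pmf P \<pi> h)" "D h" "-b" b
    by unfold_locales (use bounded[OF h] in \<open>auto simp: AE_measure_pmf_iff abs_le_iff minus_le_iff\<close>)
  have "(\<integral>\<^sup>+ h'. ennreal (exp (l * path_sum D (Suc n) h')) \<partial>measure_pmf (step_pmf P \<pi> h))
    = (\<integral>\<^sup>+ h'. ennreal (exp (l * path_sum D n h)) *
        ennreal (exp (l * D h h')) \<partial>measure_pmf (step_pmf P \<pi> h))"
    using path_sum_step[OF h]
    by (intro nn_integral_cong_AE) (auto simp: AE_measure_pmf_iff distrib_left exp_add ennreal_mult)
  also have "\<dots> = ennreal (exp (l * path_sum D n h)) *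
      (\<integral>\<^sup>+ h'. ennreal (exp (l * D h h')) \<partial>measure_pmf (step_pmf P \<pi> h))"
    by (rule nn_integral_cmult) simp
  also have "\<dots> \<le> ennreal (exp (l * path_sum D n h)) * ennreal (exp (l\<^sup>2 * b\<^sup>2 / 2))"
    using Hoeffdings_lemma_nn_integral_0[OF l mean_zero[OF h]]
    by (intro mult_left_mono) (simp_all add: power2_eq_square field_simps)
  finally show ?thesis .
qed

lemma exp_moment_le:
  assumes l: "0 < l"
  shows "(\<integral>\<^sup>+ h. ennreal (exp (l * path_sum D n h)) \<partial>measure_pmf (run n))
    \<le> ennreal (exp (real n * (l\<^sup>2 * b\<^sup>2 / 2)))"
proof (induction n)
  case 0
  show ?case by (simp add: path_sum_def)
next
  case (Suc n)
  let ?q = "exp (l\<^sup>2 * b\<^sup>2 / 2)"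
  have "(\<integral>\<^sup>+ h'. ennreal (exp (l * path_sum D (Suc n) h')) \<partial>measure_pmf (run (Suc n)))
    = (\<integral>\<^sup>+ h. \<integral>\<^sup>+ h'. ennreal (exp (l * path_sum D (Suc n) h'))
        \<partial>measure_pmf (step_pmf P \<pi> h) \<partial>measure_pmf (run n))"
    by simp
  also have "\<dots> \<le> (\<integral>\<^sup>+ h. ennreal (exp (l * path_sum D n h)) * ennreal ?q \<partial>measure_pmf (run n))"
    by (intro nn_integral_mono_AE, unfold AE_measure_pmf_iff) (intro ballI exp_moment_step[OF l])
  also have "\<dots> = (\<integral>\<^sup>+ h. ennreal (exp (l * path_sum D n h)) \<partial>measure_pmf (run n)) * ennreal ?q"
    by (rule nn_integral_multc) simp
  also have "\<dots> \<le> ennreal (exp (real n * (l\<^sup>2 * b\<^sup>2 / 2))) * ennreal ?q"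
    by (rule mult_right_mono[OF Suc.IH]) simp
  also have "\<dots> = ennreal (exp (real (Suc n) * (l\<^sup>2 * b\<^sup>2 / 2)))"
    by (simp add: ennreal_mult[symmetric] exp_add[symmetric] algebra_simps)
  finally show ?case .
qed

theorem azuma_hoeffding:
  assumes n: "0 < n" and \<epsilon>: "0 < \<epsilon>"
  shows "measure_pmf.prob (run n) {h. \<epsilon> \<le> path_sum D n h} \<le> exp (- (\<epsilon>\<^sup>2 / (2 * real n * b\<^sup>2)))"
proof -
  define l where "l = \<epsilon> / (real n * b\<^sup>2)"
  have l: "0 < l" using n \<epsilon> b_pos by (simp add: l_def)
  have "emeasure (run n) {h \<in> UNIV. \<epsilon> \<le> path_sum D n h}
    \<le> ennreal (exp (- l * \<epsilon>)) *
      (\<integral>\<^sup>+ h. ennreal (exp (l * path_sum D n h)) * indicator UNIV h \<partial>measure_pmf (run n))"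
    by (rule Chernoff_ineq_nn_integral_ge[OF l]) simp_all
  also have "\<dots> \<le> ennreal (exp (- l * \<epsilon>)) * ennreal (exp (real n * (l\<^sup>2 * b\<^sup>2 / 2)))"
    using exp_moment_le[OF l, of n] by (intro mult_left_mono) simp_all
  also have "\<dots> = ennreal (exp (- l * \<epsilon> + real n * (l\<^sup>2 * b\<^sup>2 / 2)))"
    by (simp add: ennreal_mult[symmetric] exp_add[symmetric])
  also have "- l * \<epsilon> + real n * (l\<^sup>2 * b\<^sup>2 / 2) = - (\<epsilon>\<^sup>2 / (2 * real n * b\<^sup>2))"
    using n b_pos by (simp add: l_def field_simps power2_eq_square)
  finally show ?thesis unfolding measure_pmf.emeasure_eq_measure by simp
qed

corollary azuma_hoeffding_whp:
  assumes \<delta>: "0 < \<delta>" "\<delta> < 1"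
  shows "measure_pmf.prob (run n) {h. b * sqrt (2 * real n * ln (1 / \<delta>)) < path_sum D n h} \<le> \<delta>"
proof (cases "n = 0")
  case True
  then show ?thesis using \<delta> by (simp add: path_sum_def)
next
  case False
  define \<epsilon> where "\<epsilon> = b * sqrt (2 * real n * ln (1 / \<delta>))"
  have ln_pos: "0 < ln (1 / \<delta>)" using \<delta> by simp
  have \<epsilon>: "0 < \<epsilon>" using ln_pos False b_pos by (simp add: \<epsilon>_def)
  have "measure_pmf.prob (run n) {h. \<epsilon> < path_sum D n h} \<le> measure_pmf.prob (run n) {h. \<epsilon> \<le> path_sum D n h}"
    by (rule measure_pmf.finite_measure_mono) auto
  also have "\<dots> \<le> exp (- (\<epsilon>\<^sup>2 / (2 * real n * b\<^sup>2)))" using False by (intro azuma_hoeffding \<epsilon>) simp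
  also have "\<epsilon>\<^sup>2 / (2 * real n * b\<^sup>2) = ln (1 / \<delta>)"
    using False b_pos ln_pos by (simp add: \<epsilon>_def power_mult_distrib)
  also have "exp (- ln (1 / \<delta>)) = \<delta>" using \<delta> by (simp add: ln_div)
  finally show ?thesis by (simp add: \<epsilon>_def)
qed

end

section \<open>Regret of optimistic greedy policies\<close>

context mdp_kernel
begin

lemma run_state_in:
  assumes "\<pi> \<in> policies (pA M)" "s1 \<in> pS M" "h \<in> set_pmf (run_pmf P \<pi> ([], s1) n)" "i \<le> n"
  shows "snd (hprefix h i) \<in> pS M"
  using run_finite_and_state_in[OF assms(1), of "([], s1)" i] run_pmf_hprefix[OF assms(3,4)] assms(2)
  by simp

lemma regret_le_horizon:
  assumes \<pi>: "\<pi> \<in> policies (pA M)" and s1: "s1 \<in> pS M" and h: "h \<in> set_pmf (run_pmf P \<pi> ([], s1) n)"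
  shows "regret \<gamma> (rew M) P (pA M) \<pi> (Suc n) h \<le> real (Suc n) * horizon"
proof -
  have "snd (hprefix h i) \<in> pS M" if "i < Suc n" for i using run_state_in[OF \<pi> s1 h] that by simp
  moreover have "Vstar \<gamma> (rew M) P (pA M) s \<le> horizon" if "s \<in> pS M" for s
    using that by (intro Vstar_least Vpi_le_horizon) auto
  ultimately have "regret \<gamma> (rew M) P (pA M) \<pi> (Suc n) h \<le> (\<Sum>i<Suc n. horizon) - (\<Sum>i<Suc n. 0)"
    unfolding regret_def using Vpi_nonneg[OF \<pi>] by (intro diff_mono sum_mono) auto
  then show ?thesis by simp
qed

end

lemma discounted_recursion_sum_le:
  fixes x e :: "nat \<Rightarrow> real"
  assumes "0 \<le> \<gamma>" "0 \<le> x 0" and step: "\<And>i. i < n \<Longrightarrow> x i \<le> \<gamma> * x (Suc i) + e i"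
  shows "(1 - \<gamma>) * (\<Sum>i<Suc n. x i) \<le> x n + (\<Sum>i<n. e i)"
proof -
  let ?X = "\<Sum>i<Suc n. x i"
  have "(\<Sum>i<n. x i) \<le> (\<Sum>i<n. \<gamma> * x (Suc i) + e i)" by (intro sum_mono step) simp
  also have "\<dots> = \<gamma> * (\<Sum>i<n. x (Suc i)) + (\<Sum>i<n. e i)" by (simp add: sum.distrib sum_distrib_left)
  also have "(\<Sum>i<n. x (Suc i)) = ?X - x 0" by (simp only: sum.lessThan_Suc_shift add_diff_cancel_left')
  also have "\<gamma> * (?X - x 0) \<le> \<gamma> * ?X" using assms(1,2) by (intro mult_left_mono) auto
  finally show ?thesis by (simp add: left_diff_distrib)
qed

definition greedy_policy ::
  "((nat \<Rightarrow> nat \<Rightarrow> real) \<Rightarrow> nat \<Rightarrow> nat) \<Rightarrow> (hist \<Rightarrow> nat \<Rightarrow> nat \<Rightarrow> real) \<Rightarrow> hist \<Rightarrow> nat pmf" where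
  "greedy_policy sel q h = return_pmf (sel (q h) (snd h))"

locale greedy_run = mdp_kernel +
  fixes sel :: "(nat \<Rightarrow> nat \<Rightarrow> real) \<Rightarrow> nat \<Rightarrow> nat" and q :: "hist \<Rightarrow> nat \<Rightarrow> nat \<Rightarrow> real" and s1 :: nat
  assumes sel_in: "\<And>Q s. sel Q s \<in> pA M"
    and sel_max: "\<And>Q s a. a \<in> pA M \<Longrightarrow> Q s a \<le> Q s (sel Q s)"
    and s1: "s1 \<in> pS M"
begin

abbreviation "\<pi> \<equiv> greedy_policy sel q"
abbreviation "act g \<equiv> sel (q g) (snd g)"
abbreviation "traj n \<equiv> run_pmf P \<pi> ([], s1) n"
abbreviation "state_at h i \<equiv> snd (hprefix h i)"
abbreviation "action_at h i \<equiv> act (hprefix h i)"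

lemma greedy_policy_in: "\<pi> \<in> policies (pA M)"
  using sel_in by (simp add: policies_def greedy_policy_def)

lemma step_greedy: "step_pmf P \<pi> g = map_pmf (\<lambda>k. (fst g @ [(snd g, act g)], k)) (P (snd g) (act g))"
  by (simp add: step_pmf_def greedy_policy_def bind_return_pmf)

lemma mean_reward_greedy: "mean_reward \<pi> g = rew M (snd g) (act g)"
  by (simp add: mean_reward_def greedy_policy_def)

lemma traj_state_in: "g \<in> set_pmf (traj n) \<Longrightarrow> snd g \<in> pS M"
  using run_finite_and_state_in[OF greedy_policy_in, of "([], s1)" n] s1 by simp

text \<open>Clipping keeps the martingale differences bounded also where \<open>q\<close> is not an optimistic value:
  if a confidence polytope is empty, the supremum in the value iteration is a junk value.\<close>

definition clipped_value :: "hist \<Rightarrow> nat \<Rightarrow> real" where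
  "clipped_value g s = max 0 (min horizon (q g s (sel (q g) s)))"

definition next_gap :: "hist \<Rightarrow> hist \<Rightarrow> real" where
  "next_gap g g' = clipped_value g (snd g') - V \<pi> g'"

definition noise :: "hist \<Rightarrow> hist \<Rightarrow> real" where
  "noise g g' = measure_pmf.expectation (step_pmf P \<pi> g) (next_gap g) - next_gap g g'"

lemma next_gap_bounds: "snd g' \<in> pS M \<Longrightarrow> - horizon \<le> next_gap g g' \<and> next_gap g g' \<le> horizon"
  using Vpi_nonneg[OF greedy_policy_in, of g'] Vpi_le_horizon[OF greedy_policy_in, of g'] horizon_pos
  by (auto simp: next_gap_def clipped_value_def)

sublocale noise: bounded_martingale_differences P \<pi> s1 noise "2 * horizon"
proof
  show "0 < 2 * horizon" using horizon_pos by simp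
  fix n g assume g: "g \<in> set_pmf (traj n)"
  have finite: "finite (set_pmf (step_pmf P \<pi> g))"
    by (rule finite_step[OF greedy_policy_in traj_state_in[OF g]])
  show "measure_pmf.expectation (step_pmf P \<pi> g) (noise g) = 0"
    unfolding noise_def
    by (subst Bochner_Integration.integral_diff) (auto intro: integrable_measure_pmf_finite finite)
  have gap: "- horizon \<le> next_gap g g' \<and> next_gap g g' \<le> horizon" if "g' \<in> set_pmf (step_pmf P \<pi> g)" for g'
    by (rule next_gap_bounds[OF step_state_in[OF greedy_policy_in traj_state_in[OF g] that]])
  fix g' assume g': "g' \<in> set_pmf (step_pmf P \<pi> g)"
  have "- horizon \<le> measure_pmf.expectation (step_pmf P \<pi> g) (next_gap g)"
    by (rule expectation_pmf_ge[OF finite]) (use gap in blast)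
  moreover have "measure_pmf.expectation (step_pmf P \<pi> g) (next_gap g) \<le> horizon"
    by (rule expectation_pmf_le[OF finite]) (use gap in blast)
  ultimately show "\<bar>noise g g'\<bar> \<le> 2 * horizon" using gap[OF g'] by (auto simp: noise_def abs_le_iff)
qed

end

locale optimistic_trajectory = greedy_run +
  fixes n :: nat and h :: hist
    and Q :: "nat \<Rightarrow> (nat \<Rightarrow> nat \<Rightarrow> nat \<Rightarrow> real) set" and N :: nat and \<rho> :: "nat \<Rightarrow> real"
  assumes h: "h \<in> set_pmf (traj n)"
    and plausible: "\<And>i. i \<le> n \<Longrightarrow> plausible (Q i)"
    and q_eq: "\<And>i. i \<le> n \<Longrightarrow> q (hprefix h i) = devi M (Q i) N"
    and l1_diameter: "\<And>i p. i < n \<Longrightarrow> p \<in> Q i \<Longrightarrow>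
      l1_dist (pSsa M (state_at h i) (action_at h i))
        (p (state_at h i) (action_at h i)) (pmf (P (state_at h i) (action_at h i))) \<le> \<rho> i"
begin

abbreviation "hist_at i \<equiv> hprefix h i"
abbreviation "state i \<equiv> state_at h i"
abbreviation "action i \<equiv> action_at h i"
abbreviation "val i \<equiv> devi_value M (Q i) N"

definition gap :: "nat \<Rightarrow> real" where "gap i = val i (state i) - V \<pi> (hist_at i)"

definition switches :: "nat set" where "switches = {i. i < n \<and> q (hist_at (Suc i)) \<noteq> q (hist_at i)}"

lemma state_in: "i \<le> n \<Longrightarrow> state i \<in> pS M"
  by (rule run_state_in[OF greedy_policy_in s1 h])

lemma val_bounds: "i \<le> n \<Longrightarrow> s \<in> pS M \<Longrightarrow> 0 \<le> val i s \<and> val i s \<le> horizon"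
  using devi_value_nonneg devi_value_le_horizon plausible_kernel_set[OF plausible] by blast

lemma val_eq_greedy: "i \<le> n \<Longrightarrow> val i s = q (hist_at i) s (sel (q (hist_at i)) s)"
  unfolding q_eq by (intro devi_value_eq sel_in sel_max)

lemma gap_nonneg: "i \<le> n \<Longrightarrow> 0 \<le> gap i"
  using devi_optimistic[OF plausible greedy_policy_in state_in] by (simp add: gap_def)

lemma gap_le_horizon:
  assumes i: "i \<le> n"
  shows "gap i \<le> horizon"
  using val_bounds[OF i state_in[OF i]] Vpi_nonneg[OF greedy_policy_in state_in[OF i]]
  by (simp add: gap_def)

lemma \<rho>_nonneg:
  assumes "i < n"
  shows "0 \<le> \<rho> i"
proof -
  obtain p where "p \<in> Q i" using plausible[of i] assms unfolding plausible_def kernel_set_def by auto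
  from order.trans[OF sum_nonneg[OF abs_ge_zero] l1_diameter[OF assms this]] show ?thesis .
qed

lemma next_gap_eq:
  assumes "i \<le> n" "snd g \<in> pS M"
  shows "next_gap (hist_at i) g = val i (snd g) - V \<pi> g"
  using val_bounds[OF assms] by (simp add: next_gap_def clipped_value_def val_eq_greedy[OF assms(1)])

lemma expectation_next_gap:
  assumes i: "i \<le> n"
  shows "measure_pmf.expectation (step_pmf P \<pi> (hist_at i)) (next_gap (hist_at i)) =
    weighted_mean (pSsa M (state i) (action i)) (pmf (P (state i) (action i))) (val i)
    - measure_pmf.expectation (step_pmf P \<pi> (hist_at i)) (V \<pi>)"
  using reachable_subset[OF state_in[OF i] sel_in]
  by (simp add: step_greedy expectation_kernel[OF state_in[OF i] sel_in] weighted_mean_def next_gap_eq[OF i]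
      subset_iff right_diff_distrib sum_subtractf cong: sum.cong)

lemma gap_le_next_gap:
  assumes i: "i < n"
  shows "gap i \<le> \<gamma> * (noise (hist_at i) (hist_at (Suc i)) + next_gap (hist_at i) (hist_at (Suc i)))
    + \<gamma> * (horizon * \<rho> i) + \<gamma> ^ N"
proof -
  have i_le: "i \<le> n" using i by simp
  have "val i (state i) = devi M (Q i) N (state i) (action i)"
    using val_eq_greedy[OF i_le] by (simp add: q_eq[OF i_le])
  also have "\<dots> \<le> rew M (state i) (action i) + \<gamma> * (weighted_mean (pSsa M (state i) (action i))
      (pmf (P (state i) (action i))) (val i) + horizon * \<rho> i) + \<gamma> ^ N"
    by (rule devi_le_one_step[OF plausible_kernel_set[OF plausible[OF i_le]] state_in[OF i_le] sel_in])
      (rule l1_diameter[OF i])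
  finally show ?thesis
    unfolding gap_def Vpi_bellman[OF greedy_policy_in state_in[OF i_le]] mean_reward_greedy
    by (simp add: noise_def expectation_next_gap[OF i_le] distrib_left right_diff_distrib)
qed

lemma next_gap_le:
  assumes i: "i < n"
  shows "next_gap (hist_at i) (hist_at (Suc i)) \<le> gap (Suc i) + horizon * indicator switches i"
proof -
  have i_le: "i \<le> n" "Suc i \<le> n" using i by auto
  have "val i (state (Suc i)) \<le> val (Suc i) (state (Suc i)) + horizon * indicator switches i"
  proof (cases "i \<in> switches")
    case True
    then show ?thesis
      using val_bounds[OF i_le(1) state_in[OF i_le(2)]] val_bounds[OF i_le(2) state_in[OF i_le(2)]] by simp
  next
    case False
    then show ?thesis using i by (simp add: switches_def val_eq_greedy i_le)
  qed
  then show ?thesis by (simp add: next_gap_eq[OF i_le(1) state_in[OF i_le(2)]] gap_def)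
qed

lemma gap_recursion:
  assumes i: "i < n"
  shows "gap i \<le> \<gamma> * gap (Suc i) + (\<gamma> * noise (hist_at i) (hist_at (Suc i))
    + horizon * \<rho> i + \<gamma> ^ N + horizon * indicator switches i)"
proof -
  have "\<gamma> * next_gap (hist_at i) (hist_at (Suc i)) \<le> \<gamma> * (gap (Suc i) + horizon * indicator switches i)"
    by (rule mult_left_mono[OF next_gap_le[OF i] disc_nonneg])
  moreover have "\<gamma> * (horizon * indicator switches i) \<le> horizon * indicator switches i"
    using horizon_pos by (intro disc_mult_le) simp
  moreover have "\<gamma> * (horizon * \<rho> i) \<le> horizon * \<rho> i"
    using horizon_pos \<rho>_nonneg[OF i] by (intro disc_mult_le) simp
  ultimately show ?thesis using gap_le_next_gap[OF i] by (simp add: distrib_left)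
qed

lemma regret_le_sum_gap: "regret \<gamma> (rew M) P (pA M) \<pi> (Suc n) h \<le> (\<Sum>i<Suc n. gap i)"
  unfolding regret_def sum_subtractf[symmetric] gap_def
  using Vstar_le_devi_value[OF plausible state_in] by (intro sum_mono diff_right_mono) simp

theorem regret_decomposition:
  assumes \<epsilon>: "path_sum noise n h \<le> \<epsilon>" "0 \<le> \<epsilon>"
  shows "regret \<gamma> (rew M) P (pA M) \<pi> (Suc n) h
    \<le> horizon * (horizon + \<epsilon> + horizon * (\<Sum>i<n. \<rho> i) + real n * \<gamma> ^ N + horizon * real (card switches))"
proof -
  have "(\<Sum>i<n. indicator switches i) = real (card switches)"
    by (simp add: indicator_def switches_def sum.If_cases Int_def lessThan_def conj_commute)
  then have "(\<Sum>i<n. \<gamma> * noise (hist_at i) (hist_at (Suc i)) + horizon * \<rho> i + \<gamma> ^ N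
      + horizon * indicator switches i)
    = \<gamma> * path_sum noise n h + horizon * (\<Sum>i<n. \<rho> i) + real n * \<gamma> ^ N + horizon * real (card switches)"
    by (simp add: sum.distrib path_sum_def flip: sum_distrib_left)
  then have "(1 - \<gamma>) * (\<Sum>i<Suc n. gap i)
    \<le> gap n + (\<gamma> * path_sum noise n h + horizon * (\<Sum>i<n. \<rho> i) + real n * \<gamma> ^ N
      + horizon * real (card switches))"
    using discounted_recursion_sum_le[where x = gap and n = n,
        OF disc_nonneg gap_nonneg[OF le0] gap_recursion]
    by simp
  moreover have "\<gamma> * path_sum noise n h \<le> \<epsilon>"
    using mult_left_mono[OF \<epsilon>(1) disc_nonneg] disc_mult_le[OF \<epsilon>(2)] by linarith
  ultimately have "(1 - \<gamma>) * (\<Sum>i<Suc n. gap i)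
    \<le> horizon + \<epsilon> + horizon * (\<Sum>i<n. \<rho> i) + real n * \<gamma> ^ N + horizon * real (card switches)"
    using gap_le_horizon[of n] by linarith
  from mult_left_mono[OF this, of horizon] show ?thesis
    using regret_le_sum_gap horizon_pos disc_less_1 by (simp add: horizon_def)
qed

end

section \<open>Minimisation over the parameter ball\<close>

lemma compact_coordinate_box:
  "compact {f :: nat \<Rightarrow> real. \<forall>i. if i < d then \<bar>f i\<bar> \<le> L else f i = 0}"
proof -
  let ?B = "PiE UNIV (\<lambda>i :: nat. if i < d then {-L..L} else {0 :: real})"
  have "compactin (product_topology (\<lambda>i. euclidean) UNIV) ?B"
    by (subst compactin_PiE) auto
  then have "compact ?B"
    by (simp add: euclidean_product_topology flip: compactin_euclidean_iff)
  also have "?B = {f. \<forall>i. if i < d then \<bar>f i\<bar> \<le> L else f i = 0}"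
    by (auto simp: PiE_def Pi_def abs_le_iff minus_le_iff split: if_splits)
  finally show ?thesis .
qed

lemma vnorm_square: "x \<in> carrier_vec d \<Longrightarrow> (vnorm x)\<^sup>2 = (\<Sum>i<d. (x $ i)\<^sup>2)"
  by (simp add: vnorm_def scalar_prod_def atLeast0LessThan sum_nonneg flip: power2_eq_square)

lemma Theta_eq_image:
  assumes L: "0 \<le> L"
  shows "Theta d L = vec d ` ({f. \<forall>i. if i < d then \<bar>f i\<bar> \<le> L else f i = 0} \<inter> {f. (\<Sum>i<d. (f i)\<^sup>2) \<le> L\<^sup>2})"
    (is "_ = vec d ` ?K")
proof
  show "Theta d L \<subseteq> vec d ` ?K"
  proof
    fix x assume "x \<in> Theta d L"
    then have x: "x \<in> carrier_vec d" "vnorm x \<le> L" by (auto simp: Theta_def)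
    let ?f = "\<lambda>i. if i < d then x $ i else 0"
    have "\<bar>x $ i\<bar> \<le> L" if "i < d" for i using abs_vec_index_le_vnorm[OF x(1) that] x(2) by simp
    moreover have "(\<Sum>i<d. (?f i)\<^sup>2) \<le> L\<^sup>2"
      using power_mono[OF x(2) vnorm_nonneg, of 2] by (simp add: vnorm_square[OF x(1)])
    ultimately have "?f \<in> ?K" by simp
    moreover have "x = vec d ?f" using x by (intro eq_vecI) auto
    ultimately show "x \<in> vec d ` ?K" by blast
  qed
  show "vec d ` ?K \<subseteq> Theta d L"
  proof clarify
    fix f :: "nat \<Rightarrow> real" assume "(\<Sum>i<d. (f i)\<^sup>2) \<le> L\<^sup>2"
    then have "(vnorm (vec d f))\<^sup>2 \<le> L\<^sup>2" by (simp add: vnorm_square[of _ d])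
    from power2_le_imp_le[OF this L] show "vec d f \<in> Theta d L" by (simp add: Theta_def)
  qed
qed

lemma Theta_attains_min:
  fixes g :: "real vec \<Rightarrow> real"
  assumes L: "0 \<le> L" and g: "continuous_on UNIV (\<lambda>f. g (vec d f))"
  shows "\<exists>\<theta>\<in>Theta d L. \<forall>x\<in>Theta d L. g \<theta> \<le> g x"
proof -
  let ?B = "{f :: nat \<Rightarrow> real. \<forall>i. if i < d then \<bar>f i\<bar> \<le> L else f i = 0}"
    and ?S = "{f :: nat \<Rightarrow> real. (\<Sum>i<d. (f i)\<^sup>2) \<le> L\<^sup>2}"
  have "closed ?S"
    by (intro closed_Collect_le continuous_intros continuous_on_product_coordinates)
  then have "compact (?B \<inter> ?S)" by (intro compact_Int_closed compact_coordinate_box)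
  moreover have "(\<lambda>_. 0) \<in> ?B \<inter> ?S" using L by simp
  then have "?B \<inter> ?S \<noteq> {}" by (metis empty_iff)
  moreover have "continuous_on (?B \<inter> ?S) (\<lambda>f. g (vec d f))" by (rule continuous_on_subset[OF g]) simp
  ultimately have "\<exists>f\<in>?B \<inter> ?S. \<forall>h\<in>?B \<inter> ?S. g (vec d f) \<le> g (vec d h)"
    by (rule continuous_attains_inf)
  then show ?thesis unfolding Theta_eq_image[OF L] bex_simps ball_simps .
qed

lemma continuous_on_quadratic:
  assumes \<theta>: "\<theta> \<in> carrier_vec d" and A: "A \<in> carrier_mat d d" and g: "g \<in> carrier_vec d"
  shows "continuous_on S (\<lambda>f :: nat \<Rightarrow> real. g \<bullet> (vec d f - \<theta>) + c * (wnorm A (vec d f - \<theta>))\<^sup>2)"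
proof -
  have coordinate: "continuous_on S (\<lambda>f :: nat \<Rightarrow> real. f i)" for i
    by (rule continuous_on_subset[OF continuous_on_product_coordinates]) simp
  have "(wnorm A (vec d f - \<theta>))\<^sup>2 =
    \<bar>\<Sum>i<d. (f i - \<theta> $ i) * (\<Sum>j<d. A $$ (i, j) * (f j - \<theta> $ j))\<bar>" for f
  proof -
    have "(vec d f - \<theta>) \<bullet> (A *\<^sub>v (vec d f - \<theta>)) =
      (\<Sum>i<d. (f i - \<theta> $ i) * (\<Sum>j<d. A $$ (i, j) * (f j - \<theta> $ j)))"
      using \<theta> A by (simp add: scalar_prod_def atLeast0LessThan)
    moreover have "(sqrt q)\<^sup>2 = \<bar>q\<bar>" for q :: real by (simp add: power2_eq_square)
    ultimately show ?thesis by (simp add: wnorm_def)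
  qed
  moreover have "g \<bullet> (vec d f - \<theta>) = (\<Sum>i<d. g $ i * (f i - \<theta> $ i))" for f
    using \<theta> g by (simp add: scalar_prod_def atLeast0LessThan)
  ultimately show ?thesis
    by (simp only:) (intro continuous_intros coordinate)
qed

section \<open>Iterates of the algorithm\<close>

definition alg_objective :: "ucparams \<Rightarrow> nat \<times> nat \<times> nat \<Rightarrow> real vec \<Rightarrow> real mat \<Rightarrow> real vec \<Rightarrow> real" where
  "alg_objective M tr \<theta> \<Sigma> x = (case tr of (s, a, s2) \<Rightarrow>
     grad (dim M) (loss M s a s2) \<theta> \<bullet> (x - \<theta>)
     + 1 / (2 * eta M) * (wnorm (\<Sigma> + eta M \<cdot>\<^sub>m hess (dim M) (loss M s a s2) \<theta>) (x - \<theta>))\<^sup>2)"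

definition alg_argmin :: "ucparams \<Rightarrow> nat \<times> nat \<times> nat \<Rightarrow> real vec \<Rightarrow> real mat \<Rightarrow> real vec" where
  "alg_argmin M tr \<theta> \<Sigma> = (SOME \<theta>'. \<theta>' \<in> Theta (dim M) (Lth M) \<and>
     (\<forall>x\<in>Theta (dim M) (Lth M). alg_objective M tr \<theta> \<Sigma> \<theta>' \<le> alg_objective M tr \<theta> \<Sigma> x))"

lemma alg_argmin_in_Theta:
  assumes "0 \<le> Lth M" "\<theta> \<in> carrier_vec (dim M)" "\<Sigma> \<in> carrier_mat (dim M) (dim M)"
  shows "alg_argmin M tr \<theta> \<Sigma> \<in> Theta (dim M) (Lth M)"
proof -
  obtain s a s2 where tr: "tr = (s, a, s2)" by (cases tr)
  have "continuous_on UNIV (\<lambda>f. alg_objective M tr \<theta> \<Sigma> (vec (dim M) f))"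
    unfolding alg_objective_def tr prod.case using assms
    by (intro continuous_on_quadratic) (auto simp: grad_def hess_def)
  from someI_ex[OF Theta_attains_min[OF assms(1) this, unfolded Bex_def]]
  show ?thesis unfolding alg_argmin_def by blast
qed

lemma alg_next_eq:
  "alg_next M t (s, a, s2) (\<theta>, \<Sigma>, \<Sigma>\<^sub>k, Q) =
     (let \<theta>' = alg_argmin M (s, a, s2) \<theta> \<Sigma>; \<Sigma>' = \<Sigma> + hess (dim M) (loss M s a s2) \<theta>'
      in if det \<Sigma>' \<le> 2 * det \<Sigma>\<^sub>k then (\<theta>', \<Sigma>', \<Sigma>\<^sub>k, Q)
         else (\<theta>', \<Sigma>', \<Sigma>', devi M (Pset M (Suc t) \<theta>' \<Sigma>') (NN M)))"
  by (simp add: alg_next_def alg_argmin_def alg_objective_def Let_def)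

text \<open>Indices count processed transitions, so \<open>alg_theta M xs i\<close> and \<open>alg_Sigma M xs i\<close> are the paper's
  estimate and matrix at time \<open>i + 1\<close>.\<close>

definition alg_at :: "ucparams \<Rightarrow> (nat \<times> nat \<times> nat) list \<Rightarrow> nat \<Rightarrow> astate" where
  "alg_at M xs i = alg_state M (take i xs)"

definition alg_theta :: "ucparams \<Rightarrow> (nat \<times> nat \<times> nat) list \<Rightarrow> nat \<Rightarrow> real vec" where
  "alg_theta M xs i = fst (alg_at M xs i)"

definition alg_Sigma :: "ucparams \<Rightarrow> (nat \<times> nat \<times> nat) list \<Rightarrow> nat \<Rightarrow> real mat" where
  "alg_Sigma M xs i = fst (snd (alg_at M xs i))"

definition alg_Sigma_episode :: "ucparams \<Rightarrow> (nat \<times> nat \<times> nat) list \<Rightarrow> nat \<Rightarrow> real mat" where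
  "alg_Sigma_episode M xs i = fst (snd (snd (alg_at M xs i)))"

definition alg_Q :: "ucparams \<Rightarrow> (nat \<times> nat \<times> nat) list \<Rightarrow> nat \<Rightarrow> nat \<Rightarrow> nat \<Rightarrow> real" where
  "alg_Q M xs i = snd (snd (snd (alg_at M xs i)))"

definition alg_Pset :: "ucparams \<Rightarrow> (nat \<times> nat \<times> nat) list \<Rightarrow> nat \<Rightarrow> (nat \<Rightarrow> nat \<Rightarrow> nat \<Rightarrow> real) set" where
  "alg_Pset M xs i = Pset M (Suc i) (alg_theta M xs i) (alg_Sigma M xs i)"

lemma alg_at_eq:
  "alg_at M xs i = (alg_theta M xs i, alg_Sigma M xs i, alg_Sigma_episode M xs i, alg_Q M xs i)"
  by (simp add: alg_theta_def alg_Sigma_def alg_Sigma_episode_def alg_Q_def)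

lemma alg_at_0:
  "alg_theta M xs 0 = 0\<^sub>v (dim M)" "alg_Sigma M xs 0 = lam M \<cdot>\<^sub>m 1\<^sub>m (dim M)"
  "alg_Sigma_episode M xs 0 = alg_Sigma M xs 0" "alg_Q M xs 0 = devi M (alg_Pset M xs 0) (NN M)"
  by (simp_all add: alg_theta_def alg_Sigma_def alg_Sigma_episode_def alg_Q_def alg_Pset_def alg_at_def
      alg_state_def alg_init_def Let_def)

lemma alg_run_from_snoc:
  "alg_run_from M t (xs @ [x]) st = alg_next M (t + length xs) x (alg_run_from M t xs st)"
  by (induction xs arbitrary: t st) auto

lemma alg_at_Suc:
  assumes "i < length xs"
  shows "alg_at M xs (Suc i) = alg_next M (Suc i) (xs ! i) (alg_at M xs i)"
  using assms by (simp add: alg_at_def alg_state_def take_Suc_conv_app_nth alg_run_from_snoc)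

lemma
  assumes "i < length xs" "xs ! i = (s, a, s2)"
  shows alg_theta_Suc: "alg_theta M xs (Suc i) =
      alg_argmin M (s, a, s2) (alg_theta M xs i) (alg_Sigma M xs i)"
    and alg_Sigma_Suc: "alg_Sigma M xs (Suc i) =
      alg_Sigma M xs i + hess (dim M) (loss M s a s2) (alg_theta M xs (Suc i))"
    and alg_episode_continues: "det (alg_Sigma M xs (Suc i)) \<le> 2 * det (alg_Sigma_episode M xs i) \<Longrightarrow>
      alg_Sigma_episode M xs (Suc i) = alg_Sigma_episode M xs i \<and> alg_Q M xs (Suc i) = alg_Q M xs i"
    and alg_episode_starts: "\<not> det (alg_Sigma M xs (Suc i)) \<le> 2 * det (alg_Sigma_episode M xs i) \<Longrightarrow>
      alg_Sigma_episode M xs (Suc i) = alg_Sigma M xs (Suc i) \<and>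
      alg_Q M xs (Suc i) = devi M (alg_Pset M xs (Suc i)) (NN M)"
proof -
  note step = alg_at_Suc[OF assms(1), of M, unfolded alg_at_eq assms(2) alg_next_eq Let_def]
  show theta: "alg_theta M xs (Suc i) = alg_argmin M (s, a, s2) (alg_theta M xs i) (alg_Sigma M xs i)"
    using step by (simp split: if_splits)
  show "alg_Sigma M xs (Suc i) = alg_Sigma M xs i + hess (dim M) (loss M s a s2) (alg_theta M xs (Suc i))"
    using step by (simp add: theta split: if_splits)
  note folded_step = step[folded theta, folded this]
  show "det (alg_Sigma M xs (Suc i)) \<le> 2 * det (alg_Sigma_episode M xs i) \<Longrightarrow>
      alg_Sigma_episode M xs (Suc i) = alg_Sigma_episode M xs i \<and> alg_Q M xs (Suc i) = alg_Q M xs i"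
    using folded_step by simp
  show "\<not> det (alg_Sigma M xs (Suc i)) \<le> 2 * det (alg_Sigma_episode M xs i) \<Longrightarrow>
      alg_Sigma_episode M xs (Suc i) = alg_Sigma M xs (Suc i) \<and>
      alg_Q M xs (Suc i) = devi M (alg_Pset M xs (Suc i)) (NN M)"
    using folded_step by (simp add: alg_Pset_def)
qed

lemma alg_episode_exists:
  "i \<le> length xs \<Longrightarrow> \<exists>j\<le>i. alg_Sigma_episode M xs i = alg_Sigma M xs j \<and>
     alg_Q M xs i = devi M (alg_Pset M xs j) (NN M)"
proof (induction i)
  case 0
  then show ?case by (simp add: alg_at_0)
next
  case (Suc i)
  then have i: "i < length xs" by simp
  obtain s a s2 where tr: "xs ! i = (s, a, s2)" by (cases "xs ! i")
  show ?case
  proof (cases "det (alg_Sigma M xs (Suc i)) \<le> 2 * det (alg_Sigma_episode M xs i)")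
    case True
    from alg_episode_continues[OF i tr this] Suc i show ?thesis by (auto intro: le_SucI)
  next
    case False
    from alg_episode_starts[OF i tr this] show ?thesis by blast
  qed
qed

definition alg_episode :: "ucparams \<Rightarrow> (nat \<times> nat \<times> nat) list \<Rightarrow> nat \<Rightarrow> nat" where
  "alg_episode M xs i = (SOME j. j \<le> i \<and> alg_Sigma_episode M xs i = alg_Sigma M xs j \<and>
     alg_Q M xs i = devi M (alg_Pset M xs j) (NN M))"

lemma alg_episode:
  assumes "i \<le> length xs"
  shows alg_episode_le: "alg_episode M xs i \<le> i"
    and alg_Sigma_episode_eq: "alg_Sigma_episode M xs i = alg_Sigma M xs (alg_episode M xs i)"
    and alg_Q_eq_devi: "alg_Q M xs i = devi M (alg_Pset M xs (alg_episode M xs i)) (NN M)"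
  using someI_ex[OF alg_episode_exists[OF assms, of M]] unfolding alg_episode_def by blast+

lemma det_alg_Sigma_le_episode:
  assumes i: "i \<le> length xs" and nonneg: "\<And>j. j \<le> length xs \<Longrightarrow> 0 \<le> det (alg_Sigma M xs j)"
  shows "det (alg_Sigma M xs i) \<le> 2 * det (alg_Sigma_episode M xs i)"
proof (cases i)
  case 0
  then show ?thesis using nonneg[of 0] by (simp add: alg_at_0)
next
  case (Suc j)
  then have j: "j < length xs" using i by simp
  obtain s a s2 where tr: "xs ! j = (s, a, s2)" by (cases "xs ! j")
  show ?thesis
  proof (cases "det (alg_Sigma M xs (Suc j)) \<le> 2 * det (alg_Sigma_episode M xs j)")
    case True
    with alg_episode_continues[OF j tr True] show ?thesis by (simp add: Suc)
  next
    case False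
    with alg_episode_starts[OF j tr False] nonneg[OF i] show ?thesis by (simp add: Suc)
  qed
qed

definition alg_switches :: "ucparams \<Rightarrow> (nat \<times> nat \<times> nat) list \<Rightarrow> nat \<Rightarrow> nat set" where
  "alg_switches M xs i = {j. j < i \<and> alg_Q M xs (Suc j) \<noteq> alg_Q M xs j}"

lemma alg_switches_Suc: "alg_switches M xs (Suc i) =
    alg_switches M xs i \<union> (if alg_Q M xs (Suc i) \<noteq> alg_Q M xs i then {i} else {})"
  by (auto simp: alg_switches_def less_Suc_eq)

lemma power_card_alg_switches_le:
  assumes "i \<le> length xs" and nonneg: "0 \<le> det (alg_Sigma M xs 0)"
  shows "2 ^ card (alg_switches M xs i) * det (alg_Sigma M xs 0) \<le> det (alg_Sigma_episode M xs i)"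
  using assms(1)
proof (induction i)
  case 0
  then show ?case by (simp add: alg_at_0 alg_switches_def)
next
  case (Suc i)
  then have i: "i < length xs" by simp
  obtain s a s2 where tr: "xs ! i = (s, a, s2)" by (cases "xs ! i")
  have IH: "2 ^ card (alg_switches M xs i) * det (alg_Sigma M xs 0) \<le> det (alg_Sigma_episode M xs i)"
    using Suc by simp
  show ?case
  proof (cases "det (alg_Sigma M xs (Suc i)) \<le> 2 * det (alg_Sigma_episode M xs i)")
    case True
    from alg_episode_continues[OF i tr this] IH show ?thesis by (simp add: alg_switches_Suc)
  next
    case False
    have "card (alg_switches M xs (Suc i)) \<le> Suc (card (alg_switches M xs i))"
      unfolding alg_switches_Suc by (rule order.trans[OF card_Un_le]) simp
    then have "(2::real) ^ card (alg_switches M xs (Suc i)) * det (alg_Sigma M xs 0)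
      \<le> 2 ^ Suc (card (alg_switches M xs i)) * det (alg_Sigma M xs 0)"
      using nonneg by (intro mult_right_mono power_increasing) auto
    also have "\<dots> \<le> det (alg_Sigma M xs (Suc i))" using IH False by simp
    finally show ?thesis using alg_episode_starts[OF i tr False] by simp
  qed
qed

section \<open>Trajectories in a multinomial logit MDP\<close>

locale mnl_mdp = finite_mdp +
  fixes \<theta>s :: "real vec" and L\<phi> :: real
  assumes reachable_nonempty: "\<And>s a. s \<in> pS M \<Longrightarrow> a \<in> pA M \<Longrightarrow> pSsa M s a \<noteq> {}"
    and phi_carrier: "\<And>s a k. s \<in> pS M \<Longrightarrow> a \<in> pA M \<Longrightarrow> k \<in> pSsa M s a \<Longrightarrow> phi M s a k \<in> carrier_vec (dim M)"
    and phi_le: "\<And>s a k. s \<in> pS M \<Longrightarrow> a \<in> pA M \<Longrightarrow> k \<in> pSsa M s a \<Longrightarrow> vnorm (phi M s a k) \<le> L\<phi>"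
    and \<theta>s_in_Theta: "\<theta>s \<in> Theta (dim M) (Lth M)"
begin

abbreviation "D \<equiv> dim M"
abbreviation "P \<equiv> trans_pmf (phi M) (pSsa M) \<theta>s"

lemma mnl_model: "s \<in> pS M \<Longrightarrow> a \<in> pA M \<Longrightarrow> mnl_model M s a"
  using finite_reachable reachable_nonempty phi_carrier by unfold_locales

lemma \<theta>s_carrier: "\<theta>s \<in> carrier_vec D"
  using \<theta>s_in_Theta by (simp add: Theta_def)

lemma Lth_nonneg: "0 \<le> Lth M"
  using \<theta>s_in_Theta vnorm_nonneg[of \<theta>s] by (simp add: Theta_def)

lemma UU_ge_1:
  assumes s: "s \<in> pS M"
  shows "1 \<le> real (UU (pS M) (pA M) (pSsa M))"
proof -
  obtain a where a: "a \<in> pA M" using actions_nonempty by blast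
  have "{card (pSsa M s a) | s a. s \<in> pS M \<and> a \<in> pA M} = (\<lambda>(s, a). card (pSsa M s a)) ` (pS M \<times> pA M)"
    by auto
  then have "finite {card (pSsa M s a) | s a. s \<in> pS M \<and> a \<in> pA M}"
    using finite_states finite_actions by simp
  then have "card (pSsa M s a) \<le> UU (pS M) (pA M) (pSsa M)"
    unfolding UU_def using s a by (intro Max_ge) auto
  moreover have "0 < card (pSsa M s a)"
    using finite_reachable[OF s a] reachable_nonempty[OF s a] by (simp add: card_gt_0_iff)
  ultimately show ?thesis by simp
qed

lemma L\<phi>_nonneg:
  assumes s: "s \<in> pS M"
  shows "0 \<le> L\<phi>"
proof -
  obtain a where a: "a \<in> pA M" using actions_nonempty by blast
  obtain k where "k \<in> pSsa M s a" using reachable_nonempty[OF s a] by blast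
  from order.trans[OF vnorm_nonneg phi_le[OF s a this]] show ?thesis .
qed

lemma pmf_trans_pmf:
  assumes "s \<in> pS M" "a \<in> pA M"
  shows "pmf (P s a) k = mnl_kernel M \<theta>s s a k"
proof -
  interpret mnl_model M s a by (rule mnl_model[OF assms])
  have "(\<integral>\<^sup>+ k. ennreal (p \<theta>s k) \<partial>count_space UNIV) = (\<Sum>k\<in>I. ennreal (p \<theta>s k))"
    using finite_reachable by (intro nn_integral_count_space') (auto simp: mnl_outside)
  also have "\<dots> = 1" by (simp add: sum_ennreal mnl_nonneg sum_weights)
  finally show ?thesis unfolding trans_pmf_def by (intro pmf_embed_pmf mnl_nonneg)
qed

sublocale mdp_kernel M P
proof
  fix s a assume sa: "s \<in> pS M" "a \<in> pA M"
  interpret mnl_model M s a by (rule mnl_model[OF sa])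
  show "set_pmf (P s a) \<subseteq> pSsa M s a"
  proof
    fix k assume "k \<in> set_pmf (P s a)"
    then have "p \<theta>s k \<noteq> 0" by (simp add: set_pmf_iff pmf_trans_pmf[OF sa])
    then show "k \<in> pSsa M s a" using mnl_outside by blast
  qed
qed

lemma plausible_Pset:
  assumes "mnl_kernel M \<theta>s \<in> Pset M t \<theta> \<Sigma>"
  shows "plausible (Pset M t \<theta> \<Sigma>)"
  unfolding plausible_def kernel_set_def
proof (intro conjI ballI)
  show "Pset M t \<theta> \<Sigma> \<noteq> {}" using assms by blast
  show "\<exists>q\<in>Pset M t \<theta> \<Sigma>. \<forall>s\<in>pS M. \<forall>a\<in>pA M. \<forall>k\<in>pSsa M s a. q s a k = pmf (P s a) k"
    using assms pmf_trans_pmf by (intro bexI[of _ "mnl_kernel M \<theta>s"]) auto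
  fix q s a assume "q \<in> Pset M t \<theta> \<Sigma>" and sa: "s \<in> pS M" "a \<in> pA M"
  then have "\<forall>k\<in>pS M. 0 \<le> q s a k" "(\<Sum>k\<in>pSsa M s a. q s a k) = 1"
    by (simp_all add: Pset_def mem_conf_set_iff)
  then show "prob_weights (pSsa M s a) (q s a)"
    using finite_reachable[OF sa] reachable_subset[OF sa] by unfold_locales auto
qed

end

locale mnl_trajectory = mnl_mdp +
  fixes xs :: "(nat \<times> nat \<times> nat) list"
  assumes transitions_valid: "\<And>i. i < length xs \<Longrightarrow> fst (xs ! i) \<in> pS M \<and> fst (snd (xs ! i)) \<in> pA M \<and>
    snd (snd (xs ! i)) \<in> pSsa M (fst (xs ! i)) (fst (snd (xs ! i)))"
begin

abbreviation "sx i \<equiv> fst (xs ! i)"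
abbreviation "ax i \<equiv> fst (snd (xs ! i))"
abbreviation "\<theta>h \<equiv> alg_theta M xs"
abbreviation "\<Sigma> \<equiv> alg_Sigma M xs"

lemma mnl_model_at: "i < length xs \<Longrightarrow> mnl_model M (sx i) (ax i)"
  using mnl_model transitions_valid by blast

lemma alg_theta_in_Theta_and_alg_Sigma_carrier:
  "i \<le> length xs \<Longrightarrow> \<theta>h i \<in> Theta D (Lth M) \<and> \<Sigma> i \<in> carrier_mat D D"
proof (induction i)
  case 0
  then show ?case using Lth_nonneg by (simp add: alg_at_0 Theta_def vnorm_def)
next
  case (Suc i)
  then have i: "i < length xs" by simp
  obtain s a s2 where tr: "xs ! i = (s, a, s2)" by (cases "xs ! i")
  have "\<theta>h i \<in> carrier_vec D" "\<Sigma> i \<in> carrier_mat D D" using Suc by (auto simp: Theta_def)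
  then show ?case
    using alg_argmin_in_Theta[OF Lth_nonneg]
    by (simp add: alg_theta_Suc[OF i tr] alg_Sigma_Suc[OF i tr] hess_def)
qed

lemma theta_in_Theta: "i \<le> length xs \<Longrightarrow> \<theta>h i \<in> Theta D (Lth M)"
  using alg_theta_in_Theta_and_alg_Sigma_carrier by blast

lemma theta_carrier: "i \<le> length xs \<Longrightarrow> \<theta>h i \<in> carrier_vec D"
  using theta_in_Theta by (auto simp: Theta_def)

lemma Sigma_carrier: "i \<le> length xs \<Longrightarrow> \<Sigma> i \<in> carrier_mat D D"
  using alg_theta_in_Theta_and_alg_Sigma_carrier by blast

lemma Sigma_Suc:
  assumes i: "i < length xs"
  shows "\<Sigma> (Suc i) = \<Sigma> i + gram D (pSsa M (sx i) (ax i)) (hess_factor M (sx i) (ax i) (\<theta>h (Suc i)))"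
proof -
  interpret mnl_model M "sx i" "ax i" by (rule mnl_model_at[OF i])
  have "xs ! i = (sx i, ax i, snd (snd (xs ! i)))" by simp
  from alg_Sigma_Suc[OF i this] show ?thesis
    using hess_loss theta_carrier[of "Suc i"] transitions_valid[OF i] i by simp
qed

lemma Sigma_updates:
  assumes "j \<le> i" "i \<le> length xs"
  shows "(rank_one_update D)\<^sup>*\<^sup>* (\<Sigma> j) (\<Sigma> i)"
  using assms
proof (induction i rule: dec_induct)
  case (step i)
  then have i: "i < length xs" by simp
  interpret mnl_model M "sx i" "ax i" by (rule mnl_model_at[OF i])
  have "(rank_one_update D)\<^sup>*\<^sup>* (\<Sigma> i) (\<Sigma> (Suc i))"
    unfolding Sigma_Suc[OF i] using i
    by (intro rank_one_updates_gram Sigma_carrier finite_reachable hess_factor_carrier) auto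
  with step show ?case by simp
qed simp

lemma abs_Sigma_index_le:
  assumes "i \<le> length xs" "u < D" "w < D"
  shows "\<bar>\<Sigma> i $$ (u, w)\<bar> \<le> \<bar>lam M\<bar> + real i * (4 * L\<phi>\<^sup>2)"
  using assms(1)
proof (induction i)
  case 0
  then show ?case using assms by (simp add: alg_at_0)
next
  case (Suc i)
  then have i: "i < length xs" by simp
  interpret mnl_model M "sx i" "ax i" by (rule mnl_model_at[OF i])
  have "\<bar>gram D I (hess_factor M (sx i) (ax i) (\<theta>h (Suc i))) $$ (u, w)\<bar> \<le> 4 * L\<phi>\<^sup>2"
    using phi_le transitions_valid[OF i] by (intro abs_gram_hess_factor_le assms) auto
  then show ?case
    using Suc assms Sigma_carrier[of i] by (simp add: Sigma_Suc[OF i] algebra_simps)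
qed

end

lemma le_two_ln_one_plus:
  fixes x :: real
  assumes "0 \<le> x" "x \<le> 1"
  shows "x \<le> 2 * ln (1 + x)"
proof -
  have "ln (inverse (1 + x)) \<le> inverse (1 + x) - 1" using assms by (intro ln_le_minus_one) simp
  then have "1 - inverse (1 + x) \<le> ln (1 + x)" using assms by (simp add: ln_inverse)
  moreover have "x / 2 \<le> x / (1 + x)" using assms by (intro divide_left_mono) auto
  moreover have "x / (1 + x) = 1 - inverse (1 + x)" using assms by (simp add: field_simps)
  ultimately show ?thesis by linarith
qed

locale regularized_trajectory = mnl_trajectory +
  assumes lam_pos: "0 < lam M" and lam_ge: "4 * L\<phi>\<^sup>2 \<le> lam M"
begin

definition potential :: "nat \<Rightarrow> real" where
  "potential i = feature_variance M (sx i) (ax i) (\<theta>h (Suc i)) (\<Sigma> i)"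

definition log_det_growth :: "nat \<Rightarrow> real" where
  "log_det_growth i = ln (det (\<Sigma> i) / det (\<Sigma> 0))"

lemma pd_Sigma: "i \<le> length xs \<Longrightarrow> pd D (\<Sigma> i)"
  using pd_rank_one_updates[OF Sigma_updates[of 0 i]] pd_smult_one[OF lam_pos] by (simp add: alg_at_0)

lemma det_Sigma_pos: "i \<le> length xs \<Longrightarrow> 0 < det (\<Sigma> i)"
  using pd_Sigma pd_det_pos by blast

lemma wnorm_minv_Sigma_le:
  assumes "i \<le> length xs" and x: "x \<in> carrier_vec D"
  shows "wnorm (minv (\<Sigma> i)) x \<le> vnorm x / sqrt (lam M)"
  using wnorm_minv_rank_one_updates_antimono[OF Sigma_updates[of 0 i] pd_Sigma x] assms
  by (simp add: alg_at_0 wnorm_minv_smult_one[OF lam_pos x])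

lemma max_feature_square_Sigma_le:
  assumes i: "i < length xs"
  shows "max_feature_square M (sx i) (ax i) (\<Sigma> i) \<le> L\<phi>\<^sup>2 / lam M"
proof -
  interpret mnl_model M "sx i" "ax i" by (rule mnl_model_at[OF i])
  show ?thesis
  proof (rule max_feature_square_le)
    fix k assume k: "k \<in> I"
    have "vnorm (\<phi> k) / sqrt (lam M) \<le> L\<phi> / sqrt (lam M)"
      using phi_le k transitions_valid[OF i] lam_pos by (intro divide_right_mono) auto
    then have "wnorm (minv (\<Sigma> i)) (\<phi> k) \<le> L\<phi> / sqrt (lam M)"
      using wnorm_minv_Sigma_le[of i "\<phi> k"] i phi_carrier[OF k] by simp
    then have "(wnorm (minv (\<Sigma> i)) (\<phi> k))\<^sup>2 \<le> (L\<phi> / sqrt (lam M))\<^sup>2"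
      using i by (intro power_mono wnorm_nonneg[OF psd_minv[OF pd_Sigma] phi_carrier[OF k]]) auto
    then show "(wnorm (minv (\<Sigma> i)) (\<phi> k))\<^sup>2 \<le> L\<phi>\<^sup>2 / lam M" using lam_pos by (simp add: power_divide)
  qed
qed

lemma potential_bounds:
  assumes i: "i < length xs"
  shows potential_nonneg: "0 \<le> potential i" and potential_le_1: "potential i \<le> 1"
proof -
  interpret mnl_model M "sx i" "ax i" by (rule mnl_model_at[OF i])
  have pd: "pd D (\<Sigma> i)" using pd_Sigma i by simp
  show "0 \<le> potential i" unfolding potential_def by (rule feature_variance_nonneg)
  have "potential i \<le> 4 * (L\<phi>\<^sup>2 / lam M)"
    unfolding potential_def
    using feature_variance_le[OF pd, of "\<theta>h (Suc i)"] max_feature_square_Sigma_le[OF i] by linarith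
  also have "\<dots> \<le> 1" using lam_pos lam_ge by simp
  finally show "potential i \<le> 1" .
qed

lemma det_Sigma_Suc_ge:
  assumes i: "i < length xs"
  shows "det (\<Sigma> i) * (1 + potential i) \<le> det (\<Sigma> (Suc i))"
proof -
  interpret mnl_model M "sx i" "ax i" by (rule mnl_model_at[OF i])
  have pd: "pd D (\<Sigma> i)" using pd_Sigma i by simp
  show ?thesis
    unfolding Sigma_Suc[OF i] potential_def sum_wnorm_hess_factor[OF pd, symmetric]
    by (intro det_add_gram_ge pd finite_reachable hess_factor_carrier)
qed

lemma sum_potential_le: "i \<le> length xs \<Longrightarrow> (\<Sum>j<i. potential j) \<le> 2 * log_det_growth i"
proof (induction i)
  case 0
  then show ?case using det_Sigma_pos[of 0] by (simp add: log_det_growth_def)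
next
  case (Suc i)
  then have i: "i < length xs" by simp
  note pos = det_Sigma_pos[of i] det_Sigma_pos[OF Suc.prems] det_Sigma_pos[of 0]
  have "potential i / 2 \<le> ln (1 + potential i)" using le_two_ln_one_plus[OF potential_bounds[OF i]] by simp
  also have "\<dots> \<le> ln (det (\<Sigma> (Suc i)) / det (\<Sigma> i))"
    using det_Sigma_Suc_ge[OF i] pos i potential_nonneg[OF i] by (intro ln_mono) (auto simp: field_simps)
  also have "\<dots> = log_det_growth (Suc i) - log_det_growth i"
    using pos i by (simp add: ln_div log_det_growth_def)
  finally show ?case using Suc i by simp
qed

lemma log_det_growth_le:
  assumes i: "i \<le> length xs" and D: "0 < D"
  shows "log_det_growth i \<le> real D * ln (real D * (1 + real i))"
proof -
  have "\<bar>\<Sigma> i $$ (u, w)\<bar> \<le> lam M * (1 + real i)" if "u < D" "w < D" for u w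
    using abs_Sigma_index_le[OF i that] mult_left_mono[OF lam_ge, of "real i"] lam_pos
    by (simp add: algebra_simps)
  then have "det (\<Sigma> i) \<le> (real D * (lam M * (1 + real i))) ^ D"
    using abs_det_le[OF Sigma_carrier[OF i]] abs_le_D1 by blast
  also have "\<dots> = (real D * (1 + real i)) ^ D * det (\<Sigma> 0)"
    by (simp add: alg_at_0 power_mult_distrib)
  finally have "det (\<Sigma> i) / det (\<Sigma> 0) \<le> (real D * (1 + real i)) ^ D"
    using det_Sigma_pos[of 0] by (simp add: pos_divide_le_eq)
  then have "log_det_growth i \<le> ln ((real D * (1 + real i)) ^ D)"
    unfolding log_det_growth_def using det_Sigma_pos[of 0] det_Sigma_pos[OF i] by (intro ln_mono) auto
  also have "\<dots> = real D * ln (real D * (1 + real i))" using D by (simp add: ln_realpow)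
  finally show ?thesis .
qed

lemma det_Sigma_le_episode: "i \<le> length xs \<Longrightarrow> det (\<Sigma> i) \<le> 2 * det (\<Sigma> (alg_episode M xs i))"
  using det_alg_Sigma_le_episode[of i xs M] det_Sigma_pos alg_Sigma_episode_eq[of i xs M]
  by (simp add: less_imp_le)

lemma card_alg_switches_le:
  assumes i: "i \<le> length xs"
  shows "real (card (alg_switches M xs i)) \<le> 2 * log_det_growth i"
proof -
  let ?K = "card (alg_switches M xs i)" and ?j = "alg_episode M xs i"
  have "2 ^ ?K * det (\<Sigma> 0) \<le> det (\<Sigma> ?j)"
    using power_card_alg_switches_le[OF i, of M] det_Sigma_pos[of 0] alg_Sigma_episode_eq[OF i, of M]
    by simp
  also have "\<dots> \<le> det (\<Sigma> i)"
    using alg_episode_le[OF i, of M] i by (intro det_rank_one_updates_mono[OF Sigma_updates pd_Sigma]) auto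
  finally have "ln (2 ^ ?K) \<le> log_det_growth i"
    unfolding log_det_growth_def using det_Sigma_pos[of 0]
    by (intro ln_mono) (auto simp: pos_le_divide_eq intro: less_le_trans[OF zero_less_power])
  then have "real ?K * ln 2 \<le> log_det_growth i" by (simp add: ln_realpow)
  moreover have "real ?K * (1 / 2) \<le> real ?K * ln 2"
    using le_two_ln_one_plus[of 1] by (intro mult_left_mono) auto
  ultimately show ?thesis by linarith
qed

end

subsection \<open>Confidence polytopes along an episode\<close>

locale confident_trajectory = regularized_trajectory +
  fixes \<kappa> B :: real
  assumes \<kappa>_pos: "0 < \<kappa>"
    and kappa_le: "\<And>i \<theta> k l. i < length xs \<Longrightarrow> \<theta> \<in> Theta D (Lth M) \<Longrightarrow>
      k \<in> pSsa M (sx i) (ax i) \<Longrightarrow> l \<in> pSsa M (sx i) (ax i) \<Longrightarrow>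
      \<kappa> \<le> mnl_kernel M \<theta> (sx i) (ax i) k * mnl_kernel M \<theta> (sx i) (ax i) l"
    and phi_zero: "\<And>i. i < length xs \<Longrightarrow> \<exists>k\<in>pSsa M (sx i) (ax i). phi M (sx i) (ax i) k = 0\<^sub>v D"
    and confident: "\<And>j. j \<le> length xs \<Longrightarrow> wnorm (\<Sigma> j) (\<theta>h j - \<theta>s) \<le> beta M (Suc j)"
    and beta_le: "\<And>j. j \<le> length xs \<Longrightarrow> beta M (Suc j) \<le> B"
begin

lemma beta_nonneg:
  assumes j: "j \<le> length xs"
  shows "0 \<le> beta M (Suc j)"
proof -
  have "0 \<le> wnorm (\<Sigma> j) (\<theta>h j - \<theta>s)"
    using theta_carrier[OF j] \<theta>s_carrier by (intro wnorm_nonneg[OF pd_psd[OF pd_Sigma[OF j]]]) simp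
  then show ?thesis using confident[OF j] by linarith
qed

lemma B_nonneg: "0 \<le> B"
  using beta_nonneg[of 0] beta_le[of 0] by linarith

lemma mnl_in_Pset:
  assumes j: "j \<le> length xs"
  shows "mnl_kernel M \<theta>s \<in> alg_Pset M xs j"
  unfolding alg_Pset_def Pset_def mem_conf_set_iff
proof (intro ballI conjI)
  fix s a assume sa: "s \<in> pS M" "a \<in> pA M"
  interpret mnl_model M s a by (rule mnl_model[OF sa])
  have "wnorm (\<Sigma> j) (\<theta>s - \<theta>h j) \<le> beta M (Suc j)"
    using confident[OF j] wnorm_minus_commute[OF pd_psd[OF pd_Sigma[OF j]] \<theta>s_carrier theta_carrier[OF j]]
    by simp
  then show "l1_dist I (p \<theta>s) (p (\<theta>h j)) \<le> conf_radius M s a (\<theta>h j) (\<Sigma> j) (beta M (Suc j))"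
    by (rule mnl_l1_le_conf_radius[OF pd_Sigma[OF j] theta_carrier[OF j] \<theta>s_carrier])
qed (use mnl_model.mnl_nonneg mnl_model.mnl_le_1 prob_weights.sum_weights[OF prob_weights_kernel]
    in \<open>auto simp: mnl_model pmf_trans_pmf\<close>)

lemma plausible_alg_Pset: "j \<le> length xs \<Longrightarrow> plausible (alg_Pset M xs j)"
  using plausible_Pset mnl_in_Pset unfolding alg_Pset_def by blast

lemma wnorm_theta_drift_le:
  assumes "j \<le> i" "i \<le> length xs"
  shows "wnorm (\<Sigma> j) (\<theta>h j - \<theta>h i) \<le> 2 * B"
proof -
  have j: "j \<le> length xs" using assms by simp
  note psd = pd_psd[OF pd_Sigma[OF j]]
  note carrier = theta_carrier[OF j] \<theta>s_carrier theta_carrier[OF assms(2)]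
  have "wnorm (\<Sigma> j) (\<theta>h i - \<theta>s) \<le> wnorm (\<Sigma> i) (\<theta>h i - \<theta>s)"
    using carrier by (intro wnorm_rank_one_updates_mono[OF Sigma_updates pd_Sigma] assms j) simp
  then show ?thesis
    using wnorm_diff_triangle_le[OF psd carrier] wnorm_minus_commute[OF psd carrier(2,3)]
      confident[OF j] confident[OF assms(2)] beta_le[OF j] beta_le[OF assms(2)]
    by linarith
qed

definition transition_error :: "nat \<Rightarrow> real" where
  "transition_error i = 4 * B * sqrt (potential i) + 60 * B\<^sup>2 * potential i / \<kappa>"

context
  fixes i j :: nat
  assumes i: "i < length xs" and j: "j \<le> i" and det_le: "det (\<Sigma> i) \<le> 2 * det (\<Sigma> j)"
begin

interpretation mnl_model M "sx i" "ax i" by (rule mnl_model_at[OF i])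

lemma indices: "j \<le> length xs" "i \<le> length xs" "Suc i \<le> length xs"
  using i j by auto

lemma wnorm_minv_episode_le:
  assumes x: "x \<in> carrier_vec D"
  shows "(wnorm (minv (\<Sigma> j)) x)\<^sup>2 \<le> 2 * (wnorm (minv (\<Sigma> i)) x)\<^sup>2"
proof -
  have "det (\<Sigma> j) * (wnorm (minv (\<Sigma> j)) x)\<^sup>2 \<le> det (\<Sigma> i) * (wnorm (minv (\<Sigma> i)) x)\<^sup>2"
    by (rule det_wnorm_minv_rank_one_updates_mono[OF Sigma_updates pd_Sigma x]) (use indices j in auto)
  also have "\<dots> \<le> det (\<Sigma> j) * (2 * (wnorm (minv (\<Sigma> i)) x)\<^sup>2)"
    using mult_right_mono[OF det_le, of "(wnorm (minv (\<Sigma> i)) x)\<^sup>2"] by (simp add: mult_ac)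
  finally show ?thesis using det_Sigma_pos[OF indices(1)] by (simp only: mult_le_cancel_left_pos)
qed

lemma feature_variance_episode_le:
  "feature_variance M (sx i) (ax i) \<theta> (\<Sigma> j) \<le> 2 * feature_variance M (sx i) (ax i) \<theta> (\<Sigma> i)"
  unfolding feature_variance_def weighted_mean_cmult[symmetric]
  by (intro weighted_mean_mono wnorm_minv_episode_le centered_carrier)

lemma max_feature_square_episode_le: "max_feature_square M (sx i) (ax i) (\<Sigma> j) \<le> 2 * potential i / \<kappa>"
proof -
  obtain z where z: "z \<in> I" "\<phi> z = 0\<^sub>v D" using phi_zero[OF i] by blast
  have "\<kappa> * max_feature_square M (sx i) (ax i) (\<Sigma> j) \<le> feature_variance M (sx i) (ax i) (\<theta>h (Suc i)) (\<Sigma> j)"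
    by (rule kappa_max_feature_square_le[OF pd_Sigma[OF indices(1)] less_imp_le[OF \<kappa>_pos] _ z])
      (rule kappa_le[OF i theta_in_Theta[OF indices(3)]])
  also have "\<dots> \<le> 2 * potential i" unfolding potential_def by (rule feature_variance_episode_le)
  finally show ?thesis using \<kappa>_pos by (simp add: pos_le_divide_eq mult.commute)
qed

lemma centered_width_episode_le:
  "centered_width M (sx i) (ax i) (\<theta>h j) (\<Sigma> j) \<le> 2 * sqrt (potential i) + 24 * B * potential i / \<kappa>"
proof -
  let ?w = "\<lambda>\<theta>. centered_width M (sx i) (ax i) \<theta> (\<Sigma> j)" and ?m = "max_feature_square M (sx i) (ax i) (\<Sigma> j)"
  have "(?w (\<theta>h (Suc i)))\<^sup>2 \<le> 2 * potential i"
    unfolding potential_def by (rule order.trans[OF centered_width_square_le feature_variance_episode_le])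
  also have "\<dots> \<le> 4 * potential i" using potential_nonneg[OF i] by simp
  finally have "?w (\<theta>h (Suc i)) \<le> sqrt (4 * potential i)" by (rule real_le_rsqrt)
  also have "\<dots> = 2 * sqrt (potential i)" by (simp add: real_sqrt_mult)
  finally have new_estimate: "?w (\<theta>h (Suc i)) \<le> 2 * sqrt (potential i)" .
  have "6 * ?m * wnorm (\<Sigma> j) (\<theta>h j - \<theta>h (Suc i)) \<le> 6 * (2 * potential i / \<kappa>) * (2 * B)"
    using wnorm_nonneg[OF pd_psd[OF pd_Sigma[OF indices(1)]]] theta_carrier indices j
      max_feature_square_nonneg[of "\<Sigma> j"] \<kappa>_pos potential_nonneg[OF i]
    by (intro mult_mono wnorm_theta_drift_le max_feature_square_episode_le) auto
  then show ?thesis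
    using centered_width_lipschitz[OF pd_Sigma theta_carrier theta_carrier, OF indices(1,3,1)] new_estimate
    by (simp add: mult_ac)
qed

lemma conf_radius_episode_le:
  "conf_radius M (sx i) (ax i) (\<theta>h j) (\<Sigma> j) (beta M (Suc j)) \<le> transition_error i / 2"
proof -
  have "conf_radius M (sx i) (ax i) (\<theta>h j) (\<Sigma> j) (beta M (Suc j))
    \<le> B * (2 * sqrt (potential i) + 24 * B * potential i / \<kappa>) + 3 * B\<^sup>2 * (2 * potential i / \<kappa>)"
    unfolding conf_radius_def
    using beta_nonneg beta_le indices centered_width_nonneg[OF pd_Sigma] max_feature_square_nonneg B_nonneg
    by (intro add_mono mult_mono power_mono centered_width_episode_le max_feature_square_episode_le) auto
  also have "\<dots> = transition_error i / 2"
    using \<kappa>_pos by (simp add: transition_error_def field_simps power2_eq_square)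
  finally show ?thesis .
qed

theorem Pset_l1_diameter:
  assumes q: "q \<in> alg_Pset M xs j"
  shows "l1_dist (pSsa M (sx i) (ax i)) (q (sx i) (ax i)) (pmf (P (sx i) (ax i))) \<le> transition_error i"
proof -
  have sa: "sx i \<in> pS M" "ax i \<in> pA M" using transitions_valid[OF i] by auto
  have to_estimate: "l1_dist I (q' (sx i) (ax i)) (p (\<theta>h j)) \<le> transition_error i / 2"
    if "q' \<in> alg_Pset M xs j" for q'
    using that sa conf_radius_episode_le unfolding alg_Pset_def Pset_def mem_conf_set_iff
    by (meson order.trans)
  have "l1_dist I (q (sx i) (ax i)) (p \<theta>s)
    \<le> (\<Sum>k\<in>I. \<bar>q (sx i) (ax i) k - p (\<theta>h j) k\<bar> + \<bar>p \<theta>s k - p (\<theta>h j) k\<bar>)"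
    by (intro sum_mono) linarith
  also have "\<dots> \<le> transition_error i / 2 + transition_error i / 2"
    unfolding sum.distrib by (intro add_mono to_estimate q mnl_in_Pset indices)
  finally show ?thesis by (simp add: pmf_trans_pmf[OF sa])
qed

end

lemma sum_transition_error_le:
  assumes G: "(\<Sum>i<length xs. potential i) \<le> G"
  shows "(\<Sum>i<length xs. transition_error i) \<le> 4 * B * sqrt (real (length xs) * G) + 60 * B\<^sup>2 * G / \<kappa>"
proof -
  let ?n = "length xs"
  have "(\<Sum>i<?n. sqrt (potential i))\<^sup>2 \<le> (\<Sum>i<?n. (sqrt (potential i))\<^sup>2) * real (card {..<?n})"
    by (rule sum_squared_le_sum_of_squares)
  also have "\<dots> = (\<Sum>i<?n. potential i) * real ?n" using potential_nonneg by simp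
  also have "\<dots> \<le> real ?n * G" using mult_right_mono[OF G, of "real ?n"] by (simp add: mult.commute)
  finally have "(\<Sum>i<?n. sqrt (potential i)) \<le> sqrt (real ?n * G)" by (rule real_le_rsqrt)
  then have "4 * B * (\<Sum>i<?n. sqrt (potential i)) \<le> 4 * B * sqrt (real ?n * G)"
    using B_nonneg by (intro mult_left_mono) auto
  moreover have "60 * B\<^sup>2 / \<kappa> * (\<Sum>i<?n. potential i) \<le> 60 * B\<^sup>2 / \<kappa> * G"
    using \<kappa>_pos by (intro mult_left_mono G) auto
  moreover have "(\<Sum>i<?n. transition_error i)
    = 4 * B * (\<Sum>i<?n. sqrt (potential i)) + 60 * B\<^sup>2 / \<kappa> * (\<Sum>i<?n. potential i)"
    by (simp add: transition_error_def sum.distrib sum_distrib_left)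
  ultimately show ?thesis by simp
qed

end

subsection \<open>Vanishing features\<close>

text \<open>If \<open>L\<phi> = 0\<close>, the hypothesis on \<open>\<lambda>\<close> admits \<open>\<lambda> = 0\<close>, and \<open>minv\<close> of the singular matrices is a
  junk value. All polytopes then reduce to the true kernel.\<close>

context mnl_mdp
begin

context
  assumes L\<phi>_eq_0: "L\<phi> = 0"
begin

lemma phi_eq_zero:
  assumes "s \<in> pS M" "a \<in> pA M" "k \<in> pSsa M s a"
  shows "phi M s a k = 0\<^sub>v D"
proof -
  note carrier = phi_carrier[OF assms]
  have "phi M s a k $ j = 0" if "j < D" for j
    using abs_vec_index_le_vnorm[OF carrier that] phi_le[OF assms] L\<phi>_eq_0 by simp
  then show ?thesis using carrier by (intro eq_vecI) auto
qed

lemma conf_radius_eq_zero: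
  assumes sa: "s \<in> pS M" "a \<in> pA M"
  shows "conf_radius M s a \<theta> A b = 0"
proof -
  have "mean_feat M \<theta> s a = 0\<^sub>v D"
    using phi_eq_zero[OF sa] by (intro eq_vecI) (auto simp: mean_feat_def)
  then have "centered_width M s a \<theta> A = 0"
    using phi_eq_zero[OF sa] by (simp add: centered_width_def weighted_mean_def wnorm_zero)
  moreover have "(\<lambda>k. (wnorm (minv A) (phi M s a k))\<^sup>2) ` pSsa M s a = {0}"
    using phi_eq_zero[OF sa] reachable_nonempty[OF sa] by (auto simp: wnorm_zero)
  then have "max_feature_square M s a A = 0" by (simp add: max_feature_square_def)
  ultimately show ?thesis by (simp add: conf_radius_def)
qed

lemma mem_Pset_zero_features_iff:
  assumes \<theta>: "\<theta> \<in> carrier_vec D"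
  shows "q \<in> Pset M t \<theta> A \<longleftrightarrow> (\<forall>s\<in>pS M. \<forall>a\<in>pA M.
    (\<forall>k\<in>pS M. 0 \<le> q s a k \<and> q s a k \<le> 1) \<and> (\<Sum>k\<in>pSsa M s a. q s a k) = 1 \<and>
    l1_dist (pSsa M s a) (q s a) (mnl_kernel M \<theta>s s a) \<le> 0)"
proof -
  have "mnl_kernel M \<theta> s a k = mnl_kernel M \<theta>s s a k" if "s \<in> pS M" "a \<in> pA M" for s a k
    using phi_eq_zero[OF that] \<theta> \<theta>s_carrier by (simp add: mnl_def cong: sum.cong)
  then show ?thesis unfolding Pset_def mem_conf_set_iff by (simp add: conf_radius_eq_zero)
qed

lemma mnl_in_Pset_zero_features:
  assumes "\<theta> \<in> carrier_vec D"
  shows "mnl_kernel M \<theta>s \<in> Pset M t \<theta> A"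
  unfolding mem_Pset_zero_features_iff[OF assms]
  using mnl_model.mnl_nonneg mnl_model.mnl_le_1 prob_weights.sum_weights[OF prob_weights_kernel]
  by (auto simp: mnl_model pmf_trans_pmf)

end
end

lemma (in mnl_trajectory) alg_Q_zero_features:
  assumes L\<phi>: "L\<phi> = 0" and i: "i \<le> length xs"
  shows "alg_Q M xs i = devi M (alg_Pset M xs 0) (NN M)"
proof -
  have "\<theta>h (alg_episode M xs i) \<in> carrier_vec D" "\<theta>h 0 \<in> carrier_vec D"
    using theta_carrier alg_episode_le[OF i, of M] i by auto
  then have "alg_Pset M xs (alg_episode M xs i) = alg_Pset M xs 0"
    unfolding alg_Pset_def by (intro Set.set_eqI) (simp add: mem_Pset_zero_features_iff[OF L\<phi>])
  then show ?thesis by (simp add: alg_Q_eq_devi[OF i])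
qed

section \<open>Regret of the algorithm\<close>

lemma transitions_length [simp]: "length (transitions h) = length (fst h)"
  by (simp add: transitions_def)

lemma transitions_nth:
  "i < length (fst h) \<Longrightarrow> transitions h ! i = (fst (fst h ! i), snd (fst h ! i), snd (hprefix h (Suc i)))"
  by (simp add: transitions_def hprefix_def)

lemma transitions_hprefix:
  assumes "i \<le> length (fst h)"
  shows "transitions (hprefix h i) = take i (transitions h)"
proof (rule nth_equalityI)
  show "length (transitions (hprefix h i)) = length (take i (transitions h))"
    using assms by (simp add: hprefix_def)
  fix j assume "j < length (transitions (hprefix h i))"
  then have j: "j < i" "j < length (fst h)" using assms by (auto simp: hprefix_def)
  have "hprefix (hprefix h i) (Suc j) = hprefix h (Suc j)"
    using j assms by (cases "Suc j = i") (auto simp: hprefix_def)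
  then show "transitions (hprefix h i) ! j = take i (transitions h) ! j"
    using j assms by (simp add: transitions_nth hprefix_def[of h i])
qed

definition hist_Q :: "ucparams \<Rightarrow> hist \<Rightarrow> nat \<Rightarrow> nat \<Rightarrow> real" where
  "hist_Q M h = alg_Q M (transitions h) (length (fst h))"

lemma hist_Q_hprefix: "i \<le> length (fst h) \<Longrightarrow> hist_Q M (hprefix h i) = alg_Q M (transitions h) i"
  by (simp add: hist_Q_def alg_Q_def alg_at_def transitions_hprefix) (simp add: hprefix_def)

lemma ucmnlk_eq: "ucmnlk M sel h = sel (hist_Q M h) (snd h)"
  by (simp add: ucmnlk_def hist_Q_def alg_Q_def alg_at_def split: prod.split)

lemma ucmnlk_pol_eq_greedy_policy: "ucmnlk_pol M sel = greedy_policy sel (hist_Q M)"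
  by (simp add: fun_eq_iff ucmnlk_pol_def greedy_policy_def ucmnlk_eq)

locale ucmnlk_run = mnl_mdp +
  fixes sel :: "(nat \<Rightarrow> nat \<Rightarrow> real) \<Rightarrow> nat \<Rightarrow> nat" and s1 :: nat
  assumes sel_in: "\<And>Q s. sel Q s \<in> pA M"
    and sel_max: "\<And>Q s a. a \<in> pA M \<Longrightarrow> Q s a \<le> Q s (sel Q s)"
    and s1: "s1 \<in> pS M"
begin

sublocale greedy_run M P sel "hist_Q M" s1
  by unfold_locales (fact sel_in sel_max s1)+

context
  fixes n :: nat and h :: hist
  assumes h: "h \<in> set_pmf (traj n)"
begin

lemma length_transitions_traj: "length (transitions h) = n"
  using run_pmf_length[OF h] by simp

lemma transitions_traj_nth:
  assumes i: "i < n"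
  shows "transitions h ! i = (state_at h i, action_at h i, state_at h (Suc i))"
    and "state_at h (Suc i) \<in> pSsa M (state_at h i) (action_at h i)"
proof -
  let ?s = "state_at h i" and ?a = "action_at h i"
  have length_h: "length (fst h) = n" by (rule run_pmf_length[OF h])
  have "?s \<in> pS M" using run_state_in[OF greedy_policy_in s1 h] i by simp
  moreover have "hprefix h (Suc i) \<in> set_pmf (step_pmf P \<pi> (hprefix h i))"
    using run_pmf_prefix[OF h i] by blast
  ultimately obtain k where k: "k \<in> pSsa M ?s ?a" "hprefix h (Suc i) = (fst (hprefix h i) @ [(?s, ?a)], k)"
    using set_kernel[OF _ sel_in] by (fastforce simp: step_greedy)
  have "take (Suc i) (fst h) = take i (fst h) @ [(?s, ?a)]"
    using arg_cong[OF k(2), of fst] by (simp add: hprefix_def)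
  then have "fst h ! i = (?s, ?a)" using i length_h by (simp add: take_Suc_conv_app_nth)
  then show "transitions h ! i = (?s, ?a, state_at h (Suc i))"
    using i length_h by (simp add: transitions_nth)
  show "state_at h (Suc i) \<in> pSsa M ?s ?a" using k by simp
qed

lemma mnl_trajectory_transitions: "mnl_trajectory M \<theta>s L\<phi> (transitions h)"
  using transitions_traj_nth run_state_in[OF greedy_policy_in s1 h] sel_in length_transitions_traj
  by unfold_locales auto

theorem regret_le_confident:
  assumes "confident_trajectory M \<theta>s L\<phi> (transitions h) \<kappa> B" and D: "0 < D"
    and \<epsilon>: "path_sum noise n h \<le> \<epsilon>" "0 \<le> \<epsilon>"
  defines "G \<equiv> 2 * real D * ln (real D * (1 + real n))"
  shows "regret \<gamma> (rew M) P (pA M) \<pi> (Suc n) h \<le> horizon *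
    (horizon + \<epsilon> + horizon * (4 * B * sqrt (real n * G) + 60 * B\<^sup>2 * G / \<kappa>) + real n * \<gamma> ^ NN M
      + horizon * G)"
proof -
  let ?xs = "transitions h"
  interpret confident_trajectory M \<theta>s L\<phi> ?xs \<kappa> B by (rule assms(1))
  note length_xs = length_transitions_traj
  interpret optimistic_trajectory M P sel "hist_Q M" s1 n h
    "\<lambda>i. alg_Pset M ?xs (alg_episode M ?xs i)" "NN M" transition_error
  proof
    show "plausible (alg_Pset M ?xs (alg_episode M ?xs i))" if "i \<le> n" for i
      using that alg_episode_le[of i ?xs M] length_xs by (intro plausible_alg_Pset) simp
    show "hist_Q M (hprefix h i) = devi M (alg_Pset M ?xs (alg_episode M ?xs i)) (NN M)" if "i \<le> n" for i
      using that length_xs by (simp add: hist_Q_hprefix alg_Q_eq_devi)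
    show "l1_dist (pSsa M (state_at h i) (action_at h i))
        (p (state_at h i) (action_at h i)) (pmf (P (state_at h i) (action_at h i)))
        \<le> transition_error i"
      if "i < n" "p \<in> alg_Pset M ?xs (alg_episode M ?xs i)" for i p
      using Pset_l1_diameter[OF _ alg_episode_le det_Sigma_le_episode that(2)] that(1) length_xs
      by (simp add: transitions_traj_nth(1))
  qed (rule h)
  have growth: "2 * log_det_growth n \<le> G"
    using log_det_growth_le[OF _ D, of n] length_xs by (simp add: G_def)
  have "(\<Sum>i<n. transition_error i) \<le> 4 * B * sqrt (real n * G) + 60 * B\<^sup>2 * G / \<kappa>"
    using sum_transition_error_le[of G] sum_potential_le[of n] growth length_xs by simp
  moreover have "real (card switches) \<le> G"
    using card_alg_switches_le[of n] growth length_xs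
    by (simp add: switches_def alg_switches_def hist_Q_hprefix cong: conj_cong)
  ultimately show ?thesis
    using horizon_pos by (intro order.trans[OF regret_decomposition[OF \<epsilon>]] mult_left_mono add_mono) auto
qed

theorem regret_le_zero_features:
  assumes L\<phi>: "L\<phi> = 0" and \<epsilon>: "path_sum noise n h \<le> \<epsilon>" "0 \<le> \<epsilon>"
  shows "regret \<gamma> (rew M) P (pA M) \<pi> (Suc n) h \<le> horizon * (horizon + \<epsilon> + real n * \<gamma> ^ NN M)"
proof -
  let ?xs = "transitions h" and ?Q = "alg_Pset M (transitions h) 0"
  interpret mnl_trajectory M \<theta>s L\<phi> ?xs by (rule mnl_trajectory_transitions)
  note length_xs = length_transitions_traj
  have hist_Q: "hist_Q M (hprefix h i) = devi M ?Q (NN M)" if "i \<le> n" for i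
    using that length_xs by (simp add: hist_Q_hprefix alg_Q_zero_features[OF L\<phi>])
  interpret optimistic_trajectory M P sel "hist_Q M" s1 n h "\<lambda>_. ?Q" "NN M" "\<lambda>_. 0"
  proof
    show "plausible ?Q"
      unfolding alg_Pset_def by (intro plausible_Pset mnl_in_Pset_zero_features L\<phi> theta_carrier) simp
    fix i p assume i: "i < n" and "p \<in> ?Q"
    moreover have "state_at h i \<in> pS M" using run_state_in[OF greedy_policy_in s1 h] i by simp
    ultimately show "l1_dist (pSsa M (state_at h i) (action_at h i))
        (p (state_at h i) (action_at h i)) (pmf (P (state_at h i) (action_at h i))) \<le> 0"
      using sel_in unfolding alg_Pset_def mem_Pset_zero_features_iff[OF L\<phi> theta_carrier[OF le0]]
      by (simp add: pmf_trans_pmf)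
  qed (fact h hist_Q)+
  have "switches = {}" by (auto simp: switches_def hist_Q)
  then show ?thesis using regret_decomposition[OF \<epsilon>] by simp
qed

end
end

subsection \<open>Elementary estimates\<close>

lemma power_le_exp_neg:
  fixes \<gamma> :: real
  assumes "0 \<le> \<gamma>"
  shows "\<gamma> ^ N \<le> exp (- (real N * (1 - \<gamma>)))"
proof -
  have "\<gamma> \<le> exp (\<gamma> - 1)" using exp_ge_add_one_self[of "\<gamma> - 1"] by simp
  then have "\<gamma> ^ N \<le> exp (\<gamma> - 1) ^ N" using assms by (rule power_mono)
  then show ?thesis by (simp add: exp_of_nat_mult[symmetric] algebra_simps)
qed

lemma first_order_term_le:
  fixes B F G T d l n :: real
  assumes F: "0 \<le> F" and B: "0 \<le> B" "B \<le> F * sqrt d * l\<^sup>2" and G: "0 \<le> G" "G \<le> 3 * d * l"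
    and n: "0 \<le> n" "n \<le> T" and d: "0 \<le> d" and l: "1 \<le> l"
  shows "4 * B * sqrt (n * G) \<le> 8 * F * (d * sqrt T * l ^ 5)"
proof -
  have "n * G \<le> T * (3 * d * l)" using n G by (intro mult_mono) auto
  also have "\<dots> \<le> T * (4 * d * l\<^sup>2)"
    using n d l by (intro mult_left_mono mult_mono) (auto simp: power2_eq_square mult_le_cancel_left1)
  finally have "sqrt (n * G) \<le> sqrt (T * (4 * d * l\<^sup>2))" by (rule real_sqrt_le_mono)
  also have "\<dots> = 2 * sqrt T * sqrt d * l" using l by (simp add: real_sqrt_mult)
  finally have "4 * B * sqrt (n * G) \<le> 4 * (F * sqrt d * l\<^sup>2) * (2 * sqrt T * sqrt d * l)"
    using B G n by (intro mult_mono) auto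
  also have "\<dots> = 8 * F * ((sqrt d * sqrt d) * sqrt T * l ^ 3)"
    by (simp add: power2_eq_square power3_eq_cube)
  also have "\<dots> \<le> 8 * F * (d * sqrt T * l ^ 5)"
    using F d n l by (intro mult_left_mono mult_mono power_increasing) auto
  finally show ?thesis .
qed

lemma second_order_term_le:
  fixes B F G d l :: real
  assumes B: "0 \<le> B" "B \<le> F * sqrt d * l\<^sup>2" and G: "0 \<le> G" "G \<le> 3 * d * l"
    and d: "0 \<le> d"
  shows "60 * B\<^sup>2 * G \<le> 180 * F\<^sup>2 * (d\<^sup>2 * l ^ 5)"
proof -
  have "B\<^sup>2 \<le> (F * sqrt d * l\<^sup>2)\<^sup>2" using B by (intro power_mono) auto
  also have "\<dots> = F\<^sup>2 * d * l ^ 4" using d by (simp add: power_mult_distrib)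
  finally have "60 * B\<^sup>2 * G \<le> 60 * (F\<^sup>2 * d * l ^ 4) * (3 * d * l)"
    using G d by (intro mult_mono) auto
  also have "\<dots> = 180 * F\<^sup>2 * (d\<^sup>2 * l ^ 5)" by (simp add: power2_eq_square power_numeral_reduce)
  finally show ?thesis .
qed

lemma regret_terms_le:
  fixes A F G X Y \<epsilon> c g :: real
  assumes c: "1 \<le> c" and X: "1 \<le> X" and Y: "0 \<le> Y" and \<epsilon>: "\<epsilon> \<le> 4 * c * X"
    and A: "A \<le> 8 * F * X + 180 * F\<^sup>2 * Y" and g: "g \<le> c * X" and G: "G \<le> 3 * X"
  shows "c * (c + \<epsilon> + c * A + g + c * G) \<le> 180 * (1 + F\<^sup>2) * (c\<^sup>2 * (X + Y))"
proof -
  have "8 * F \<le> 4 * (1 + F\<^sup>2)" using zero_le_power2[of "F - 1"] by (simp add: power2_diff)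
  then have "9 + 8 * F \<le> 180 * (1 + F\<^sup>2)" using zero_le_power2[of F] unfolding distrib_left by linarith
  then have coefficients: "(9 + 8 * F) * X + 180 * F\<^sup>2 * Y \<le> 180 * (1 + F\<^sup>2) * X + 180 * (1 + F\<^sup>2) * Y"
    using X Y by (intro add_mono mult_right_mono) auto
  have "c \<le> c * X" using c X by simp
  then have "c + \<epsilon> + c * A + g + c * G
    \<le> c * X + 4 * c * X + c * (8 * F * X + 180 * F\<^sup>2 * Y) + c * X + c * (3 * X)"
    using c \<epsilon> g A G by (intro add_mono mult_left_mono) auto
  also have "\<dots> = c * ((9 + 8 * F) * X + 180 * F\<^sup>2 * Y)" by (simp add: algebra_simps)
  also have "\<dots> \<le> c * (180 * (1 + F\<^sup>2) * X + 180 * (1 + F\<^sup>2) * Y)"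
    using c by (intro mult_left_mono coefficients) simp
  finally have "c * (c + \<epsilon> + c * A + g + c * G) \<le> c * (c * (180 * (1 + F\<^sup>2) * X + 180 * (1 + F\<^sup>2) * Y))"
    using c by (intro mult_left_mono) auto
  then show ?thesis by (simp add: power2_eq_square algebra_simps)
qed

lemma prob_pmf_ge_diff:
  assumes "a \<le> measure_pmf.prob p E" "measure_pmf.prob p B \<le> b"
    and good: "\<And>x. x \<in> set_pmf p \<Longrightarrow> x \<in> E \<Longrightarrow> x \<notin> B \<Longrightarrow> x \<in> G"
  shows "a - b \<le> measure_pmf.prob p G"
proof -
  have "measure_pmf.prob p E = measure_pmf.prob p (E \<inter> set_pmf p)" by (simp add: measure_Int_set_pmf)
  also have "\<dots> \<le> measure_pmf.prob p (G \<union> B)"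
    using good by (intro measure_pmf.finite_measure_mono) auto
  also have "\<dots> \<le> measure_pmf.prob p G + measure_pmf.prob p B" by (rule measure_Un_le) auto
  finally show ?thesis using assms(1,2) by linarith
qed

lemma four_square_le_regularization:
  fixes L\<theta> L\<phi> U d \<Lambda> :: real
  assumes L: "0 \<le> L\<theta>" "0 \<le> L\<phi>" and U: "1 \<le> U" and d: "1 \<le> d"
    and \<Lambda>: "84 * sqrt 2 * (L\<theta> * L\<phi> ^ 3 + d * L\<phi>\<^sup>2) * (1 / 2 * ln U + (L\<theta> * L\<phi> + 1)) \<le> \<Lambda>"
  shows "4 * L\<phi>\<^sup>2 \<le> \<Lambda>"
proof -
  have "1 \<le> sqrt (2 :: real)" by simp
  then have "4 \<le> 84 * sqrt (2 :: real)" by linarith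
  moreover have "1 * L\<phi>\<^sup>2 \<le> d * L\<phi>\<^sup>2" using d by (intro mult_right_mono) auto
  then have "L\<phi>\<^sup>2 \<le> L\<theta> * L\<phi> ^ 3 + d * L\<phi>\<^sup>2" using L by (simp add: add_increasing)
  moreover have "1 \<le> 1 / 2 * ln U + (L\<theta> * L\<phi> + 1)" using L U by simp
  ultimately have "4 * L\<phi>\<^sup>2 * 1 \<le> (84 * sqrt 2) * (L\<theta> * L\<phi> ^ 3 + d * L\<phi>\<^sup>2) * (1 / 2 * ln U + (L\<theta> * L\<phi> + 1))"
    using L d by (intro mult_mono) auto
  then show ?thesis using \<Lambda> by linarith
qed

subsection \<open>The high-probability bound\<close>

locale ucmnlk_regret = ucmnlk_run +
  fixes T :: nat and \<kappa> \<delta> U F :: real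
  assumes T_ge_1: "1 \<le> T" and dim_pos: "0 < D" and \<kappa>_pos: "0 < \<kappa>"
    and \<delta>_pos: "0 < \<delta>" and \<delta>_less_1: "\<delta> < 1" and U_ge_1: "1 \<le> U"
    and beta_eq: "\<And>t. beta M t = F * sqrt (real D) * (ln (U * real t / \<delta>))\<^sup>2"
    and lam_ge: "4 * L\<phi>\<^sup>2 \<le> lam M"
    and phi_zero: "\<And>s a. s \<in> pS M \<Longrightarrow> a \<in> pA M \<Longrightarrow> \<exists>k\<in>pSsa M s a. phi M s a k = 0\<^sub>v D"
    and NN_ge: "ln (sqrt (real T) / real D) / (1 - \<gamma>) \<le> real (NN M)"
    and kappa_le: "\<And>h i \<theta> k l. h \<in> set_pmf (run_pmf P (ucmnlk_pol M sel) ([], s1) (T - 1)) \<Longrightarrow>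
      i < T \<Longrightarrow> \<theta> \<in> Theta D (Lth M) \<Longrightarrow>
      k \<in> pSsa M (snd (hprefix h i)) (ucmnlk M sel (hprefix h i)) \<Longrightarrow>
      l \<in> pSsa M (snd (hprefix h i)) (ucmnlk M sel (hprefix h i)) \<Longrightarrow>
      \<kappa> \<le> mnl_kernel M \<theta> (snd (hprefix h i)) (ucmnlk M sel (hprefix h i)) k *
          mnl_kernel M \<theta> (snd (hprefix h i)) (ucmnlk M sel (hprefix h i)) l"
begin

definition log_factor :: real where "log_factor = 1 + ln (real T * U / \<delta>)"

definition regret_bound :: real where
  "regret_bound = 180 * (1 + F\<^sup>2) * log_factor ^ 5 *
     (real D * sqrt (real T) / (1 - \<gamma>)\<^sup>2 + (real D)\<^sup>2 / (\<kappa> * (1 - \<gamma>)\<^sup>2))"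

definition main_rate :: real where
  "main_rate = real D * sqrt (real T) * log_factor ^ 5"

definition kappa_rate :: real where
  "kappa_rate = (real D)\<^sup>2 * log_factor ^ 5 / \<kappa>"

definition confident_event :: "hist set" where
  "confident_event = {h. \<forall>t\<in>{1..T}.
     wnorm (alg_Sigma M (transitions h) (t - 1)) (alg_theta M (transitions h) (t - 1) - \<theta>s) \<le> beta M t}"

definition deviation :: real where
  "deviation = 2 * horizon * sqrt (2 * real (T - 1) * ln (1 / \<delta>))"

abbreviation "regret_T h \<equiv> regret \<gamma> (rew M) P (pA M) \<pi> T h"

lemma regret_bound_eq: "regret_bound = 180 * (1 + F\<^sup>2) * (horizon\<^sup>2 * (main_rate + kappa_rate))"
  by (simp add: regret_bound_def main_rate_def kappa_rate_def horizon_def power_divide distrib_left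
      add_divide_distrib mult_ac)

lemma log_argument_ge_1: "1 \<le> t \<Longrightarrow> 1 \<le> U * real t / \<delta>"
  using mult_mono[OF U_ge_1, of 1 "real t"] U_ge_1 \<delta>_pos \<delta>_less_1 by (simp add: pos_le_divide_eq)

lemma log_factor_ge_1: "1 \<le> log_factor"
  using log_argument_ge_1[OF T_ge_1] by (simp add: log_factor_def mult.commute)

lemma ln_le_log_factor:
  assumes "0 < x" "x \<le> real T * U / \<delta>"
  shows "ln x \<le> log_factor"
  using ln_mono[OF assms(2,1)] by (simp add: log_factor_def)

lemma log_factor_le_power: "log_factor \<le> log_factor ^ 5"
  using power_increasing[of 1 5 log_factor] log_factor_ge_1 by simp

lemma kappa_rate_nonneg: "0 \<le> kappa_rate"
  using log_factor_ge_1 \<kappa>_pos by (simp add: kappa_rate_def)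

lemma dim_sqrt_le_main_rate: "real D * sqrt (real T) \<le> main_rate"
proof -
  have "real D * sqrt (real T) * 1 \<le> main_rate"
    unfolding main_rate_def using log_factor_ge_1 by (intro mult_left_mono one_le_power) auto
  then show ?thesis by simp
qed

lemma main_rate_ge_1: "1 \<le> main_rate"
  unfolding main_rate_def using dim_pos T_ge_1 log_factor_ge_1
  by (intro mult_ge1_I one_le_power) auto

lemma regret_bound_ge_linear:
  assumes "sqrt (real T) < real D"
  shows "real T * horizon \<le> regret_bound"
proof -
  have "real T * horizon = sqrt (real T) * sqrt (real T) * horizon" by simp
  also have "\<dots> \<le> real D * sqrt (real T) * horizon\<^sup>2"
    using assms horizon_ge_1 by (intro mult_mono) (auto simp: power2_eq_square)
  also have "\<dots> \<le> (main_rate + kappa_rate) * horizon\<^sup>2"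
    using dim_sqrt_le_main_rate kappa_rate_nonneg by (intro mult_right_mono) auto
  also have "\<dots> = 1 * (horizon\<^sup>2 * (main_rate + kappa_rate))" by simp
  also have "\<dots> \<le> regret_bound"
    unfolding regret_bound_eq using main_rate_ge_1 kappa_rate_nonneg by (intro mult_right_mono) auto
  finally show ?thesis .
qed

lemma deviation_nonneg: "0 \<le> deviation"
  using horizon_pos \<delta>_pos \<delta>_less_1 by (simp add: deviation_def)

lemma deviation_le: "deviation \<le> 4 * horizon * main_rate"
proof -
  have "1 / \<delta> \<le> real T * U / \<delta>"
    using mult_mono[of 1 "real T" 1 U] T_ge_1 U_ge_1 \<delta>_pos by (intro divide_right_mono) auto
  then have "ln (1 / \<delta>) \<le> log_factor" using \<delta>_pos by (intro ln_le_log_factor) auto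
  also have "\<dots> \<le> log_factor\<^sup>2" using log_factor_ge_1 by (simp add: power2_eq_square)
  finally have "2 * real (T - 1) * ln (1 / \<delta>) \<le> 4 * real T * log_factor\<^sup>2"
    using \<delta>_pos \<delta>_less_1 by (intro mult_mono) auto
  then have "sqrt (2 * real (T - 1) * ln (1 / \<delta>)) \<le> sqrt (4 * real T * log_factor\<^sup>2)"
    by (rule real_sqrt_le_mono)
  also have "\<dots> = 2 * (sqrt (real T) * log_factor)" using log_factor_ge_1 by (simp add: real_sqrt_mult)
  also have "sqrt (real T) * log_factor \<le> main_rate"
    unfolding main_rate_def using dim_pos log_factor_ge_1 log_factor_le_power
    by (intro mult_mono) (auto simp: mult_le_cancel_right1)
  finally have "2 * horizon * sqrt (2 * real (T - 1) * ln (1 / \<delta>)) \<le> 2 * horizon * (2 * main_rate)"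
    using horizon_pos by (intro mult_left_mono) auto
  then show ?thesis by (simp add: deviation_def mult_ac)
qed

lemma truncation_error_le: "real (T - 1) * \<gamma> ^ NN M \<le> horizon * main_rate"
proof -
  have "ln (sqrt (real T) / real D) \<le> real (NN M) * (1 - \<gamma>)"
    using NN_ge disc_less_1 by (simp add: pos_divide_le_eq)
  then have "exp (- (real (NN M) * (1 - \<gamma>))) \<le> exp (- ln (sqrt (real T) / real D))" by simp
  also have "\<dots> = real D / sqrt (real T)" using dim_pos T_ge_1 by (simp add: exp_minus)
  finally have "\<gamma> ^ NN M \<le> real D / sqrt (real T)"
    using power_le_exp_neg[OF disc_nonneg, of "NN M"] by linarith
  then have "real (T - 1) * \<gamma> ^ NN M \<le> real T * (real D / sqrt (real T))"
    using disc_nonneg by (intro mult_mono) auto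
  also have "\<dots> = real D * (real T / sqrt (real T))" by simp
  also have "\<dots> = real D * sqrt (real T)" by (simp only: real_div_sqrt[OF of_nat_0_le_iff])
  also have "\<dots> \<le> 1 * main_rate" using dim_sqrt_le_main_rate by simp
  also have "\<dots> \<le> horizon * main_rate" using horizon_ge_1 main_rate_ge_1 by (intro mult_right_mono) auto
  finally show ?thesis .
qed

definition potential_bound :: real where
  "potential_bound = 2 * real D * ln (real D * (1 + real (T - 1)))"

lemma potential_bound_nonneg: "0 \<le> potential_bound"
  using dim_pos T_ge_1 by (auto simp: potential_bound_def intro!: mult_nonneg_nonneg ln_ge_zero mult_ge1_I)

lemma potential_bound_le:
  assumes D: "real D \<le> sqrt (real T)"
  shows "potential_bound \<le> 3 * real D * log_factor"
proof -
  have "ln (real D * real T) \<le> ln (sqrt (real T) * real T)"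
    using dim_pos T_ge_1 D by (intro ln_mono mult_right_mono) auto
  also have "\<dots> = 3 / 2 * ln (real T)" using T_ge_1 by (simp add: ln_mult ln_sqrt)
  also have "ln (real T) \<le> log_factor"
  proof (rule ln_le_log_factor)
    have "real T * \<delta> \<le> real T * U" using \<delta>_less_1 U_ge_1 by (intro mult_left_mono) auto
    then show "real T \<le> real T * U / \<delta>" using \<delta>_pos by (simp add: pos_le_divide_eq)
  qed (use T_ge_1 in simp)
  finally have "2 * real D * ln (real D * real T) \<le> 2 * real D * (3 / 2 * log_factor)"
    by (intro mult_left_mono) auto
  then show ?thesis using T_ge_1 by (simp add: potential_bound_def of_nat_diff mult_ac)
qed

lemma potential_bound_le_main_rate:
  assumes "real D \<le> sqrt (real T)"
  shows "potential_bound \<le> 3 * main_rate"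
proof -
  have "real D * log_factor \<le> main_rate"
    unfolding main_rate_def using T_ge_1 log_factor_ge_1 log_factor_le_power
    by (intro mult_mono) (auto simp: mult_le_cancel_left1)
  then show ?thesis using potential_bound_le[OF assms] by simp
qed

lemma F_nonneg:
  assumes "h \<in> confident_event"
  shows "0 \<le> F"
proof -
  have "0 \<le> lam M" using lam_ge zero_le_power2[of L\<phi>] by linarith
  then have "0 \<le> wnorm (lam M \<cdot>\<^sub>m 1\<^sub>m D) (0\<^sub>v D - \<theta>s)"
    using \<theta>s_carrier by (intro wnorm_nonneg[OF psd_smult_one]) simp_all
  also have "\<dots> \<le> beta M 1"
    using assms T_ge_1 by (force simp: confident_event_def alg_at_0)
  finally have "0 \<le> F * sqrt (real D) * (ln (U / \<delta>))\<^sup>2" by (simp add: beta_eq)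
  moreover have "0 < ln (U / \<delta>)" using U_ge_1 \<delta>_pos \<delta>_less_1 by (intro ln_gt_zero) simp
  ultimately show ?thesis using dim_pos by (simp add: zero_le_mult_iff)
qed

lemma beta_mono:
  assumes F: "0 \<le> F" and t: "1 \<le> t" "t \<le> T"
  shows "beta M t \<le> beta M T"
proof -
  have "U * real t / \<delta> \<le> U * real T / \<delta>"
    using U_ge_1 \<delta>_pos t by (intro divide_right_mono mult_left_mono) auto
  then have "ln (U * real t / \<delta>) \<le> ln (U * real T / \<delta>)"
    using log_argument_ge_1[OF t(1)] by (intro ln_mono) auto
  then show ?thesis
    unfolding beta_eq using log_argument_ge_1[OF t(1)] F by (intro mult_left_mono power_mono) auto
qed

lemma beta_T_le:
  assumes F: "0 \<le> F"
  shows "beta M T \<le> F * sqrt (real D) * log_factor\<^sup>2"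
  unfolding beta_eq using F log_argument_ge_1[OF T_ge_1]
  by (intro mult_left_mono power_mono) (auto simp: log_factor_def mult.commute)

context
  fixes h :: hist
  assumes h: "h \<in> set_pmf (traj (T - 1))" and event: "h \<in> confident_event"
begin

lemma confident_trajectory_transitions:
  assumes "0 < lam M"
  shows "confident_trajectory M \<theta>s L\<phi> (transitions h) \<kappa> (beta M T)"
proof -
  interpret mnl_trajectory M \<theta>s L\<phi> "transitions h" by (rule mnl_trajectory_transitions[OF h])
  note length_xs = length_transitions_traj[OF h]
  show ?thesis
  proof
    show "\<exists>k\<in>pSsa M (sx i) (ax i). phi M (sx i) (ax i) k = 0\<^sub>v D" if "i < length (transitions h)" for i
      using transitions_valid[OF that] by (intro phi_zero) auto
    show "wnorm (\<Sigma> j) (\<theta>h j - \<theta>s) \<le> beta M (Suc j)" if "j \<le> length (transitions h)" for j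
      using event that length_xs T_ge_1 by (force simp: confident_event_def)
    show "beta M (Suc j) \<le> beta M T" if "j \<le> length (transitions h)" for j
      using that length_xs T_ge_1 by (intro beta_mono F_nonneg[OF event]) auto
    show "\<kappa> \<le> mnl_kernel M \<theta> (sx i) (ax i) k * mnl_kernel M \<theta> (sx i) (ax i) l"
      if "i < length (transitions h)" "\<theta> \<in> Theta D (Lth M)"
        and "k \<in> pSsa M (sx i) (ax i)" "l \<in> pSsa M (sx i) (ax i)" for i \<theta> k l
      using kappa_le[of h i \<theta> k l] h that length_xs
      by (simp add: ucmnlk_pol_eq_greedy_policy ucmnlk_eq transitions_traj_nth(1)[OF h])
  qed (use assms lam_ge \<kappa>_pos in auto)
qed

lemma regret_le_bound:
  assumes D: "real D \<le> sqrt (real T)" and noise: "path_sum noise (T - 1) h \<le> deviation"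
  shows "regret_T h \<le> regret_bound"
proof -
  note F = F_nonneg[OF event]
  note terms_le = regret_terms_le[OF horizon_ge_1 main_rate_ge_1 kappa_rate_nonneg deviation_le _
      truncation_error_le, of _ F, folded regret_bound_eq]
  have T: "Suc (T - 1) = T" using T_ge_1 by simp
  show ?thesis
  proof (cases "0 < lam M")
    case True
    interpret confident: confident_trajectory M \<theta>s L\<phi> "transitions h" \<kappa> "beta M T"
      by (rule confident_trajectory_transitions[OF True])
    note estimates = confident.B_nonneg beta_T_le[OF F] potential_bound_nonneg potential_bound_le[OF D]
    have "60 * (beta M T)\<^sup>2 * potential_bound / \<kappa> \<le> 180 * F\<^sup>2 * kappa_rate"
      unfolding kappa_rate_def using second_order_term_le[OF estimates] \<kappa>_pos
      by (simp add: divide_right_mono)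
    moreover have "4 * beta M T * sqrt (real (T - 1) * potential_bound) \<le> 8 * F * main_rate"
      unfolding main_rate_def by (rule first_order_term_le[OF F estimates]) (use log_factor_ge_1 in auto)
    ultimately have transition_cost: "4 * beta M T * sqrt (real (T - 1) * potential_bound)
        + 60 * (beta M T)\<^sup>2 * potential_bound / \<kappa> \<le> 8 * F * main_rate + 180 * F\<^sup>2 * kappa_rate"
      by simp
    from regret_le_confident[OF h confident.confident_trajectory_axioms dim_pos noise deviation_nonneg]
    show ?thesis
      unfolding T potential_bound_def[symmetric]
      by (rule order.trans) (rule terms_le[OF transition_cost potential_bound_le_main_rate[OF D]])
  next
    case False
    then have "L\<phi>\<^sup>2 \<le> 0" using lam_ge by linarith
    then have "L\<phi> = 0" by simp
    from regret_le_zero_features[OF h this noise deviation_nonneg, unfolded T] show ?thesis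
      using terms_le[of 0 0] F main_rate_ge_1 kappa_rate_nonneg by simp
  qed
qed

end

theorem regret_bound_whp:
  assumes event: "1 - \<delta> \<le> measure_pmf.prob (run_pmf P (ucmnlk_pol M sel) ([], s1) (T - 1)) confident_event"
  shows "1 - 2 * \<delta> \<le> measure_pmf.prob (run_pmf P (ucmnlk_pol M sel) ([], s1) (T - 1))
    {h. regret \<gamma> (rew M) P (pA M) (ucmnlk_pol M sel) T h \<le> regret_bound}"
  unfolding ucmnlk_pol_eq_greedy_policy
proof (cases "sqrt (real T) < real D")
  case True
  have "regret_T h \<le> regret_bound" if "h \<in> set_pmf (traj (T - 1))" for h
    using regret_le_horizon[OF greedy_policy_in s1 that] regret_bound_ge_linear[OF True] T_ge_1 by simp
  then have "measure_pmf.prob (traj (T - 1)) {h. regret_T h \<le> regret_bound} = 1"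
    by (subst measure_pmf.prob_eq_1) (auto simp: AE_measure_pmf_iff)
  then show "1 - 2 * \<delta> \<le> measure_pmf.prob (traj (T - 1)) {h. regret_T h \<le> regret_bound}" using \<delta>_pos by simp
next
  case False
  have "1 - \<delta> - \<delta> \<le> measure_pmf.prob (traj (T - 1)) {h. regret_T h \<le> regret_bound}"
  proof (rule prob_pmf_ge_diff)
    show "1 - \<delta> \<le> measure_pmf.prob (traj (T - 1)) confident_event"
      using event by (simp add: ucmnlk_pol_eq_greedy_policy)
    show "measure_pmf.prob (traj (T - 1)) {h. deviation < path_sum noise (T - 1) h} \<le> \<delta>"
      unfolding deviation_def by (rule noise.azuma_hoeffding_whp[OF \<delta>_pos \<delta>_less_1])
  qed (use regret_le_bound False in auto)
  then show "1 - 2 * \<delta> \<le> measure_pmf.prob (traj (T - 1)) {h. regret_T h \<le> regret_bound}" by simp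
qed

end

theorem theorem4:
  fixes f0 :: "real \<Rightarrow> real \<Rightarrow> real"
  assumes "poly2 f0"
  shows "\<exists>f :: real \<Rightarrow> real \<Rightarrow> real. \<exists>k :: nat. poly2 f \<and>
   (\<forall>(S::nat set) (A::nat set) (r::nat \<Rightarrow> nat \<Rightarrow> real) (Ssa::nat \<Rightarrow> nat \<Rightarrow> nat set)
      (\<phi>::nat \<Rightarrow> nat \<Rightarrow> nat \<Rightarrow> real Matrix.vec) (d::nat) (\<theta>s::real Matrix.vec) (L\<theta>::real) (L\<phi>::real)
      (\<gamma>::real) (\<kappa>::real) (\<delta>::real) (\<eta>::real) (lam0::real) (N::nat) (T::nat) (s1::nat)
      (sel::(nat \<Rightarrow> nat \<Rightarrow> real) \<Rightarrow> nat \<Rightarrow> nat).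
    let U = UU S A Ssa;
        P = trans_pmf \<phi> Ssa \<theta>s;
        M = \<lparr>pS = S, pA = A, rew = r, pSsa = Ssa, phi = \<phi>, dim = d, Lth = L\<theta>, disc = \<gamma>,
             eta = \<eta>, lam = lam0, del = \<delta>, NN = N, beta = beta0 f0 L\<theta> L\<phi> d U \<delta>\<rparr>;
        \<pi> = ucmnlk_pol M sel;
        traj = run_pmf P \<pi> ([], s1) (T - 1)
    in
     (finite S \<and> finite A \<and> A \<noteq> {} \<and> s1 \<in> S \<and>
      (\<forall>s\<in>S. \<forall>a\<in>A. 0 \<le> r s a \<and> r s a \<le> 1) \<and>
      (\<forall>s\<in>S. \<forall>a\<in>A. Ssa s a \<subseteq> S \<and> Ssa s a \<noteq> {}) \<and>
      0 < d \<and> (\<forall>s\<in>S. \<forall>a\<in>A. \<forall>s'\<in>Ssa s a. \<phi> s a s' \<in> carrier_vec d) \<and> \<theta>s \<in> carrier_vec d \<and>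
      (\<forall>s\<in>S. \<forall>a\<in>A. \<forall>s'\<in>Ssa s a. vnorm (\<phi> s a s') \<le> L\<phi>) \<and> vnorm \<theta>s \<le> L\<theta> \<and>
      0 < \<kappa> \<and> \<kappa> < 1 \<and>
      (\<forall>h\<in>set_pmf traj. \<forall>i<T. \<forall>\<theta>\<in>Theta d L\<theta>.
          \<forall>s'\<in>Ssa (snd (hprefix h i)) (ucmnlk M sel (hprefix h i)).
          \<forall>s''\<in>Ssa (snd (hprefix h i)) (ucmnlk M sel (hprefix h i)).
            mnl \<phi> Ssa \<theta> (snd (hprefix h i)) (ucmnlk M sel (hprefix h i)) s' *
            mnl \<phi> Ssa \<theta> (snd (hprefix h i)) (ucmnlk M sel (hprefix h i)) s'' \<ge> \<kappa>) \<and>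
      (\<forall>s\<in>S. \<forall>a\<in>A. \<exists>s'\<in>Ssa s a. \<phi> s a s' = 0\<^sub>v d) \<and>
      0 \<le> \<gamma> \<and> \<gamma> < 1 \<and> 0 < \<delta> \<and> \<delta> < 1 \<and> 1 \<le> T \<and>
      \<eta> = 1/2 * ln (real U) + (L\<theta> * L\<phi> + 1) \<and>
      lam0 \<ge> 84 * sqrt 2 * (L\<theta> * L\<phi> ^ 3 + real d * L\<phi> ^ 2) * \<eta> \<and>
      real N \<ge> ln (sqrt (real T) / real d) / (1 - \<gamma>) \<and>
      (\<forall>Q s. sel Q s \<in> A \<and> (\<forall>a\<in>A. Q s a \<le> Q s (sel Q s))) \<and>
      measure_pmf.prob traj
        {h. \<forall>t\<in>{1..T}. case alg_state M (take (t - 1) (transitions h)) of (\<theta>h, \<Sigma>, _, _) \<Rightarrow>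
              wnorm \<Sigma> (\<theta>h - \<theta>s) \<le> beta0 f0 L\<theta> L\<phi> d U \<delta> t} \<ge> 1 - \<delta>
    \<longrightarrow>
      measure_pmf.prob traj
        {h. regret \<gamma> r P A \<pi> T h \<le>
              f L\<theta> L\<phi> * (1 + ln (real T * real U / \<delta>)) ^ k *
              (real d * sqrt (real T) / (1 - \<gamma>) ^ 2 + real d ^ 2 / (\<kappa> * (1 - \<gamma>) ^ 2))}
        \<ge> 1 - 2 * \<delta>))"
proof (intro exI[of _ "\<lambda>x y. 180 * (1 + (f0 x y)\<^sup>2)"] exI[of _ 5] conjI allI, unfold Let_def, goal_cases)
  case 1
  show ?case unfolding power2_eq_square by (intro poly2_mult poly2_add poly2_const assms)
next
  case (2 S A r Ssa \<phi> d \<theta>s L\<theta> L\<phi> \<gamma> \<kappa> \<delta> \<eta> lam0 N T s1 sel)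
  define M where "M = \<lparr>pS = S, pA = A, rew = r, pSsa = Ssa, phi = \<phi>, dim = d, Lth = L\<theta>, disc = \<gamma>,
    eta = \<eta>, lam = lam0, del = \<delta>, NN = N, beta = beta0 f0 L\<theta> L\<phi> d (UU S A Ssa) \<delta>\<rparr>"
  have M_fields [simp]: "pS M = S" "pA M = A" "rew M = r" "pSsa M = Ssa" "phi M = \<phi>"
    "dim M = d" "Lth M = L\<theta>" "disc M = \<gamma>" "lam M = lam0" "NN M = N"
    "beta M = beta0 f0 L\<theta> L\<phi> d (UU S A Ssa) \<delta>"
    by (simp_all add: M_def)
  show ?case
    unfolding M_def[symmetric]
  proof (rule impI, goal_cases)
    case hyps: 1
    interpret run: ucmnlk_run M \<theta>s L\<phi> sel s1
      using hyps by unfold_locales (auto simp: Theta_def)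
    have lam_ge: "4 * L\<phi>\<^sup>2 \<le> lam0"
      by (rule four_square_le_regularization
            [OF run.Lth_nonneg run.L\<phi>_nonneg[OF run.s1] run.UU_ge_1[OF run.s1], where d = "real d"])
        (use hyps in auto)
    interpret ucmnlk_regret M \<theta>s L\<phi> sel s1 T \<kappa> \<delta> "real (UU S A Ssa)" "f0 L\<theta> L\<phi>"
      by unfold_locales (use hyps lam_ge run.UU_ge_1[OF run.s1] in \<open>auto simp: beta0_def\<close>)
    have "1 - \<delta> \<le> measure_pmf.prob (run_pmf run.P (ucmnlk_pol M sel) ([], s1) (T - 1)) confident_event"
      using hyps by (simp add: confident_event_def alg_Sigma_def alg_theta_def alg_at_def case_prod_beta)
    from regret_bound_whp[OF this] show ?case by (simp add: regret_bound_def log_factor_def)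
  qed
qed

end
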